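(* Let $N\ge 3$ be an integer, and let a tiling of the regular $N$-gon $R_N$ with triangles of angles $\alpha,\beta,\gamma$ be given, where $\alpha,\beta,\gamma$ are rational multiples of $\pi$. Let $V_1,\ldots,V_N$ be the vertices of $R_N$, and let $p_j,q_j,r_j$ be the number of angles $\alpha,\beta,\gamma$, respectively, of the tiles meeting at $V_j$. If $N\ne 6$, then $p_j+q_j+r_j\le 2$ for every $j=1,\ldots,N$; that is, each angle of $R_N$ is packed with at most two tiles.
   Context: A tiling of a polygon $A$ is a decomposition of $A$ into finitely many nonoverlapping polygons (pairwise disjoint interiors, union $A$); no other condition is imposed, so two pieces may share a boundary point without sharing a common side. Here all tiles are triangles with angles $\alpha,\beta,\gamma$ (hence similar to each other, possibly of different sizes and possibly reflected). In each tile the three angles are labelled $\alpha,\beta,\gamma$, so that the numbers $p_j,q_j,r_j$ are defined. *)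

theory Defs
  imports "HOL-Analysis.Analysis"
begin

definition vertex_angle :: "complex \<Rightarrow> complex \<Rightarrow> complex \<Rightarrow> real" where
  "vertex_angle P Q R = arccos (((P - Q) \<bullet> (R - Q)) / (norm (P - Q) * norm (R - Q)))"

text \<open>A tile is an ordered triple of vertices. The order carries the labelling of the angles:
  the angle at the first, second, third vertex is labelled alpha, beta, gamma. When some of
  the three values coincide, each admissible labelling is allowed. Size and orientation of
  the triangle are not restricted.\<close>

type_synonym tile = "complex \<times> complex \<times> complex"

definition region :: "tile \<Rightarrow> complex set" where
  "region = (\<lambda>(A, B, C). convex hull {A, B, C})"

definition triangle_with_angles :: "real \<Rightarrow> real \<Rightarrow> real \<Rightarrow> tile \<Rightarrow> bool" where
  "triangle_with_angles \<alpha> \<beta> \<gamma> = (\<lambda>(A, B, C).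
     \<not> collinear {A, B, C} \<and>
     vertex_angle C A B = \<alpha> \<and> vertex_angle A B C = \<beta> \<and> vertex_angle B C A = \<gamma>)"

text \<open>Distinct triples must have disjoint interiors, so a triangle cannot occur in a tiling
  under two different labellings.\<close>

definition is_tiling :: "complex set \<Rightarrow> real \<Rightarrow> real \<Rightarrow> real \<Rightarrow> tile set \<Rightarrow> bool" where
  "is_tiling P \<alpha> \<beta> \<gamma> T \<longleftrightarrow>
     finite T \<and>
     (\<forall>t\<in>T. triangle_with_angles \<alpha> \<beta> \<gamma> t) \<and>
     pairwise (\<lambda>s t. interior (region s) \<inter> interior (region t) = {}) T \<and>
     (\<Union>t\<in>T. region t) = P"

text \<open>The regular \<open>N\<close>-gon with centre \<open>c\<close> and first vertex \<open>c + w\<close>, in arbitrary position and of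
  arbitrary size; it is non-degenerate for nonzero \<open>w\<close>. The vertices are indexed by
  \<open>1, \<dots>, N\<close>.\<close>

definition ngon_vertex :: "nat \<Rightarrow> complex \<Rightarrow> complex \<Rightarrow> nat \<Rightarrow> complex" where
  "ngon_vertex N c w j = c + w * cis (2 * pi * (real j - 1) / real N)"

definition regular_ngon :: "nat \<Rightarrow> complex \<Rightarrow> complex \<Rightarrow> complex set" where
  "regular_ngon N c w = convex hull (ngon_vertex N c w ` {1..N})"

definition num_alpha :: "tile set \<Rightarrow> complex \<Rightarrow> nat" where
  "num_alpha T V = card {t \<in> T. fst t = V}"

definition num_beta :: "tile set \<Rightarrow> complex \<Rightarrow> nat" where
  "num_beta T V = card {t \<in> T. fst (snd t) = V}"

definition num_gamma :: "tile set \<Rightarrow> complex \<Rightarrow> nat" where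
  "num_gamma T V = card {t \<in> T. snd (snd t) = V}"

end

theory Submission
  imports Defs "HOL-Computational_Algebra.Polynomial_Factorial" "HOL-Number_Theory.Cong"
begin

text \<open>Let the angles be multiples of \<open>\<pi>/n\<close> and let \<open>\<zeta> = exp (i \<pi>/n)\<close>. For \<open>k\<close> coprime to \<open>2n\<close>
  there is an additive map \<open>\<Psi>\<close> of the plane with \<open>\<Psi> (\<zeta> z) = \<zeta>\<^sup>k \<Psi> z\<close>. It maps the tiles
  to triangles with angles \<open>k\<alpha>, k\<beta>, k\<gamma>\<close> modulo \<open>\<pi>\<close>, either preserving the orientation of all tiles
  or reversing all of them, and it maps the polygon to the star polygon \<open>{N/k}\<close>. Interior edges
  cancel, so up to a common sign the image triangles cover a point as often as the star polygon
  winds around it. If \<open>{k/N} < 1/2\<close>, then near a vertex this winding number is the indicator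
  function of an angle \<open>(1 - 2{k/N})\<pi>\<close>; hence three tiles with angles \<open>x\<pi>, y\<pi>, z\<pi>\<close> at a vertex of
  the polygon satisfy \<open>{kx} + {ky} + {kz} \<le> 1 - 2{k/N}\<close>.

  For \<open>k = 1\<close> this shows that the three angles are not \<open>\<alpha>, \<beta>, \<gamma>\<close>, so two of them are equal, say to
  \<open>a\<pi>\<close>. Then \<open>{ka} + {k/N} < 1/2\<close>, so that \<open>\<parallel>k(a + 1/N)\<parallel> = \<parallel>ka\<parallel> + \<parallel>k/N\<parallel>\<close> for all \<open>k\<close> coprime to \<open>2n\<close>,
  where \<open>\<parallel>x\<parallel>\<close> is the distance to the nearest integer. Multipliers \<open>k\<close> that add \<open>1/2\<close> to the
  fractions with the largest power of \<open>2\<close> in the denominator, and multipliers that double the odd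
  part of all fractions, show that this is possible only for \<open>N = 6\<close>.\<close>

section \<open>Conjugate roots of unity\<close>

text \<open>The map \<Psi> need not be continuous, so neither sets nor areas survive it: only
  vertices are mapped, and a tile is replaced by the triangle of its mapped vertices. What does
  survive is that points on a line whose direction is \<open>w\<close> times a power of \<zeta> stay
  collinear, because \<Psi> takes reals to reals. Hence every side of every tile must first be shown
  to have such a direction. Moreover, interior edges must cancel although tiles may meet along parts
  of sides and \<Psi> may destroy the order of points on a line. Cancellation is therefore stated
  for every function \<open>g\<close> of a direction and a point, an edge from \<open>A\<close> to
  \<open>B\<close> of direction \<open>e\<close> contributing \<open>g e B - g e A\<close>, which
  telescopes along any subdivision. Crossing numbers with a vertical ray serve as winding numbers
  because each of them is such a difference. Multipliers with {k/N} > 1/2 are reached through -k,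
  which leaves the equation between distances unchanged. The hexagon survives because 1/6 = 1/2 -
  1/3 and 1/3 is the fixed point of x -> 1 - 2x, the second branch of doubling on distances.\<close>

definition ipoly :: "int poly \<Rightarrow> complex \<Rightarrow> complex" where
  "ipoly f z = poly (map_poly of_int f) z"

lemma ipoly_0 [simp]: "ipoly 0 z = 0"
  by (simp add: ipoly_def)

lemma ipoly_pCons [simp]: "ipoly (pCons a f) z = of_int a + z * ipoly f z"
  by (simp add: ipoly_def map_poly_pCons)

lemma ipoly_add [simp]: "ipoly (f + g) z = ipoly f z + ipoly g z"
  by (induction f g rule: poly_induct2) (simp_all add: algebra_simps)

lemma ipoly_smult [simp]: "ipoly (smult c f) z = of_int c * ipoly f z"
  by (induction f) (simp_all add: algebra_simps)

lemma ipoly_mult [simp]: "ipoly (f * g) z = ipoly f z * ipoly g z"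
  by (induction f) (simp_all add: algebra_simps)

lemma ipoly_1 [simp]: "ipoly 1 z = 1"
  by (simp add: one_pCons)

lemma ipoly_power [simp]: "ipoly (f ^ n) z = ipoly f z ^ n"
  by (induction n) simp_all

lemma ipoly_diff [simp]: "ipoly (f - g) z = ipoly f z - ipoly g z"
  using ipoly_add[of "f - g" g z] by simp

lemma ipoly_monom [simp]: "ipoly (monom c n) z = of_int c * z ^ n"
  by (induction n) (simp_all add: monom_0 monom_Suc)

lemma ipoly_sum [simp]: "ipoly (sum f A) z = (\<Sum>i\<in>A. ipoly (f i) z)"
  by (induction A rule: infinite_finite_induct) simp_all

lemma ipoly_of_nat [simp]: "ipoly (of_nat m) z = of_nat m"
  by (induction m) simp_all

lemma ipoly_pcompose [simp]: "ipoly (pcompose f g) z = ipoly f (ipoly g z)"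
  by (induction f) (simp_all add: pcompose_pCons)

section \<open>The Frobenius congruence and minimal polynomials over the integers\<close>

lemma prime_dvd_power_add:
  fixes x y :: "'a::comm_ring_1"
  assumes "prime p"
  shows "of_nat p dvd (x + y) ^ p - (x ^ p + y ^ p)"
proof -
  have p: "p > 0" using assms prime_gt_0_nat by blast
  have split: "{..p} = insert 0 (insert p {1..<p})" using p by auto
  have "(x + y) ^ p = (\<Sum>k\<le>p. of_nat (p choose k) * x ^ k * y ^ (p - k))"
    by (rule binomial_ring)
  also have "\<dots> = x ^ p + y ^ p + (\<Sum>k\<in>{1..<p}. of_nat (p choose k) * x ^ k * y ^ (p - k))"
    unfolding split using p by (simp add: algebra_simps)
  finally have "(x + y) ^ p - (x ^ p + y ^ p) = (\<Sum>k\<in>{1..<p}. of_nat (p choose k) * x ^ k * y ^ (p - k))"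
    by simp
  moreover have "of_nat p dvd (\<Sum>k\<in>{1..<p}. of_nat (p choose k) * x ^ k * y ^ (p - k))"
  proof (rule dvd_sum)
    fix k assume "k \<in> {1..<p}"
    hence k: "0 < k" "k < p" by auto
    hence "k * (p choose k) = p * ((p - 1) choose (k - 1))"
      using binomial_absorption[of "k - 1" p] by simp
    hence "p dvd k * (p choose k)" by simp
    moreover have "\<not> p dvd k" using k by (auto dest: dvd_imp_le)
    ultimately have "p dvd (p choose k)" using assms prime_dvd_mult_iff by blast
    hence "(of_nat p :: 'a) dvd of_nat (p choose k)" by (metis dvd_def of_nat_mult)
    thus "(of_nat p :: 'a) dvd of_nat (p choose k) * x ^ k * y ^ (p - k)" by (simp add: mult.assoc)
  qed
  ultimately show ?thesis by simp
qed

text \<open>Fermat's little theorem: induction over natural bases with the Frobenius congruence,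
  then reduction modulo \<open>p\<close> for the negative ones. It handles the coefficients in
  \<open>frobenius_pcompose\<close>.\<close>

lemma prime_dvd_power_self_diff:
  fixes a :: int
  assumes "prime p"
  shows "int p dvd a ^ p - a"
proof -
  have nat_case: "int p dvd int m ^ p - int m" for m
  proof (induction m)
    case 0
    then show ?case using assms prime_gt_0_nat by (simp add: power_0_left)
  next
    case (Suc m)
    have "int p dvd (int m + 1) ^ p - (int m ^ p + 1 ^ p)"
      using prime_dvd_power_add[OF assms, of "int m" 1] by simp
    from dvd_add[OF this Suc.IH] show ?case by (simp add: algebra_simps)
  qed
  have "int p dvd (a mod int p) ^ p - a mod int p"
    using nat_case[of "nat (a mod int p)"] assms prime_gt_0_nat by (simp add: )
  moreover have "[(a mod int p) ^ p - a mod int p = a ^ p - a] (mod int p)"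
    by (intro cong_diff cong_pow) (auto simp: cong_def)
  ultimately show ?thesis
    using cong_dvd_iff by blast
qed

text \<open>Modulo \<open>p\<close> the p-th power is additive, and by Fermat it fixes each integer
  coefficient, so only the exponents of the variable are multiplied by \<open>p\<close>.\<close>

lemma frobenius_pcompose:
  fixes f :: "int poly"
  assumes "prime p"
  shows "of_nat p dvd pcompose f (monom 1 p) - f ^ p"
proof (induction f)
  case 0
  then show ?case using assms prime_gt_0_nat by (simp add: power_0_left)
next
  case (pCons a f)
  have pC: "pCons a f = [:a:] + [:0, 1:] * f" by simp
  have X: "[:0, 1:] ^ p = (monom 1 p :: int poly)" by (simp add: monom_altdef)
  have "of_nat p dvd pCons a f ^ p - ([:a:] ^ p + ([:0, 1:] * f) ^ p)"
    unfolding pC by (rule prime_dvd_power_add[OF assms])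
  moreover have "(of_nat p :: int poly) dvd [:a:] ^ p - [:a:]"
  proof -
    from prime_dvd_power_self_diff[OF assms, of a] obtain b where "a ^ p - a = int p * b" by (elim dvdE)
    hence "[:a:] ^ p - [:a:] = of_nat p * [:b:]"
      by (simp add: poly_const_pow of_nat_poly)
    thus ?thesis by (metis dvd_triv_left)
  qed
  moreover have "of_nat p dvd monom 1 p * (pcompose f (monom 1 p) - f ^ p)"
    using pCons.IH by simp
  ultimately have "of_nat p dvd monom 1 p * (pcompose f (monom 1 p) - f ^ p)
      - (pCons a f ^ p - ([:a:] ^ p + ([:0, 1:] * f) ^ p)) - ([:a:] ^ p - [:a:])"
    by (metis dvd_diff)
  moreover have "\<dots> = pcompose (pCons a f) (monom 1 p) - pCons a f ^ p"
    using power_mult_distrib[of "[:0, 1:]" f p] by (simp add: pcompose_pCons X algebra_simps)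
  ultimately show ?case by argo
qed

text \<open>Gauss's lemma makes the divisibility hold over the integers: an annihilating polynomial
  of least degree is replaced by its primitive part.\<close>

lemma minimal_int_poly:
  assumes "z ^ M = 1" "M > 0"
  obtains f where "ipoly f z = 0" "\<And>P. ipoly P z = 0 \<Longrightarrow> f dvd P"
proof -
  define Q where "Q f \<longleftrightarrow> f \<noteq> 0 \<and> ipoly f z = 0" for f :: "int poly"
  have "degree (monom 1 M :: int poly) \<noteq> degree (1 :: int poly)"
    using assms by (simp add: degree_monom_eq)
  hence "monom 1 M - 1 \<noteq> (0 :: int poly)" by force
  hence "Q (monom 1 M - 1)" using assms by (simp add: Q_def)
  then obtain h where h: "Q h" "\<And>g. Q g \<Longrightarrow> degree h \<le> degree g"
    using ex_has_least_nat[of Q _ degree] by blast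
  define f where "f = primitive_part h"
  have hf: "h = smult (content h) f" by (simp add: f_def)
  have "content h \<noteq> 0" using h by (simp add: Q_def)
  have f0: "ipoly f z = 0"
    using h(1) \<open>content h \<noteq> 0\<close> by (metis Q_def hf ipoly_smult mult_eq_0_iff of_int_eq_0_iff)
  have fn: "f \<noteq> 0" using h(1) hf by (auto simp: Q_def)
  have deg: "degree f = degree h" using \<open>content h \<noteq> 0\<close> hf by (metis degree_smult_eq)
  have cf: "content f = 1" using h(1) by (simp add: Q_def f_def)
  have "f dvd P" if P: "ipoly P z = 0" for P
  proof -
    \<comment> \<open>Pseudo-division avoids fractions at the price of a power \<open>c\<close> of
      the leading coefficient. As \<open>f\<close> is primitive, \<open>c\<close> divides the
      content of the quotient and can be cancelled again.\<close>
    obtain q r where qr: "pseudo_divmod P f = (q, r)" by force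
    define c where "c = coeff f (degree f) ^ (Suc (degree P) - degree f)"
    have e: "smult c P = f * q + r" "r = 0 \<or> degree r < degree f"
      using pseudo_divmod[OF fn qr] by (auto simp: c_def)
    have "ipoly r z = 0" using arg_cong[OF e(1), of "\<lambda>t. ipoly t z"] P f0 by simp
    hence "r = 0" using e(2) h(2)[of r] deg by (force simp: Q_def)
    have "c \<noteq> 0" using fn by (simp add: c_def)
    have "content (smult c P) = content q"
      using e(1) \<open>r = 0\<close> cf by (simp add: content_mult)
    hence "c dvd content q" by (metis content_smult dvd_mult2 dvd_normalize_iff dvd_refl normalize_dvd_iff dvd_triv_left)
    hence "[:c:] dvd q" by (simp add: const_poly_dvd_iff_dvd_content)
    then obtain q' where "q = [:c:] * q'" by blast
    hence "smult c P = smult c (f * q')" using e(1) \<open>r = 0\<close> by simp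
    hence "smult c (P - f * q') = 0" by (simp add: smult_diff_right)
    hence "P = f * q'" using \<open>c \<noteq> 0\<close> by simp
    thus ?thesis by simp
  qed
  with f0 that show thesis by blast
qed

text \<open>Let \<open>f\<close> be the primitive minimal polynomial of \<open>z\<close> and \<open>X\<^sup>M - 1 = f g\<close>. Since \<open>f(z) = 0\<close>, the
  Frobenius congruence shows that \<open>f(z\<^sup>p)\<close> is divisible by \<open>p\<close> in \<open>\<int>[z]\<close>. If \<open>f(z\<^sup>p) \<noteq> 0\<close>, then
  \<open>g(z\<^sup>p) = 0\<close>, and differentiating \<open>X\<^sup>M - 1 = f g\<close> shows that \<open>f(z\<^sup>p)\<close> divides \<open>M\<close> times a unit;
  this is impossible for \<open>p \<nmid> M\<close>.\<close>

lemma root_of_unity_prime_power_root: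
  assumes z: "z ^ M = 1" and "M > 0" and p: "prime p" and np: "\<not> p dvd M" and P: "ipoly P z = 0"
  shows "ipoly P (z ^ p) = 0"
proof -
  obtain f where f: "ipoly f z = 0" and fd: "\<And>P. ipoly P z = 0 \<Longrightarrow> f dvd P"
    using minimal_int_poly[OF z \<open>M > 0\<close>] by metis
  have "f dvd monom 1 M - 1" by (rule fd) (use z in simp)
  then obtain g where g: "monom 1 M - 1 = f * g" by blast
  have zz: "(z ^ p) ^ M = 1" by (metis z power_commutes power_mult power_one mult.commute)
  have "ipoly f (z ^ p) = 0"
  proof (rule ccontr)
    assume nz: "ipoly f (z ^ p) \<noteq> 0"
    obtain h where h: "pcompose f (monom 1 p) - f ^ p = of_nat p * h"
      using frobenius_pcompose[OF p, of f] by (elim dvdE)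
    have "p > 0" using p prime_gt_0_nat by blast
    have fz: "ipoly f (z ^ p) = of_nat p * ipoly h z"
      using arg_cong[OF h, of "\<lambda>t. ipoly t z"] f \<open>p > 0\<close> by (simp add: power_0_left)
    have "ipoly f (z ^ p) * ipoly g (z ^ p) = 0"
      using arg_cong[OF g, of "\<lambda>t. ipoly t (z ^ p)"] zz by simp
    hence gz: "ipoly g (z ^ p) = 0" using nz by simp
    have "pderiv (monom 1 M - 1 :: int poly) = f * pderiv g + g * pderiv f"
      unfolding g by (simp add: pderiv_mult)
    hence "monom (int M) (M - 1) = f * pderiv g + g * pderiv f"
      by (simp add: pderiv_diff pderiv_monom)
    from arg_cong[OF this, of "\<lambda>t. ipoly t (z ^ p)"]
    have "of_nat M * (z ^ p) ^ (M - 1) = of_nat p * ipoly h z * ipoly (pderiv g) (z ^ p)"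
      using gz fz by simp
    moreover have "(z ^ p) ^ (M - 1) * z ^ p = 1"
      using zz \<open>M > 0\<close> by (simp flip: power_Suc2)
    ultimately have "of_nat M = of_nat p * ipoly h z * ipoly (pderiv g) (z ^ p) * z ^ p"
      by (metis mult.assoc mult.right_neutral)
    \<comment> \<open>The equation says that \<open>p\<close> divides \<open>M\<close> in the ring
      generated by \<open>z\<close>. Read as a polynomial vanishing at \<open>z\<close>, it becomes
      a divisibility by \<open>f\<close>.\<close>
    hence "ipoly (smult (int p) (h * pcompose (pderiv g) (monom 1 p) * monom 1 p) - [:int M:]) z = 0"
      by (simp add: mult.assoc)
    from fd[OF this] obtain k
      where k: "smult (int p) (h * pcompose (pderiv g) (monom 1 p) * monom 1 p) - [:int M:] = f * k"
      by blast
    define Q where "Q = h * pcompose (pderiv g) (monom 1 p) * monom 1 p"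
    have Q: "f * k = smult (int p) Q - [:int M:]" using k by (simp add: Q_def)
    have "f \<noteq> 0" using nz by auto
    have "degree f > 0"
    proof (rule ccontr)
      assume "\<not> degree f > 0"
      then obtain a where "f = [:a:]" by (metis degree_0_id neq0_conv)
      thus False using f nz by simp
    qed
    have "coeff (f * g) M = 1" unfolding g[symmetric] using \<open>M > 0\<close> by simp
    have "degree (f * g) = M" unfolding g[symmetric]
      using \<open>M > 0\<close> by (intro antisym degree_le le_degree) (auto simp: coeff_eq_0 degree_monom_eq)
    hence "lead_coeff f * lead_coeff g = 1"
      using \<open>coeff (f * g) M = 1\<close> by (metis lead_coeff_mult)
    hence unit: "is_unit (lead_coeff f)" by (metis dvd_triv_left)
    \<comment> \<open>Descending induction on the index. Modulo \<open>p\<close> the product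
      \<open>f * k\<close> is constant, while \<open>f\<close> has positive degree and a unit as
      leading coefficient, so a top coefficient of \<open>k\<close> that is nonzero modulo
      \<open>p\<close> would show up in positive degree.\<close>
    have all: "int p dvd coeff k i" for i
    proof (induction "degree k - i" arbitrary: i rule: less_induct)
      case less
      show ?case
      proof (cases "i > degree k")
        case True
        then show ?thesis by (simp add: coeff_eq_0)
      next
        case False
        have "coeff (f * k) (degree f + i) = (\<Sum>j\<le>degree f + i. coeff f j * coeff k (degree f + i - j))"
          by (simp add: coeff_mult)
        also have "\<dots> = (\<Sum>j\<in>insert (degree f) {..<degree f}. coeff f j * coeff k (degree f + i - j))"
          by (rule sum.mono_neutral_right) (auto simp: coeff_eq_0)
        also have "\<dots> = lead_coeff f * coeff k i + (\<Sum>j<degree f. coeff f j * coeff k (degree f + i - j))"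
          by simp
        finally have e: "lead_coeff f * coeff k i
            = coeff (f * k) (degree f + i) - (\<Sum>j<degree f. coeff f j * coeff k (degree f + i - j))" by simp
        have "int p dvd coeff (f * k) (degree f + i)"
          using \<open>degree f > 0\<close> by (simp add: Q coeff_pCons split: nat.split)
        moreover have "int p dvd (\<Sum>j<degree f. coeff f j * coeff k (degree f + i - j))"
        proof (rule dvd_sum)
          fix j assume "j \<in> {..<degree f}"
          hence "int p dvd coeff k (degree f + i - j)"
          proof (cases "degree f + i - j > degree k")
            case True
            then show ?thesis by (simp add: coeff_eq_0)
          next
            case nle: False
            show ?thesis by (rule less) (use nle \<open>j \<in> _\<close> in auto)
          qed
          thus "int p dvd coeff f j * coeff k (degree f + i - j)" by simp
        qed
        ultimately have "int p dvd lead_coeff f * coeff k i" unfolding e by (rule dvd_diff)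
        thus ?thesis using unit by (simp add: dvd_mult_unit_iff')
      qed
    qed
    have "int p dvd coeff (f * k) 0" using all by (simp add: coeff_mult)
    hence "int p dvd int p * coeff Q 0 - int M" unfolding Q by simp
    hence "int p dvd int M" by (metis dvd_diff_commute dvd_triv_left dvd_diff_left_iff zdvd_zdiffD)
    thus False using np by simp
  qed
  moreover obtain q where "P = f * q" using fd[OF P] by blast
  ultimately show ?thesis by simp
qed

text \<open>Induction over the prime factors of \<open>k\<close>: the power \<open>z ^ l\<close> is
  again an M-th root of unity, so the prime case can be applied to it in place of
  \<open>z\<close>.\<close>

theorem root_of_unity_conjugate:
  assumes "z ^ M = 1" and "M > 0" and "coprime k M" and "ipoly P z = 0"
  shows "ipoly P (z ^ k) = 0"
  using assms(3)
proof (induction k rule: less_induct)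
  case (less k)
  show ?case
  proof (cases "k \<le> 1")
    case True
    thus ?thesis using assms less.prems
      by (cases "k = 0") (auto simp: le_Suc_eq)
  next
    case False
    then obtain p where p: "prime p" "p dvd k" using prime_factor_nat[of k] by auto
    then obtain l where l: "k = p * l" by blast
    have "l < k" "coprime l M" "coprime p M"
      using l False less.prems prime_gt_1_nat[OF p(1)] by (auto intro: Nat.gr0I)
    hence "ipoly P (z ^ l) = 0" using less.IH by blast
    moreover have "(z ^ l) ^ M = 1" by (metis assms(1) power_commutes power_mult power_one mult.commute)
    moreover have "\<not> p dvd M" using \<open>coprime p M\<close> p(1) coprime_absorb_left not_prime_unit by blast
    ultimately have "ipoly P ((z ^ l) ^ p) = 0"
      using root_of_unity_prime_power_root assms(2) p(1) by blast
    thus ?thesis by (simp add: l power_mult mult.commute)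
  qed
qed

section \<open>Additive maps that conjugate cosines\<close>

lemma rational_relation_conjugate:
  fixes q :: "nat \<Rightarrow> rat"
  assumes "M > 0" "coprime k M" and J: "\<And>j. j \<in> J \<Longrightarrow> j < M"
    and rel: "(\<Sum>j\<in>J. of_rat (q j) * cos (2 * pi * real j / real M)) = (0::real)"
  shows "(\<Sum>j\<in>J. of_rat (q j) * cos (2 * pi * real k * real j / real M)) = (0::real)"
proof -
  have fin: "finite J" using J by (meson finite_nat_iff_bounded lessThan_iff subsetI)
  define z where "z = cis (2 * pi / real M)"
  have zM: "z ^ M = 1" using \<open>M > 0\<close> unfolding z_def Complex.DeMoivre by simp
  define d where "d = (\<Prod>j\<in>J. snd (quotient_of (q j)))"
  define a where "a j = fst (quotient_of (q j)) * (\<Prod>i\<in>J - {j}. snd (quotient_of (q i)))" for j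
  have pos: "snd (quotient_of (q j)) > 0" for j by (rule quotient_of_denom_pos')
  have "d > 0" unfolding d_def by (intro prod_pos) (use pos in auto)
  have da: "of_int d * (of_rat (q j) :: real) = of_int (a j)" if "j \<in> J" for j
  proof -
    have "q j = of_int (fst (quotient_of (q j))) / of_int (snd (quotient_of (q j)))"
      by (metis prod.collapse quotient_of_div)
    hence "(of_rat (q j) :: real) = of_int (fst (quotient_of (q j))) / of_int (snd (quotient_of (q j)))"
      by (metis of_rat_divide of_rat_of_int_eq)
    moreover have "d = snd (quotient_of (q j)) * (\<Prod>i\<in>J - {j}. snd (quotient_of (q i)))"
      unfolding d_def using fin that by (rule prod.remove)
    ultimately show ?thesis using pos[of j] by (simp add: a_def field_simps)
  qed
  \<comment> \<open>At an M-th root of unity on the unit circle the powers with exponents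
    \<open>j\<close> and \<open>M - j\<close> are complex conjugates, so \<open>P\<close> takes a
    real value there, twice a sum of cosines. The same \<open>P\<close> is evaluated at
    \<open>z\<close> and at \<open>z ^ k\<close>.\<close>
  define P where "P = (\<Sum>j\<in>J. smult (a j) (monom 1 j + monom 1 (M - j)))"
  have ev: "ipoly P (cis t) = of_real (2 * (\<Sum>j\<in>J. of_int (a j) * cos (real j * t)))"
    if "cis t ^ M = 1" for t
  proof -
    have "cis t ^ (M - j) = cnj (cis t ^ j)" if "j \<in> J" for j
    proof -
      have "cis t ^ (M - j) * cis t ^ j = 1"
        using J[OF that] \<open>cis t ^ M = 1\<close> by (simp flip: power_add)
      moreover have "cnj (cis t ^ j) * cis t ^ j = 1"
        by (simp add: cis_cnj cis_mult flip: power_mult_distrib)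
      ultimately show ?thesis by (metis mult_cancel_right cis_neq_zero power_not_zero)
    qed
    hence "ipoly P (cis t) = (\<Sum>j\<in>J. of_int (a j) * (cis t ^ j + cnj (cis t ^ j)))"
      unfolding P_def by simp
    also have "\<dots> = (\<Sum>j\<in>J. of_real (of_int (a j) * (2 * cos (real j * t))))"
      by (intro sum.cong refl) (simp only: complex_add_cnj Complex.DeMoivre cis.sel of_real_mult of_real_of_int_eq)
    finally show ?thesis by (simp add: sum_distrib_left algebra_simps)
  qed
  have scale: "of_int d * (\<Sum>j\<in>J. of_rat (q j) * c j) = (\<Sum>j\<in>J. of_int (a j) * c j)" for c :: "nat \<Rightarrow> real"
    unfolding sum_distrib_left by (intro sum.cong refl) (use da in \<open>simp flip: mult.assoc\<close>)
  have "ipoly P z = 0"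
    using ev[of "2 * pi / real M"] zM scale[of "\<lambda>j. cos (2 * pi * real j / real M)"] rel
    by (simp add: z_def mult.commute del: of_real_sum of_real_mult)
  hence "ipoly P (z ^ k) = 0" using root_of_unity_conjugate zM assms by blast
  moreover have zk: "z ^ k = cis (2 * pi * real k / real M)" unfolding z_def Complex.DeMoivre by (simp add: mult_ac)
  moreover have "cis (2 * pi * real k / real M) ^ M = 1"
    using zM by (metis zk power_commutes power_mult power_one mult.commute)
  ultimately have "(\<Sum>j\<in>J. of_int (a j) * cos (real j * (2 * pi * real k / real M))) = (0::real)"
    using ev[of "2 * pi * real k / real M"] by (simp del: of_real_mult of_real_sum)
  hence "of_int d * (\<Sum>j\<in>J. of_rat (q j) * cos (2 * pi * real k * real j / real M)) = (0::real)"
    unfolding scale by (simp add: algebra_simps)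
  thus ?thesis using \<open>d > 0\<close> by simp
qed

text \<open>The reals are regarded as a vector space over the rationals. \<open>L\<close> is
  prescribed on a basis selected from the cosines themselves; since rational relations are preserved
  by conjugation, the remaining cosines follow.\<close>

lemma additive_cos_conjugate:
  assumes "M > 0" "coprime k M"
  shows "\<exists>L :: real \<Rightarrow> real. (\<forall>x y. L (x + y) = L x + L y) \<and>
    (\<forall>j<M. L (cos (2 * pi * real j / real M)) = cos (2 * pi * real k * real j / real M))"
proof -
  define sc where "sc = (\<lambda>(q::rat) (x::real). of_rat q * x)"
  interpret V: vector_space sc
    by unfold_locales (auto simp: sc_def algebra_simps of_rat_add of_rat_mult)
  interpret VP: vector_space_pair sc sc ..
  define c where "c j = cos (2 * pi * real j / real M)" for j
  define c' where "c' j = cos (2 * pi * real k * real j / real M)" for j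
  obtain B where B: "B \<subseteq> c ` {..<M}" "V.independent B" "c ` {..<M} \<subseteq> V.span B"
    using V.maximal_independent_subset by metis
  have finB: "finite B" using B(1) finite_surj by blast
  define i where "i b = (SOME j. j < M \<and> c j = b)" for b
  have i: "i b < M \<and> c (i b) = b" if "b \<in> B" for b
  proof -
    have "\<exists>j. j < M \<and> c j = b" using that B(1) by auto
    thus ?thesis unfolding i_def by (rule someI_ex)
  qed
  have inj: "inj_on i B" using i by (metis inj_onI)
  obtain L where L: "Vector_Spaces.linear sc sc L" "\<forall>b\<in>B. L b = c' (i b)"
    using VP.linear_independent_extend[OF B(2), of "\<lambda>b. c' (i b)"] by blast
  interpret L: Vector_Spaces.linear sc sc L by fact
  have "L (c j) = c' j" if "j < M" for j
  proof -
    have "c j \<in> V.span B" using B(3) that by blast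
    then obtain u where u: "c j = (\<Sum>b\<in>B. sc (u b) b)"
      unfolding V.span_finite[OF finB] by blast
    have Lu: "L (c j) = (\<Sum>b\<in>B. of_rat (u b) * c' (i b))"
      unfolding u L.sum using L(2) by (intro sum.cong refl) (simp add: L.scale, simp add: sc_def)
    \<comment> \<open>Coefficients, indexed by exponents, of the relation that expresses
      \<open>c j\<close> in the basis. The two contributions are kept apart because \<open>j\<close>
      may itself be the index chosen for a basis element.\<close>
    define q where "q l = (if l \<in> i ` B then u (the_inv_into B i l) else 0) - (if l = j then 1 else 0)" for l
    have sums: "(\<Sum>l\<in>insert j (i ` B). of_rat (q l) * f l) = (\<Sum>b\<in>B. of_rat (u b) * f (i b)) - f j"
      for f :: "nat \<Rightarrow> real"
    proof -
      have "(\<Sum>l\<in>insert j (i ` B). of_rat (q l) * f l)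
        = (\<Sum>l\<in>insert j (i ` B). of_rat (if l \<in> i ` B then u (the_inv_into B i l) else 0) * f l)
          - (\<Sum>l\<in>insert j (i ` B). (if l = j then f l else 0))"
        unfolding sum_subtractf[symmetric]
        by (intro sum.cong refl) (auto simp: q_def of_rat_diff algebra_simps)
      also have "(\<Sum>l\<in>insert j (i ` B). of_rat (if l \<in> i ` B then u (the_inv_into B i l) else 0) * f l)
        = (\<Sum>l\<in>i ` B. of_rat (u (the_inv_into B i l)) * f l)"
        by (rule sum.mono_neutral_cong_right) (use finB in auto)
      also have "\<dots> = (\<Sum>b\<in>B. of_rat (u b) * f (i b))"
        by (subst sum.reindex[OF inj]) (simp add: the_inv_into_f_f[OF inj])
      also have "(\<Sum>l\<in>insert j (i ` B). (if l = j then f l else 0)) = f j"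
        using finB by (simp add: sum.delta)
      finally show ?thesis .
    qed
    have "(\<Sum>l\<in>insert j (i ` B). of_rat (q l) * c l) = 0"
      unfolding sums u using i by (simp add: sc_def)
    hence "(\<Sum>l\<in>insert j (i ` B). of_rat (q l) * c' l) = 0"
      unfolding c_def c'_def
      by (rule rational_relation_conjugate[OF assms, rotated]) (use i that in auto)
    thus ?thesis unfolding sums Lu by simp
  qed
  moreover have "L (x + y) = L x + L y" for x y by (rule L.add)
  ultimately show ?thesis unfolding c_def c'_def by blast
qed

text \<open>A vector space over an infinite field is not a finite union of proper subspaces: in the
  induction step \<open>r\<close> has to avoid only one ratio for each functional. This yields one
  map that is nonzero on all the lengths in question.\<close>

lemma finite_nonvanishing_combination:
  fixes \<phi> :: "'b \<Rightarrow> ('a \<Rightarrow> real) \<Rightarrow> real"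
  assumes "finite S"
    and lin: "\<And>s f g r. \<lbrakk>s \<in> S; f \<in> V; g \<in> V\<rbrakk> \<Longrightarrow> \<phi> s (\<lambda>x. f x + r * g x) = \<phi> s f + r * \<phi> s g"
    and V: "\<And>f g r. \<lbrakk>f \<in> V; g \<in> V\<rbrakk> \<Longrightarrow> (\<lambda>x. f x + r * g x) \<in> V" "V \<noteq> {}"
    and ex: "\<And>s. s \<in> S \<Longrightarrow> \<exists>f\<in>V. \<phi> s f \<noteq> 0"
  shows "\<exists>f\<in>V. \<forall>s\<in>S. \<phi> s f \<noteq> 0"
  using assms(1) lin ex
proof (induction S)
  case empty
  then show ?case using V by auto
next
  case (insert s S)
  have "\<exists>f\<in>V. \<forall>s\<in>S. \<phi> s f \<noteq> 0" by (rule insert.IH) (use insert.prems in auto)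
  then obtain f where f: "f \<in> V" "\<forall>t\<in>S. \<phi> t f \<noteq> 0" by blast
  obtain g where g: "g \<in> V" "\<phi> s g \<noteq> 0" using insert.prems by blast
  have "finite ((\<lambda>t. - \<phi> t f / \<phi> t g) ` insert s S)" using insert.hyps by simp
  then obtain r where r: "r \<notin> (\<lambda>t. - \<phi> t f / \<phi> t g) ` insert s S"
    using ex_new_if_finite infinite_UNIV_char_0 by blast
  have "\<phi> t (\<lambda>x. f x + r * g x) \<noteq> 0" if t: "t \<in> insert s S" for t
  proof
    assume "\<phi> t (\<lambda>x. f x + r * g x) = 0"
    hence e: "\<phi> t f + r * \<phi> t g = 0" using insert.prems(1)[OF t f(1) g(1)] by simp
    show False
    proof (cases "\<phi> t g = 0")
      case True
      hence "t \<noteq> s" "\<phi> t f = 0" using g e by auto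
      thus False using f t by auto
    next
      case False
      hence "r = - \<phi> t f / \<phi> t g" using e by (simp add: field_simps)
      thus False using r t by blast
    qed
  qed
  thus ?case using V(1)[OF f(1) g(1)] by blast
qed

text \<open>For additive \<open>L\<close> the sum \<open>\<Psi> x = (\<Sum>j<M. \<zeta>\<^bsup>-kj\<^esup> L (Re (\<zeta>\<^sup>j x)))\<close> is the projection of \<open>L \<circ> Re\<close> to the
  maps on which multiplication by \<open>\<zeta>\<close> acts as \<open>\<zeta>\<^sup>k\<close>; the conjugacy of \<open>\<zeta>\<close> and \<open>\<zeta>\<^sup>k\<close> enters only in
  choosing \<open>L\<close> such that \<open>\<Psi>\<close> does not vanish.\<close>

theorem conjugation_map:
  assumes M: "M > 0" and "coprime k M" and S: "finite S" "0 \<notin> S"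
  obtains \<Psi> :: "complex \<Rightarrow> complex"
  where "\<And>x y. \<Psi> (x + y) = \<Psi> x + \<Psi> y"
    and "\<And>x. \<Psi> (cis (2 * pi / real M) * x) = cis (2 * pi * real k / real M) * \<Psi> x"
    and "\<And>r. \<Psi> (of_real r) \<in> \<real>"
    and "\<And>s. s \<in> S \<Longrightarrow> \<Psi> (of_real s) \<noteq> 0"
proof -
  define F where "F L x j = cis (- (2 * pi * real k * real j / real M)) *
      of_real (L (Re (cis (2 * pi * real j / real M) * x)))" for L :: "real \<Rightarrow> real" and x j
  define \<Psi> where "\<Psi> L x = (\<Sum>j<M. F L x j)" for L x
  define V where "V = {L :: real \<Rightarrow> real. \<forall>x y. L (x + y) = L x + L y}"
  have "\<exists>L\<in>V. \<forall>s\<in>S. Re (\<Psi> L (of_real s)) \<noteq> 0"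
  proof (rule finite_nonvanishing_combination[OF S(1)])
    show "Re (\<Psi> (\<lambda>x. f x + r * g x) (of_real s)) = Re (\<Psi> f (of_real s)) + r * Re (\<Psi> g (of_real s))" for f g r s
      by (simp add: \<Psi>_def F_def sum_distrib_left algebra_simps flip: sum.distrib)
    show "(\<lambda>x. f x + r * g x) \<in> V" if "f \<in> V" "g \<in> V" for f g r
      using that by (simp add: V_def algebra_simps)
    have "(\<lambda>x. 0) \<in> V" by (simp add: V_def)
    thus "V \<noteq> {}" by blast
    fix s assume "s \<in> S"
    hence "s \<noteq> 0" using S by auto
    obtain L where L: "\<forall>x y. L (x + y) = L x + L y"
      "\<forall>j<M. L (cos (2 * pi * real j / real M)) = cos (2 * pi * real k * real j / real M)"
      using additive_cos_conjugate assms by metis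
    \<comment> \<open>Rescaling the argument by \<open>s\<close> makes every term a conjugated
      cosine times itself; the term for j = 0 is 1, so the sum cannot vanish.\<close>
    have "Re (\<Psi> (\<lambda>x. L (x / s)) (of_real s)) = (\<Sum>j<M. cos (2 * pi * real k * real j / real M) ^ 2)"
      using \<open>s \<noteq> 0\<close> L(2) by (simp add: \<Psi>_def F_def power2_eq_square)
    also have "\<dots> \<ge> cos (2 * pi * real k * real 0 / real M) ^ 2"
      by (rule member_le_sum) (use M in auto)
    finally have "Re (\<Psi> (\<lambda>x. L (x / s)) (of_real s)) \<noteq> 0" by simp
    moreover have "(\<lambda>x. L (x / s)) \<in> V" using L(1) by (simp add: V_def add_divide_distrib)
    ultimately show "\<exists>f\<in>V. Re (\<Psi> f (of_real s)) \<noteq> 0" by blast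
  qed
  then obtain L where L: "L \<in> V" "\<forall>s\<in>S. Re (\<Psi> L (of_real s)) \<noteq> 0" by blast
  have add: "L (x + y) = L x + L y" for x y using L by (simp add: V_def)
  have L0: "L 0 = 0" using add[of 0 0] by simp
  have per: "cis (t * real M / real M) = cis t" for t using M by simp
  show thesis
  proof (rule that[of "\<Psi> L"])
    have "F L (x + y) j = F L x j + F L y j" for x y j
      unfolding F_def distrib_left plus_complex.simps add of_real_add by simp
    thus "\<Psi> L (x + y) = \<Psi> L x + \<Psi> L y" for x y
      unfolding \<Psi>_def by (simp add: sum.distrib)
    show "\<Psi> L (of_real s) \<noteq> 0" if "s \<in> S" for s using L that by force
    show "\<Psi> L (cis (2 * pi / real M) * x) = cis (2 * pi * real k / real M) * \<Psi> L x" for x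
    proof -
      have "F L x M = F L x 0"
      proof -
        have "cis (- (2 * pi * real k * real M / real M)) = 1"
          using M cis_multiple_2pi[of "- real k"] by (simp add: algebra_simps)
        moreover have "cis (2 * pi * real M / real M) = 1" using M by simp
        ultimately show ?thesis by (simp add: F_def)
      qed
      hence shift: "(\<Sum>j<M. F L x (Suc j)) = (\<Sum>j<M. F L x j)"
        by (metis sum.lessThan_Suc_shift sum.lessThan_Suc add.commute add_left_cancel)
      have "F L (cis (2 * pi / real M) * x) j = cis (2 * pi * real k / real M) * F L x (Suc j)" for j
      proof -
        have "cis (2 * pi * real j / real M) * (cis (2 * pi / real M) * x) = cis (2 * pi * real (Suc j) / real M) * x"
          unfolding mult.assoc[symmetric] cis_mult by (simp add: algebra_simps add_divide_distrib)
        moreover have "cis (- (2 * pi * real k * real j / real M)) = cis (2 * pi * real k / real M) * cis (- (2 * pi * real k * real (Suc j) / real M))"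
          unfolding cis_mult by (simp add: algebra_simps add_divide_distrib)
        ultimately show ?thesis by (simp only: F_def mult.assoc)
      qed
      thus ?thesis unfolding \<Psi>_def by (simp add: shift flip: sum_distrib_left)
    qed
    show "\<Psi> L (of_real r) \<in> \<real>" for r
    proof -
      \<comment> \<open>Up to sign these are the imaginary parts of the terms; they are odd under
        the reflection of \<open>j\<close> to \<open>M - j\<close>.\<close>
      define G where "G j = sin (2 * pi * real k * real j / real M) * L (cos (2 * pi * real j / real M) * r)" for j
      have ref: "G (M - j) = - G j" if "j \<in> {1..<M}" for j
      proof -
        have a: "2 * pi * real k * real (M - j) / real M = 2 * pi * real k - 2 * pi * real k * real j / real M"
          using that by (simp add: of_nat_diff field_simps)
        have b: "2 * pi * real (M - j) / real M = 2 * pi - 2 * pi * real j / real M"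
          using that by (simp add: of_nat_diff field_simps)
        have "sin (2 * pi * real k) = 0" "cos (2 * pi * real k) = 1"
          using sin_int_2pin[of "int k"] cos_int_2pin[of "int k"] by (auto simp: mult.commute mult.left_commute)
        thus ?thesis unfolding G_def a b by (simp add: sin_diff cos_diff)
      qed
      have "(\<Sum>j\<in>{1..<M}. G j) = (\<Sum>j\<in>{1..<M}. G (M - j))"
        by (rule sum.reindex_bij_witness[of _ "\<lambda>j. M - j" "\<lambda>j. M - j"]) auto
      also have "\<dots> = - (\<Sum>j\<in>{1..<M}. G j)" using ref by (simp add: sum_negf)
      finally have z: "(\<Sum>j\<in>{1..<M}. G j) = 0" by simp
      have "{..<M} = insert 0 {1..<M}" using M by auto
      hence "(\<Sum>j<M. G j) = 0" using z by (simp add: G_def)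
      hence "Im (\<Psi> L (of_real r)) = 0" by (simp add: \<Psi>_def F_def G_def sum_negf)
      thus ?thesis by (simp add: complex_is_Real_iff)
    qed
  qed
qed

section \<open>Distance to the nearest integer\<close>

definition dist_int :: "real \<Rightarrow> real" where
  "dist_int x = min (frac x) (1 - frac x)"

lemma dist_int_bounds: "0 \<le> dist_int x" "dist_int x \<le> 1 / 2"
  using frac_ge_0[of x] frac_lt_1[of x] by (auto simp: dist_int_def min_def)

lemma dist_int_unique:
  assumes "\<bar>x - of_int m\<bar> \<le> 1 / 2"
  shows "dist_int x = \<bar>x - of_int m\<bar>"
proof (cases "x \<ge> of_int m")
  case True
  hence "frac x = x - of_int m" using assms by (intro frac_unique_iff[THEN iffD2]) auto
  thus ?thesis using True assms by (auto simp: dist_int_def min_def)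
next
  case False
  hence "frac x = x - of_int (m - 1)" using assms by (intro frac_unique_iff[THEN iffD2]) auto
  thus ?thesis using False assms by (auto simp: dist_int_def min_def)
qed

lemma dist_int_witness: obtains m :: int where "\<bar>x - of_int m\<bar> = dist_int x"
proof (cases "frac x \<le> 1 / 2")
  case True
  hence "\<bar>x - of_int \<lfloor>x\<rfloor>\<bar> = dist_int x"
    using frac_ge_0[of x] unfolding dist_int_def min_def by (auto simp: frac_def)
  thus thesis by (rule that)
next
  case False
  hence "\<bar>x - of_int (\<lfloor>x\<rfloor> + 1)\<bar> = dist_int x"
    using frac_lt_1[of x] unfolding dist_int_def min_def by (auto simp: frac_def)
  thus thesis by (rule that)
qed

lemma dist_int_add_int:
  assumes "y - x \<in> \<int>"
  shows "dist_int y = dist_int x"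
proof -
  obtain l where l: "y - x = of_int l" using assms by (elim Ints_cases)
  obtain m where m: "\<bar>x - of_int m\<bar> = dist_int x" by (rule dist_int_witness)
  have "y - of_int (m + l) = x - of_int m" using l by simp
  thus ?thesis using dist_int_unique[of y "m + l"] m dist_int_bounds(2)[of x] by presburger
qed

lemma dist_int_minus: "dist_int (- x) = dist_int x"
proof -
  obtain m where "\<bar>x - of_int m\<bar> = dist_int x" by (rule dist_int_witness)
  thus ?thesis using dist_int_unique[of "- x" "- m"] dist_int_bounds(2)[of x] by (simp add: abs_minus_commute)
qed

lemma dist_int_half: "dist_int (x + 1 / 2) = 1 / 2 - dist_int x"
proof -
  obtain m where m: "\<bar>x - of_int m\<bar> = dist_int x" by (rule dist_int_witness)
  show ?thesis
  proof (cases "x \<ge> of_int m")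
    case True
    thus ?thesis using m dist_int_unique[of "x + 1 / 2" "m + 1"] dist_int_bounds[of x] by simp
  next
    case False
    thus ?thesis using m dist_int_unique[of "x + 1 / 2" "m"] dist_int_bounds[of x] by simp
  qed
qed

text \<open>Doubling acts on distances as the tent map of the interval from 0 to 1/2, with fixed
  points 0 and 1/3.\<close>

lemma dist_int_double:
  "dist_int (2 * x) = (if dist_int x \<le> 1 / 4 then 2 * dist_int x else 1 - 2 * dist_int x)"
proof -
  obtain m where m: "\<bar>x - of_int m\<bar> = dist_int x" by (rule dist_int_witness)
  consider "dist_int x \<le> 1 / 4" | "dist_int x > 1 / 4" "x \<ge> of_int m" | "dist_int x > 1 / 4" "x < of_int m"
    by linarith
  thus ?thesis
  proof cases
    case 1
    moreover have "\<bar>2 * x - of_int (2 * m)\<bar> = 2 * dist_int x" unfolding m[symmetric] by (simp add: abs_if)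
    ultimately show ?thesis using dist_int_unique[of "2 * x" "2 * m"] by simp
  next
    case 2
    thus ?thesis using m dist_int_unique[of "2 * x" "2 * m + 1"] dist_int_bounds[of x] by simp
  next
    case 3
    thus ?thesis using m dist_int_unique[of "2 * x" "2 * m - 1"] dist_int_bounds[of x] by simp
  qed
qed

lemma dist_int_eq_0_iff: "dist_int x = 0 \<longleftrightarrow> x \<in> \<int>"
  unfolding dist_int_def min_def frac_eq_0_iff[symmetric]
  using frac_lt_1[of x] by (auto simp del: frac_eq_0_iff)

lemma dist_int_small: "\<lbrakk>0 \<le> x; x \<le> 1 / 2\<rbrakk> \<Longrightarrow> dist_int x = x"
  using dist_int_unique[of x 0] by simp

section \<open>Orbits under doubling\<close>

lemma no_additive_doubling_orbit:
  assumes sum: "\<And>j. dist_int (2 ^ j * p) = dist_int (2 ^ j * q) + dist_int (2 ^ j * r)"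
    and pos: "\<And>j. dist_int (2 ^ j * q) > 0" "\<And>j. dist_int (2 ^ j * r) > 0"
  shows False
proof -
  \<comment> \<open>A left side above 1/4 is folded by doubling, while at most one term on the right
    can be. Comparison with the undoubled equation then forces a term to be 0 or the left side to be
    1/4. Without folding, the left side would double forever, although it is bounded.\<close>
  have small: "dist_int (2 ^ j * p) \<le> 1 / 4" for j
  proof (rule ccontr)
    assume "\<not> ?thesis"
    moreover have "dist_int (2 * (2 ^ j * p)) = dist_int (2 * (2 ^ j * q)) + dist_int (2 * (2 ^ j * r))"
      using sum[of "Suc j"] by (simp add: mult.assoc)
    ultimately show False
      using sum[of j] pos[of j] dist_int_bounds[of "2 ^ j * p"] unfolding dist_int_double
      by (auto split: if_splits)
  qed
  have pw: "dist_int (2 ^ j * p) = 2 ^ j * dist_int p" for j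
  proof (induction j)
    case (Suc j)
    show ?case using Suc small[of j] dist_int_double[of "2 ^ j * p"] by (simp add: mult.assoc)
  qed simp
  have "dist_int p > 0" using sum[of 0] pos[of 0] by simp
  then obtain j where "1 / dist_int p < 2 ^ j" using real_arch_pow[of 2] by auto
  hence "1 < 2 ^ j * dist_int p" using \<open>dist_int p > 0\<close> by (simp add: field_simps)
  thus False using small[of j] pw[of j] by simp
qed

text \<open>If the distance of an iterate of \<open>r\<close> were at most 1/4, the other two would
  exceed 1/4, and the doubled equation would make it exactly 1/4, so that its double has the
  excluded distance 1/2. Hence the orbit follows x -> 1 - 2x, which doubles the deviation from the
  fixed point 1/3.\<close>

lemma doubling_orbit_third:
  assumes sum: "\<And>j. dist_int (2 ^ j * p) + dist_int (2 ^ j * q) + dist_int (2 ^ j * r) = 1"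
    and less: "\<And>j. dist_int (2 ^ j * p) < 1 / 2" "\<And>j. dist_int (2 ^ j * q) < 1 / 2" "\<And>j. dist_int (2 ^ j * r) < 1 / 2"
  shows "dist_int r = 1 / 3"
proof -
  have large: "dist_int (2 ^ j * r) > 1 / 4" for j
  proof (rule ccontr)
    assume "\<not> ?thesis"
    moreover have "dist_int (2 * (2 ^ j * p)) + dist_int (2 * (2 ^ j * q)) + dist_int (2 * (2 ^ j * r)) = 1"
      using sum[of "Suc j"] by (simp add: mult.assoc)
    moreover have "dist_int (2 * (2 ^ j * r)) < 1 / 2" using less(3)[of "Suc j"] by (simp add: mult.assoc)
    ultimately show False
      using sum[of j] less[of j] unfolding dist_int_double by (auto split: if_splits)
  qed
  have pw: "\<bar>dist_int (2 ^ j * r) - 1 / 3\<bar> = 2 ^ j * \<bar>dist_int r - 1 / 3\<bar>" for j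
  proof (induction j)
    case (Suc j)
    have "dist_int (2 ^ Suc j * r) - 1 / 3 = - 2 * (dist_int (2 ^ j * r) - 1 / 3)"
      using large[of j] dist_int_double[of "2 ^ j * r"] by (simp add: mult.assoc)
    hence "\<bar>dist_int (2 ^ Suc j * r) - 1 / 3\<bar> = \<bar>- 2\<bar> * \<bar>dist_int (2 ^ j * r) - 1 / 3\<bar>"
      by (simp only: abs_mult)
    thus ?case using Suc by simp
  qed simp
  show ?thesis
  proof (rule ccontr)
    assume "dist_int r \<noteq> 1 / 3"
    hence p: "\<bar>dist_int r - 1 / 3\<bar> > 0" by simp
    then obtain j where "1 / \<bar>dist_int r - 1 / 3\<bar> < 2 ^ j" using real_arch_pow[of 2] by auto
    hence "1 < 2 ^ j * \<bar>dist_int r - 1 / 3\<bar>" using p by (simp add: field_simps)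
    thus False using pw[of j] dist_int_bounds[of "2 ^ j * r"] by (simp add: abs_if split: if_splits)
  qed
qed

lemma half_int_cases:
  assumes "2 * x \<in> (\<int> :: real set)"
  obtains "x \<in> \<int>" | "x - 1 / 2 \<in> \<int>"
proof -
  obtain m where m: "2 * x = of_int m" using assms by (elim Ints_cases)
  show thesis
  proof (cases "even m")
    case True
    then obtain l where "m = 2 * l" by blast
    hence "x = of_int l" using m by simp
    thus thesis using that by simp
  next
    case False
    then obtain l where "m = 2 * l + 1" by (elim oddE)
    hence "x - 1 / 2 = of_int l" using m by simp
    thus thesis using that by (metis Ints_of_int)
  qed
qed

text \<open>The number \<open>e\<close> in the proof is the exponent of 2 in the common denominator
  of \<open>a\<close> and 1/N. For e at least 2 a single multiplier gives a contradiction. For e at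
  most 1 each number is a fraction with odd denominator plus 0 or 1/2, and the odd parts can be
  doubled independently of the halves.\<close>

lemma additive_distance_orbit:
  fixes a :: real and N M :: nat
  assumes N: "N \<ge> 3" and M: "M > 0" "even M" "real M * a \<in> \<int>" "N dvd M"
    and sum: "\<And>k. coprime k (int M) \<Longrightarrow>
      dist_int (of_int k * (a + 1 / real N)) = dist_int (of_int k * a) + dist_int (of_int k / real N)"
    and pos: "\<And>k. coprime k (int M) \<Longrightarrow> dist_int (of_int k * a) > 0"
      "\<And>k. coprime k (int M) \<Longrightarrow> dist_int (of_int k / real N) > 0"
    and less: "\<And>k. coprime k (int M) \<Longrightarrow> dist_int (of_int k * (a + 1 / real N)) < 1 / 2"
  shows "N = 6"
proof -
  define u where "u = 1 / real N"
  have kN: "of_int k / real N = of_int k * u" for k by (simp add: u_def)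
  note sum = sum[unfolded kN, folded u_def] and pos = pos[unfolded kN] and less = less[folded u_def]
  have Mu: "real M * u \<in> \<int>" using M(4) N by (auto simp: u_def)
  obtain f Mo where Mo: "M = 2 ^ f * Mo" "odd Mo"
    using M(1) by (metis multiplicity_decompose' not_is_unit_0 odd_one bot_nat_0.not_eq_extremum dvd_refl zero_neq_numeral)
  define Q where "Q e \<longleftrightarrow> 2 ^ e * real Mo * a \<in> \<int> \<and> 2 ^ e * real Mo * u \<in> \<int>" for e :: nat
  have "Q f" using M(3) Mu by (simp add: Q_def Mo(1))
  define e where "e = (LEAST e. Q e)"
  have Qe: "Q e" unfolding e_def by (rule LeastI) fact
  show ?thesis
  proof (cases "e \<ge> 2")
    case True
    \<comment> \<open>Multiplication by 1 + h adds \<open>h * x\<close>, a half-integer if the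
      denominator of \<open>x\<close> contains the full power of 2 and an integer otherwise. As e is
      at least 2, \<open>h\<close> is even and 1 + h is odd.\<close>
    define h where "h = 2 ^ (e - 1) * Mo"
    have "\<not> Q (e - 1)" unfolding e_def by (rule not_less_Least) (use True in \<open>simp add: e_def\<close>)
    hence nQ: "real h * a \<notin> \<int> \<or> real h * u \<notin> \<int>" by (simp add: Q_def h_def)
    have "(2::real) ^ e = 2 * 2 ^ (e - 1)" using True by (cases e) auto
    hence h2: "2 * (real h * a) \<in> \<int>" "2 * (real h * u) \<in> \<int>"
      using Qe by (auto simp: Q_def h_def mult.assoc)
    define k where "k = 1 + int h"
    have "coprime (1 + h) M"
    proof -
      have "even h" using True by (simp add: h_def)
      hence "coprime (1 + h) (2 ^ f)" by simp
      moreover have "coprime (1 + h) Mo"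
        by (metis h_def coprime_1_left coprime_iff_gcd_eq_1 gcd.commute gcd_add_mult mult.commute add.commute)
      ultimately show ?thesis by (simp add: Mo(1))
    qed
    hence k: "coprime k (int M)" unfolding k_def by (metis coprime_int_iff of_nat_1 of_nat_add)
    have sh: "dist_int (of_int k * x) = dist_int x" if "real h * x \<in> \<int>" for x
      by (rule dist_int_add_int) (use that in \<open>simp add: k_def algebra_simps\<close>)
    have sh2: "dist_int (of_int k * x) = 1 / 2 - dist_int x" if "real h * x - 1 / 2 \<in> \<int>" for x
    proof -
      have "dist_int (of_int k * x) = dist_int (x + 1 / 2)"
        by (rule dist_int_add_int) (use that in \<open>simp add: k_def algebra_simps\<close>)
      thus ?thesis by (simp add: dist_int_half)
    qed
    have s: "dist_int (a + u) = dist_int a + dist_int u" "dist_int a > 0" "dist_int u > 0" "dist_int (a + u) < 1 / 2"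
      using sum[of 1] pos[of 1] less[of 1] by auto
    have s': "dist_int (of_int k * (a + u)) = dist_int (of_int k * a) + dist_int (of_int k * u)"
      using sum[OF k] .
    consider "real h * a \<in> \<int>" "real h * u - 1 / 2 \<in> \<int>" | "real h * u \<in> \<int>" "real h * a - 1 / 2 \<in> \<int>"
      | "real h * u - 1 / 2 \<in> \<int>" "real h * a - 1 / 2 \<in> \<int>"
      using nQ h2 half_int_cases by metis
    hence False
    \<comment> \<open>If one summand is shifted by 1/2, so is the sum, and comparing both equations
      forces the other summand to have distance 0. If both are shifted, the sum is not, and its
      distance would be 1/2.\<close>
    proof cases
      case 1
      have "real h * (a + u) - 1 / 2 \<in> \<int>" using Ints_add[OF 1] by (simp add: algebra_simps)
      thus False using sh[OF 1(1)] sh2[OF 1(2)] sh2 s s' by auto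
    next
      case 2
      have "real h * (a + u) - 1 / 2 \<in> \<int>" using Ints_add[OF 2] by (simp add: algebra_simps)
      thus False using sh[OF 2(1)] sh2[OF 2(2)] sh2 s s' by auto
    next
      case 3
      have "real h * (a + u) \<in> \<int>" using Ints_add[OF Ints_add[OF 3] Ints_1] by (simp add: algebra_simps)
      thus False using sh2[OF 3(1)] sh2[OF 3(2)] sh s s' by auto
    qed
    thus ?thesis ..
  next
    case False
    have half: "2 * (real Mo * x) \<in> \<int>" if "2 ^ e * real Mo * x \<in> \<int>" for x
    proof -
      consider "e = 0" | "e = 1" using False by linarith
      thus ?thesis
      proof cases
        case 1
        thus ?thesis using that by (metis Ints_mult Ints_numeral mult_1 power_0)
      qed (use that in \<open>simp add: mult.assoc\<close>)
    qed
    have decomp: "\<exists>x' x0. x = x' + x0 \<and> real Mo * x' \<in> \<int> \<and> (x0 = 0 \<or> x0 = 1 / 2)"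
      if "2 ^ e * real Mo * x \<in> \<int>" for x
      using half[OF that]
    proof (cases rule: half_int_cases)
      case 1
      thus ?thesis by (intro exI[of _ x] exI[of _ 0]) auto
    next
      case 2
      obtain l where l: "Mo = 2 * l + 1" using Mo(2) by (elim oddE)
      have "real Mo * (x - 1 / 2) = (real Mo * x - 1 / 2) - of_nat l" by (simp add: l algebra_simps)
      also have "\<dots> \<in> \<int>" using 2 by (rule Ints_diff) simp
      finally show ?thesis by (intro exI[of _ "x - 1 / 2"] exI[of _ "1 / 2"]) simp
    qed
    obtain a' a0 where a: "a = a' + a0" "real Mo * a' \<in> \<int>" "a0 = 0 \<or> a0 = 1 / 2"
      using decomp[of a] Qe unfolding Q_def by blast
    obtain u' u0 where u: "u = u' + u0" "real Mo * u' \<in> \<int>" "u0 = 0 \<or> u0 = 1 / 2"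
      using decomp[of u] Qe unfolding Q_def by blast
    have ex: "\<exists>k. coprime k (int M) \<and> (\<forall>x' x0. real Mo * x' \<in> \<int> \<longrightarrow> x0 = 0 \<or> x0 = 1 / 2 \<longrightarrow>
        dist_int (of_int k * (x' + x0)) = dist_int (2 ^ j * x' + x0))" for j :: nat
    proof (cases "j = 0")
      case True
      thus ?thesis by (intro exI[of _ 1]) auto
    next
      case False
      \<comment> \<open>This multiplier is congruent to 2^j modulo \<open>Mo\<close> and odd, so it
        acts as 2^j on the odd part and trivially on 1/2. For j = 0 it would be even, which is why 1
        is used there.\<close>
      define k where "k = 2 ^ j + int Mo"
      have "coprime (2 ^ j + Mo) M"
      proof -
        have "coprime (2 ^ j + Mo) (2 ^ f)" using Mo(2) False by simp
        moreover have "coprime (2 ^ j + Mo) Mo"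
          unfolding coprime_iff_gcd_eq_1 gcd_add1 using Mo(2) by (simp flip: coprime_iff_gcd_eq_1)
        ultimately show ?thesis by (simp add: Mo(1))
      qed
      hence k: "coprime k (int M)" unfolding k_def
        by (metis coprime_int_iff of_nat_add of_nat_numeral of_nat_power)
      have "dist_int (of_int k * (x' + x0)) = dist_int (2 ^ j * x' + x0)"
        if x: "real Mo * x' \<in> \<int>" "x0 = 0 \<or> x0 = 1 / 2" for x' x0
      proof (rule dist_int_add_int)
        have "odd k" using Mo(2) False by (simp add: k_def)
        then obtain l where l: "k = 2 * l + 1" by (elim oddE)
        have "2 * x0 = 0 \<or> 2 * x0 = 1" using x(2) by auto
        hence "2 * x0 \<in> \<int>" by (metis Ints_0 Ints_1)
        hence "of_int l * (2 * x0) \<in> \<int>" by simp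
        hence "(of_int k - 1) * x0 \<in> \<int>" by (simp add: l mult_ac)
        hence "real Mo * x' + (of_int k - 1) * x0 \<in> \<int>" using x(1) by (rule Ints_add[rotated])
        moreover have "of_int k * (x' + x0) - (2 ^ j * x' + x0) = real Mo * x' + (of_int k - 1) * x0"
          by (simp add: k_def algebra_simps)
        ultimately show "of_int k * (x' + x0) - (2 ^ j * x' + x0) \<in> \<int>" by simp
      qed
      thus ?thesis using k by blast
    qed
    define s' where "s' = a' + u'"
    have s'M: "real Mo * s' \<in> \<int>" using Ints_add[OF a(2) u(2)] by (simp add: s'_def algebra_simps)
    \<comment> \<open>The sum of the halves, reduced modulo 1.\<close>
    define s0 :: real where "s0 = (if a0 = u0 then 0 else 1 / 2)"
    have "a0 + u0 - s0 = 0 \<or> a0 + u0 - s0 = 1" using a(3) u(3) by (auto simp: s0_def)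
    hence s0: "a0 + u0 - s0 \<in> \<int>" by (metis Ints_0 Ints_1)
    have orbit: "dist_int (2 ^ j * s' + s0) = dist_int (2 ^ j * a' + a0) + dist_int (2 ^ j * u' + u0) \<and>
        dist_int (2 ^ j * a' + a0) > 0 \<and> dist_int (2 ^ j * u' + u0) > 0 \<and> dist_int (2 ^ j * s' + s0) < 1 / 2" for j
    proof -
      obtain k where k: "coprime k (int M)"
        "\<And>x' x0. \<lbrakk>real Mo * x' \<in> \<int>; x0 = 0 \<or> x0 = 1 / 2\<rbrakk> \<Longrightarrow> dist_int (of_int k * (x' + x0)) = dist_int (2 ^ j * x' + x0)"
        using ex[of j] by blast
      have "dist_int (of_int k * (a + u)) = dist_int (of_int k * (s' + s0))"
      proof (rule dist_int_add_int)
        have "of_int k * (a + u) - of_int k * (s' + s0) = of_int k * (a0 + u0 - s0)"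
          by (simp add: a(1) u(1) s'_def algebra_simps)
        thus "of_int k * (a + u) - of_int k * (s' + s0) \<in> \<int>" using s0 by simp
      qed
      also have "\<dots> = dist_int (2 ^ j * s' + s0)" using k(2)[OF s'M] by (auto simp: s0_def)
      finally show ?thesis using sum[OF k(1)] pos[OF k(1)] less[OF k(1)] k(2)[OF a(2,3)] k(2)[OF u(2,3)]
        by (simp flip: a(1) u(1))
    qed
    have half2: "dist_int (2 ^ j * x + 1 / 2) = 1 / 2 - dist_int (2 ^ j * x)" for j x by (rule dist_int_half)
    have N6: "N = 6" if "a0 = 1 / 2" "u0 = 1 / 2"
    proof -
      have "dist_int u' = 1 / 3"
      proof (rule doubling_orbit_third[of a' s'])
        fix j
        show "dist_int (2 ^ j * a') + dist_int (2 ^ j * s') + dist_int (2 ^ j * u') = 1"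
          "dist_int (2 ^ j * a') < 1 / 2" "dist_int (2 ^ j * s') < 1 / 2" "dist_int (2 ^ j * u') < 1 / 2"
          using orbit[of j] that by (auto simp: s0_def half2)
      qed
      hence "dist_int u = 1 / 6" using dist_int_half[of u'] u(1) that by simp
      moreover have "dist_int u = u" using N by (intro dist_int_small) (auto simp: u_def field_simps)
      ultimately show ?thesis by (simp add: u_def field_simps)
    qed
    \<comment> \<open>A half replaces a distance d by 1/2 - d. In three of the four combinations one
      of \<open>s'\<close>, \<open>a'\<close>, \<open>u'\<close> has as distance the sum of the
      other two along the whole orbit; with two halves the three distances add up to 1.\<close>
    consider "a0 = 0" "u0 = 0" | "a0 = 1 / 2" "u0 = 0" | "a0 = 0" "u0 = 1 / 2" | "a0 = 1 / 2" "u0 = 1 / 2"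
      using a(3) u(3) by blast
    thus ?thesis
    proof cases
      case 1
      have False
        by (rule no_additive_doubling_orbit[of s' a' u']) (use orbit 1 in \<open>auto simp: s0_def half2\<close>)
      thus ?thesis ..
    next
      case 2
      have o: "dist_int (2 ^ j * a') = dist_int (2 ^ j * s') + dist_int (2 ^ j * u')" for j
        using orbit[of j] 2 by (auto simp: s0_def half2)
      have p: "dist_int (2 ^ j * s') > 0" "dist_int (2 ^ j * u') > 0" for j
        using orbit[of j] 2 by (auto simp: s0_def half2)
      from no_additive_doubling_orbit[of a' s' u', OF o p] show ?thesis ..
    next
      case 3
      have o: "dist_int (2 ^ j * u') = dist_int (2 ^ j * s') + dist_int (2 ^ j * a')" for j
        using orbit[of j] 3 by (auto simp: s0_def half2)
      have p: "dist_int (2 ^ j * s') > 0" "dist_int (2 ^ j * a') > 0" for j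
        using orbit[of j] 3 by (auto simp: s0_def half2)
      from no_additive_doubling_orbit[of u' s' a', OF o p] show ?thesis ..
    next
      case 4
      thus ?thesis by (rule N6)
    qed
  qed
qed

section \<open>Counting crossings of a vertical ray\<close>

text \<open>Twice the signed area of the triangle, positive in counterclockwise order; in its last
  argument it is an affine function vanishing at \<open>A\<close> and \<open>B\<close>.\<close>

definition orient :: "complex \<Rightarrow> complex \<Rightarrow> complex \<Rightarrow> real" where
  "orient A B C = Im (cnj (B - A) * (C - A))"

lemma orient_coords: "orient A B C = (Re B - Re A) * (Im C - Im A) - (Im B - Im A) * (Re C - Re A)"
  by (simp add: orient_def algebra_simps)

lemma orient_cyclic: "orient B C A = orient A B C"
  by (simp add: orient_coords algebra_simps)

lemma orient_sum: "orient B C x + orient C A x + orient A B x = orient A B C"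
  by (simp add: orient_coords algebra_simps)

lemma orient_barycentric:
  "of_real (orient B C x) * (A - x) + of_real (orient C A x) * (B - x) + of_real (orient A B x) * (C - x) = 0"
  by (simp add: complex_eq_iff orient_coords algebra_simps)

lemma orient_add_scaled: "orient A B (A + of_real p * (B - A) + of_real q * (C - A)) = q * orient A B C"
  by (simp add: orient_coords algebra_simps)

lemma orient_affine: "orient (u * A + v) (u * B + v) (u * C + v) = (cmod u)\<^sup>2 * orient A B C"
  unfolding cmod_power2 by (simp add: orient_coords power2_eq_square algebra_simps)

text \<open>The common factor \<open>orient A B C\<close> makes the condition independent of
  orientation, since image triangles may be reversed, and makes it false for degenerate
  triples.\<close>

definition strictly_inside :: "tile \<Rightarrow> complex \<Rightarrow> bool" where
  "strictly_inside = (\<lambda>(A, B, C) x. orient A B C * orient B C x > 0 \<and>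
     orient A B C * orient C A x > 0 \<and> orient A B C * orient A B x > 0)"

definition off_lines :: "tile \<Rightarrow> complex \<Rightarrow> bool" where
  "off_lines = (\<lambda>(A, B, C) x. orient A B x \<noteq> 0 \<and> orient B C x \<noteq> 0 \<and> orient C A x \<noteq> 0)"

definition slope :: "complex \<Rightarrow> real" where
  "slope z = Im z / Re z"

lemma slope_scale: "r \<noteq> 0 \<Longrightarrow> slope (of_real r * z) = slope z"
  by (simp add: slope_def)

lemma slope_minus [simp]: "slope (- z) = slope z"
  by (simp add: slope_def)

text \<open>Signed crossing of the edge with the upward vertical ray from \<open>x\<close>, positive
  from right to left. An endpoint on the line of the ray counts as lying to the right, so the number
  is additive along subdivisions. For a vertical edge the first factor is 0, whatever value
  \<open>slope\<close> takes.\<close>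

definition crossing :: "complex \<Rightarrow> complex \<Rightarrow> complex \<Rightarrow> real" where
  "crossing x A B = (of_bool (Re B < Re x) - of_bool (Re A < Re x)) *
     of_bool (Im A + (Re x - Re A) * slope (B - A) > Im x)"

definition crossings :: "complex \<Rightarrow> tile \<Rightarrow> real" where
  "crossings x = (\<lambda>(A, B, C). crossing x A B + crossing x B C + crossing x C A)"

lemma crossing_same [simp]: "crossing x A A = 0"
  by (simp add: crossing_def)

lemma slope_line:
  assumes "Re A \<noteq> Re B"
  shows "Im A + (t - Re A) * slope (B - A) = Im B + (t - Re B) * slope (B - A)"
  using assms by (simp add: slope_def field_simps)

lemma crossing_swap: "crossing x B A = - crossing x A B"
proof (cases "Re A = Re B")
  case True
  thus ?thesis by (simp add: crossing_def)
next
  case False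
  have "slope (A - B) = slope (B - A)" by (metis minus_diff_eq slope_minus)
  thus ?thesis using slope_line[OF False] by (simp add: crossing_def algebra_simps)
qed

lemma crossing_left_right:
  assumes "Re A < Re x" "Re x < Re B"
  shows "crossing x A B = - of_bool (orient A B x < 0)"
proof -
  have "Im A + (Re x - Re A) * slope (B - A) > Im x \<longleftrightarrow> orient A B x < 0"
    using assms by (simp add: slope_def orient_coords field_simps)
  thus ?thesis using assms by (simp add: crossing_def)
qed

lemma crossing_right_left:
  assumes "Re B < Re x" "Re x < Re A"
  shows "crossing x A B = of_bool (orient A B x > 0)"
  using crossing_left_right[OF assms] crossing_swap[of x B A]
  by (simp add: orient_coords algebra_simps)

lemma crossing_same_side:
  assumes "Re A < Re x \<longleftrightarrow> Re B < Re x"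
  shows "crossing x A B = 0"
  using assms by (simp add: crossing_def)

text \<open>Here u, v, w stand for barycentric weights of \<open>x\<close> and a, b, c for the
  horizontal offsets of the corners, one of them to the left of \<open>x\<close> and two to the
  right. The two indicators on the left are the crossings of the edges at the lone corner.\<close>

lemma barycentric_sign_count:
  fixes a b c u v w D :: real
  assumes "a < 0" "b > 0" "c > 0" and z: "u * a + v * b + w * c = 0" and D: "u + v + w = D"
    and nz: "v \<noteq> 0" "w \<noteq> 0"
  shows "of_bool (v > 0) - of_bool (w < 0) = sgn D * of_bool (D * u > 0 \<and> D * v > 0 \<and> D * w > 0)"
proof -
  consider "v > 0" "w > 0" | "v < 0" "w < 0" | "v > 0" "w < 0" | "v < 0" "w > 0" using nz by linarith
  thus ?thesis
  proof cases
    case 1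
    hence "v * b > 0" "w * c > 0" using assms by auto
    hence "u * a < 0" using z by linarith
    hence "u > 0" using assms by (simp add: mult_less_0_iff)
    thus ?thesis using 1 D by simp
  next
    case 2
    hence "v * b < 0" "w * c < 0" using assms by (auto simp: mult_less_0_iff)
    hence "u * a > 0" using z by linarith
    hence "u < 0" using assms by (simp add: zero_less_mult_iff)
    hence "D < 0" using 2 D by simp
    thus ?thesis using 2 \<open>u < 0\<close> by (simp add: zero_less_mult_iff)
  qed (auto simp: zero_less_mult_iff)
qed

lemma crossings_rotate: "crossings x (B, C, A) = crossings x (A, B, C)"
  by (simp add: crossings_def)

lemma inside_rotate: "strictly_inside (B, C, A) x = strictly_inside (A, B, C) x"
  by (auto simp: strictly_inside_def orient_cyclic)

lemma crossings_inside_apex: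
  assumes "off_lines (A, B, C) x"
    and "Re A < Re x \<and> Re x < Re B \<and> Re x < Re C \<or> Re x < Re A \<and> Re B < Re x \<and> Re C < Re x"
  shows "crossings x (A, B, C) = sgn (orient A B C) * of_bool (strictly_inside (A, B, C) x)"
  using assms(2)
proof (elim disjE conjE)
  have z: "orient B C x * (Re A - Re x) + orient C A x * (Re B - Re x) + orient A B x * (Re C - Re x) = 0"
    using arg_cong[OF orient_barycentric[of B C x A], of Re] by simp
  {
    assume s: "Re A < Re x" "Re x < Re B" "Re x < Re C"
    show ?thesis
      using barycentric_sign_count[OF _ _ _ z orient_sum] s assms(1)
      by (simp add: crossings_def crossing_left_right crossing_right_left crossing_same_side off_lines_def strictly_inside_def)
  next
    assume s: "Re x < Re A" "Re B < Re x" "Re C < Re x"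
    \<comment> \<open>The mirror image of the other case: offsets are negated and \<open>B\<close>
      and \<open>C\<close> change roles.\<close>
    have "orient B C x * (Re x - Re A) + orient A B x * (Re x - Re C) + orient C A x * (Re x - Re B) = 0"
      using z by (simp add: algebra_simps)
    moreover have "orient B C x + orient A B x + orient C A x = orient A B C"
      using orient_sum[of B C x A] by simp
    ultimately show ?thesis
      using barycentric_sign_count[of "Re x - Re A" "Re x - Re C" "Re x - Re B" "orient B C x" "orient A B x" "orient C A x"] s assms(1)
      by (auto simp add: crossings_def crossing_left_right crossing_right_left crossing_same_side off_lines_def strictly_inside_def)
  }
qed

text \<open>A corner alone on its side of the vertical line through \<open>x\<close> is rotated to
  the first place. If all corners are on one side, nothing is crossed, and \<open>x\<close> is no
  convex combination of them.\<close>

lemma crossings_inside: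
  assumes "off_lines (A, B, C) x" "Re x \<noteq> Re A" "Re x \<noteq> Re B" "Re x \<noteq> Re C"
  shows "crossings x (A, B, C) = sgn (orient A B C) * of_bool (strictly_inside (A, B, C) x)"
proof -
  have off: "off_lines (B, C, A) x" "off_lines (C, A, B) x" using assms(1) by (auto simp: off_lines_def)
  have "Re x < Re A \<longleftrightarrow> \<not> Re A < Re x" "Re x < Re B \<longleftrightarrow> \<not> Re B < Re x" "Re x < Re C \<longleftrightarrow> \<not> Re C < Re x"
    using assms by auto
  then consider "Re A < Re x \<and> Re x < Re B \<and> Re x < Re C \<or> Re x < Re A \<and> Re B < Re x \<and> Re C < Re x"
    | "Re B < Re x \<and> Re x < Re C \<and> Re x < Re A \<or> Re x < Re B \<and> Re C < Re x \<and> Re A < Re x"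
    | "Re C < Re x \<and> Re x < Re A \<and> Re x < Re B \<or> Re x < Re C \<and> Re A < Re x \<and> Re B < Re x"
    | "(Re A < Re x \<longleftrightarrow> Re B < Re x) \<and> (Re A < Re x \<longleftrightarrow> Re C < Re x)"
    by blast
  thus ?thesis
  proof cases
    case 1
    thus ?thesis using crossings_inside_apex assms by blast
  next
    case 2
    thus ?thesis using crossings_inside_apex[OF off(1)]
      by (simp add: crossings_rotate inside_rotate orient_cyclic)
  next
    case 3
    have "crossings x (A, B, C) = crossings x (C, A, B)" by (rule crossings_rotate)
    moreover have "strictly_inside (A, B, C) x = strictly_inside (C, A, B) x" by (rule inside_rotate)
    moreover have "orient A B C = orient C A B" by (rule orient_cyclic)
    ultimately show ?thesis using crossings_inside_apex[OF off(2) 3] by simp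
  next
    case 4
    have "\<not> strictly_inside (A, B, C) x"
    proof
      assume ins: "strictly_inside (A, B, C) x"
      define D where "D = orient A B C"
      have pos: "D * orient B C x > 0" "D * orient C A x > 0" "D * orient A B x > 0"
        using ins by (auto simp: strictly_inside_def D_def)
      have "orient B C x * (Re A - Re x) + orient C A x * (Re B - Re x) + orient A B x * (Re C - Re x) = 0"
        using arg_cong[OF orient_barycentric[of B C x A], of Re] by simp
      hence "D * (orient B C x * (Re A - Re x) + orient C A x * (Re B - Re x) + orient A B x * (Re C - Re x)) = 0"
        by simp
      hence z: "(D * orient B C x) * (Re A - Re x) + (D * orient C A x) * (Re B - Re x) + (D * orient A B x) * (Re C - Re x) = 0"
        by (simp add: algebra_simps)
      show False
      proof (cases "Re A < Re x")
        case True
        hence "(D * orient B C x) * (Re A - Re x) < 0" "(D * orient C A x) * (Re B - Re x) < 0" "(D * orient A B x) * (Re C - Re x) < 0"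
          using 4 pos by (auto intro: mult_pos_neg)
        thus False using z by linarith
      next
        case False
        hence "(D * orient B C x) * (Re A - Re x) > 0" "(D * orient C A x) * (Re B - Re x) > 0" "(D * orient A B x) * (Re C - Re x) > 0"
          using 4 pos assms by (auto intro!: mult_pos_pos)
        thus False using z by linarith
      qed
    qed
    moreover have "crossing x A B = 0" "crossing x B C = 0" "crossing x C A = 0"
      by (rule crossing_same_side, use 4 in blast)+
    hence "crossings x (A, B, C) = 0" by (simp add: crossings_def)
    ultimately show ?thesis by simp
  qed
qed

section \<open>Cancellation of edges\<close>

text \<open>The square identifies opposite directions.\<close>

definition edge_dir :: "complex \<Rightarrow> complex \<Rightarrow> complex" where
  "edge_dir A B = (sgn (B - A))\<^sup>2"

text \<open>All pieces of a subdivided side have the same direction, so their contributions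
  telescope, and opposite traversals cancel. Sides that overlap only in part therefore cause no
  difficulty. The dependence on the direction makes room for the slope in crossing numbers.\<close>

definition edge_diff :: "(complex \<Rightarrow> complex \<Rightarrow> real) \<Rightarrow> complex \<Rightarrow> complex \<Rightarrow> real" where
  "edge_diff g A B = g (edge_dir A B) B - g (edge_dir A B) A"

definition edge_sum :: "(complex \<Rightarrow> complex \<Rightarrow> real) \<Rightarrow> tile \<Rightarrow> real" where
  "edge_sum g = (\<lambda>(A, B, C). edge_diff g A B + edge_diff g B C + edge_diff g C A)"

definition tile_sign :: "tile \<Rightarrow> real" where
  "tile_sign = (\<lambda>(A, B, C). sgn (orient A B C))"

lemma edge_dir_swap: "edge_dir B A = edge_dir A B"
  unfolding edge_dir_def by (metis minus_diff_eq power2_minus sgn_minus)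

lemma edge_diff_swap: "edge_diff g B A = - edge_diff g A B"
  by (simp add: edge_diff_def edge_dir_swap)

lemma eventually_affine_nonzero:
  fixes v r :: real
  assumes "v \<noteq> 0 \<or> r \<noteq> 0"
  shows "\<forall>\<^sub>F e in at_right 0. v + r * e \<noteq> 0"
proof (cases "v = 0")
  case True
  thus ?thesis using assms eventually_at_right_less[of "0::real"] by (auto elim: eventually_mono)
next
  case False
  have "((\<lambda>e. v + r * e) \<longlongrightarrow> v + r * 0) (at_right 0)" by (intro tendsto_intros)
  thus ?thesis using False by (auto dest: tendsto_imp_eventually_ne)
qed

text \<open>The nested filters let \<open>e\<close> become small in dependence on \<open>d\<close>.
  If \<open>e\<close> occurs, it moves the value off a possible zero; otherwise \<open>d\<close>
  alone decides.\<close>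

lemma eventually_eventually_affine_nonzero:
  fixes p q r :: real
  assumes "p \<noteq> 0 \<or> q \<noteq> 0 \<or> r \<noteq> 0"
  shows "\<forall>\<^sub>F d in at_right 0. \<forall>\<^sub>F e in at_right 0. p + q * d + r * e \<noteq> 0"
proof (cases "r = 0")
  case True
  hence "\<forall>\<^sub>F d in at_right 0. p + q * d \<noteq> 0" using assms by (intro eventually_affine_nonzero) auto
  thus ?thesis using True by (auto elim: eventually_mono)
next
  case False
  thus ?thesis by (intro always_eventually allI eventually_affine_nonzero) simp
qed

lemma eventually_same_side:
  fixes v :: real
  assumes "v \<noteq> 0"
  shows "\<forall>\<^sub>F e in at_right 0. (v > e \<longleftrightarrow> v > 0) \<and> (v > - e \<longleftrightarrow> v > 0)"
proof -
  have "\<forall>\<^sub>F e in at_right (0::real). e \<in> {0<..<\<bar>v\<bar>}"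
    using assms eventually_at_right_real[of 0 "\<bar>v\<bar>"] by simp
  thus ?thesis by (rule eventually_mono) (auto simp: abs_if split: if_splits)
qed

lemma eventually_less_pm:
  fixes a :: real
  shows "\<forall>\<^sub>F d in at_right 0. (a < d \<longleftrightarrow> a \<le> 0) \<and> (a < - d \<longleftrightarrow> a < 0)"
proof (cases "a = 0")
  case True
  thus ?thesis using eventually_at_right_less[of "0::real"] by (auto elim: eventually_mono)
next
  case False
  have "\<forall>\<^sub>F e in at_right (0::real). e \<in> {0<..<\<bar>a\<bar>}"
    using False eventually_at_right_real[of 0 "\<bar>a\<bar>"] by simp
  thus ?thesis by (rule eventually_mono) (auto simp: abs_if split: if_splits)
qed

text \<open>For small \<open>0 < e << d\<close> this double difference of the crossing numbers of an edge vanishes unless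
  the edge is horizontal and ends at the origin, so it isolates the contribution of a single vertex
  and a single direction.\<close>

definition corner_diff :: "(complex \<Rightarrow> real) \<Rightarrow> real \<Rightarrow> real \<Rightarrow> real" where
  "corner_diff f d e = f (Complex d e) - f (Complex d (- e)) - f (Complex (- d) e) + f (Complex (- d) (- e))"

text \<open>Let \<open>h t\<close> be the height of the line over abscissa \<open>t\<close>. Unless
  the line is the real axis, \<open>h\<close> is nonzero at \<open>d\<close> and \<open>-d\<close>,
  and then the sign of \<open>e\<close> makes no difference. On the real axis the difference in
  \<open>e\<close> always shows, and the difference in \<open>d\<close> detects an endpoint at 0.
  Vertical edges contribute 0 on both sides.\<close>

lemma corner_diff_crossing:
  assumes "A \<noteq> B"
  shows "\<forall>\<^sub>F d in at_right 0. \<forall>\<^sub>F e in at_right 0. corner_diff (\<lambda>x. crossing x A B) d e =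
    of_bool (Im A = Im B) * (of_bool (A = 0) - of_bool (B = 0))"
proof -
  define m where "m = slope (B - A)"
  define h where "h t = (Im A - Re A * m) + m * t" for t
  have cr: "crossing (Complex s t) A B = (of_bool (Re B < s) - of_bool (Re A < s)) * of_bool (h s > t)" for s t
    by (simp add: crossing_def h_def m_def algebra_simps)
  show ?thesis
  proof (cases "m = 0 \<and> Im A = 0")
    case True
    hence h0: "h t = 0" for t by (simp add: h_def)
    have AB: "Im B = 0 \<or> Re A = Re B" using True by (auto simp: m_def slope_def)
    have rhs: "of_bool (Im A = Im B) * (of_bool (A = 0) - of_bool (B = 0)) =
        (of_bool (Re A = 0) - of_bool (Re B = 0) :: real)"
      using True AB assms by (auto simp: complex_eq_iff)
    have key: "corner_diff (\<lambda>x. crossing x A B) d e = of_bool (Re A = 0) - of_bool (Re B = 0)"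
      if "(Re A < d \<longleftrightarrow> Re A \<le> 0) \<and> (Re A < - d \<longleftrightarrow> Re A < 0)"
        "(Re B < d \<longleftrightarrow> Re B \<le> 0) \<and> (Re B < - d \<longleftrightarrow> Re B < 0)" "e > 0" for d e
    proof -
      have "corner_diff (\<lambda>x. crossing x A B) d e =
          (of_bool (Re A \<le> 0) - of_bool (Re A < 0)) - (of_bool (Re B \<le> 0) - of_bool (Re B < 0))"
        unfolding corner_diff_def cr h0 using that by simp
      also have "of_bool (r \<le> 0) - of_bool (r < 0) = (of_bool (r = 0) :: real)" for r :: real by simp
      finally show ?thesis by simp
    qed
    show ?thesis unfolding rhs using eventually_less_pm[of "Re A"] eventually_less_pm[of "Re B"]
    proof eventually_elim
      case (elim d)
      show ?case using eventually_at_right_less[of "0::real"]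
        by (rule eventually_mono) (rule key[OF elim])
    qed
  next
    case False
    have nz: "Im A - Re A * m \<noteq> 0 \<or> m \<noteq> 0" using False by (cases "m = 0") auto
    have ev1: "\<forall>\<^sub>F d in at_right 0. h d \<noteq> 0"
      unfolding h_def by (rule eventually_affine_nonzero[OF nz])
    have hd: "h (- d) = (Im A - Re A * m) + (- m) * d" for d by (simp add: h_def)
    have nz': "Im A - Re A * m \<noteq> 0 \<or> - m \<noteq> 0" using nz by linarith
    have ev2: "\<forall>\<^sub>F d in at_right 0. h (- d) \<noteq> 0"
      unfolding hd by (rule eventually_affine_nonzero[OF nz'])
    have rhs: "of_bool (Im A = Im B) * (of_bool (A = 0) - of_bool (B = 0)) = (0::real)"
    proof (cases "Im A = Im B")
      case True
      hence "m = 0" by (simp add: m_def slope_def)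
      hence "Im A \<noteq> 0" using False by blast
      hence "A \<noteq> 0" "B \<noteq> 0" using True by auto
      thus ?thesis by simp
    qed simp
    have key: "corner_diff (\<lambda>x. crossing x A B) d e = 0"
      if "(h d > e \<longleftrightarrow> h d > 0) \<and> (h d > - e \<longleftrightarrow> h d > 0)"
        "(h (- d) > e \<longleftrightarrow> h (- d) > 0) \<and> (h (- d) > - e \<longleftrightarrow> h (- d) > 0)" for d e
      using that by (simp add: corner_diff_def cr)
    have evk: "\<forall>\<^sub>F e in at_right 0. corner_diff (\<lambda>x. crossing x A B) d e = 0" if "h d \<noteq> 0" "h (- d) \<noteq> 0" for d
      using eventually_same_side[OF that(1)] eventually_same_side[OF that(2)]
      by eventually_elim (rule key)
    show ?thesis unfolding rhs using ev1 ev2 by eventually_elim (rule evk)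
  qed
qed

section \<open>Isolating a corner and a direction\<close>

definition generic :: "tile \<Rightarrow> complex \<Rightarrow> bool" where
  "generic = (\<lambda>(A, B, C) x. off_lines (A, B, C) x \<and> Re x \<noteq> Re A \<and> Re x \<noteq> Re B \<and> Re x \<noteq> Re C)"

lemma eventually_off_line:
  assumes "A \<noteq> B" and s: "\<bar>s\<bar> = 1" "\<bar>s'\<bar> = 1"
  shows "\<forall>\<^sub>F d in at_right 0. \<forall>\<^sub>F e in at_right 0. orient A B (Complex (s * d) (s' * e)) \<noteq> 0"
proof -
  define p where "p = (Im B - Im A) * Re A - (Re B - Re A) * Im A"
  define q where "q = - (Im B - Im A) * s"
  define r where "r = (Re B - Re A) * s'"
  have "p + q * d + r * e = orient A B (Complex (s * d) (s' * e))" for d e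
    by (simp add: orient_coords p_def q_def r_def algebra_simps)
  moreover have "q \<noteq> 0 \<or> r \<noteq> 0" using assms by (auto simp: q_def r_def complex_eq_iff)
  ultimately show ?thesis using eventually_eventually_affine_nonzero[of p q r] by simp
qed

lemma eventually_generic:
  assumes "orient A B C \<noteq> 0" and s: "\<bar>s\<bar> = 1" "\<bar>s'\<bar> = 1"
  shows "\<forall>\<^sub>F d in at_right 0. \<forall>\<^sub>F e in at_right 0. generic (A, B, C) (Complex (s * d) (s' * e))"
proof -
  have ne: "A \<noteq> B" "B \<noteq> C" "C \<noteq> A" using assms(1) by (auto simp: orient_coords)
  have re: "\<forall>\<^sub>F d in at_right 0. \<forall>\<^sub>F e in at_right (0::real). s * d \<noteq> Re P" for P
  proof -
    have "\<forall>\<^sub>F d in at_right 0. - Re P + s * d \<noteq> 0" using s by (intro eventually_affine_nonzero) auto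
    thus ?thesis by (rule eventually_mono) auto
  qed
  have re': "\<forall>\<^sub>F d in at_right 0. s * d \<noteq> Re P" for P
    using re[of P] by simp
  show ?thesis
    unfolding generic_def off_lines_def using s re'
    by (auto simp: eventually_conj_iff intro!: eventually_off_line ne re)
qed

text \<open>The coefficient of \<open>g e y\<close> in \<open>- edge_diff g A B\<close>.\<close>

definition vertex_flag :: "complex \<Rightarrow> complex \<Rightarrow> complex \<Rightarrow> complex \<Rightarrow> real" where
  "vertex_flag e y A B = of_bool (edge_dir A B = e) * (of_bool (A = y) - of_bool (B = y))"

definition vertex_flags :: "complex \<Rightarrow> complex \<Rightarrow> tile \<Rightarrow> real" where
  "vertex_flags e y = (\<lambda>(A, B, C). vertex_flag e y A B + vertex_flag e y B C + vertex_flag e y C A)"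

definition map_tile :: "(complex \<Rightarrow> complex) \<Rightarrow> tile \<Rightarrow> tile" where
  "map_tile f = (\<lambda>(A, B, C). (f A, f B, f C))"

lemma vertex_flag_rotated:
  assumes d: "cmod d = 1" and "A \<noteq> B"
  shows "of_bool (Im (cnj d * (A - y)) = Im (cnj d * (B - y))) *
      (of_bool (cnj d * (A - y) = 0) - of_bool (cnj d * (B - y) = 0)) = vertex_flag (d\<^sup>2) y A B"
proof -
  have "d \<noteq> 0" using d by auto
  have "Im (cnj d * (A - y)) = Im (cnj d * (B - y)) \<longleftrightarrow> edge_dir A B = d\<^sup>2"
  proof
    assume "edge_dir A B = d\<^sup>2"
    hence "sgn (B - A) = d \<or> sgn (B - A) = - d" by (simp add: edge_dir_def power2_eq_iff)
    hence "B - A = of_real (cmod (B - A)) * d \<or> B - A = of_real (- cmod (B - A)) * d"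
      using assms(2) by (auto simp: sgn_eq field_simps)
    then obtain r where "B - A = of_real r * d" by blast
    hence "cnj d * (B - A) = of_real r * (cnj d * d)" by simp
    also have "cnj d * d = 1" using d by (metis complex_norm_square mult.commute of_real_1 one_power2)
    finally have "Im (cnj d * (B - A)) = 0" by simp
    thus "Im (cnj d * (A - y)) = Im (cnj d * (B - y))" by (simp add: algebra_simps)
  next
    assume "Im (cnj d * (A - y)) = Im (cnj d * (B - y))"
    hence "Im (cnj d * (B - A)) = 0" by (simp add: algebra_simps)
    then obtain r where r: "cnj d * (B - A) = of_real r" by (metis complex_is_Real_iff Reals_cases)
    have "d * cnj d = 1" using d by (metis complex_norm_square of_real_1 one_power2)
    hence BA: "B - A = of_real r * d" using r by (metis mult.assoc mult.commute mult_1)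
    hence "sgn (B - A) = of_real (sgn r) * d" using d by (simp add: sgn_mult sgn_of_real) (simp add: sgn_eq)
    moreover have "r \<noteq> 0" using BA assms(2) by auto
    ultimately show "edge_dir A B = d\<^sup>2"
      by (simp add: edge_dir_def power_mult_distrib sgn_real_def)
  qed
  thus ?thesis using \<open>d \<noteq> 0\<close> by (simp add: vertex_flag_def)
qed

text \<open>The isometry \<open>R\<close> takes \<open>y\<close> to 0 and the direction
  \<open>d\<close> to the real axis. By hypothesis the weighted crossing number is 0 at all generic
  points, in particular at the four points of the corner difference, and this difference is the
  weighted sum of the flags.\<close>

lemma vertex_flags_cancel:
  assumes S: "finite S" "\<And>t. t \<in> S \<Longrightarrow> tile_sign t \<noteq> 0"
    and hyp: "\<And>x. \<forall>t\<in>S. off_lines t x \<Longrightarrow> (\<Sum>t\<in>S. c t * of_bool (strictly_inside t x)) = 0"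
    and d: "cmod d = 1"
  shows "(\<Sum>t\<in>S. c t * tile_sign t * vertex_flags (d\<^sup>2) y t) = 0"
proof -
  define R where "R z = cnj d * (z - y)" for z
  have dd: "d * cnj d = 1" using d by (metis complex_norm_square of_real_1 one_power2)
  have R: "R z = cnj d * z + (- cnj d * y)" for z by (simp add: R_def algebra_simps)
  have Rinv: "x = R (d * x + y)" for x
    by (simp add: R_def dd mult.commute[of "cnj d"] mult.assoc[of "cnj d", symmetric])
  have oR: "orient (R A) (R B) (R C) = orient A B C" for A B C
    unfolding R orient_affine using d by simp
  have off: "off_lines (map_tile R t) x = off_lines t (d * x + y)" for t x
    by (subst Rinv, cases t) (simp add: off_lines_def map_tile_def oR)
  have ins: "strictly_inside (map_tile R t) x = strictly_inside t (d * x + y)" for t x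
    by (subst Rinv, cases t) (simp add: strictly_inside_def map_tile_def oR)
  have sgnR: "tile_sign (map_tile R t) = tile_sign t" for t
    by (cases t) (simp add: tile_sign_def map_tile_def oR)
  have zero: "(\<Sum>t\<in>S. c t * tile_sign t * crossings x (map_tile R t)) = 0"
    if g: "\<forall>t\<in>S. generic (map_tile R t) x" for x
  proof -
    have "c t * tile_sign t * crossings x (map_tile R t) = c t * of_bool (strictly_inside t (d * x + y))"
      if t: "t \<in> S" for t
    proof -
      obtain A B C where ABC: "map_tile R t = (A, B, C)" by (cases "map_tile R t") auto
      have "crossings x (map_tile R t) = tile_sign t * of_bool (strictly_inside t (d * x + y))"
        using g t crossings_inside[of A B C x]
        unfolding ins[symmetric] sgnR[of t, symmetric] ABC by (auto simp: generic_def tile_sign_def ABC)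
      moreover have "tile_sign t * tile_sign t = 1"
        using S(2)[OF t] by (cases t) (auto simp: tile_sign_def sgn_real_def split: if_splits)
      ultimately show ?thesis by (metis mult.assoc mult.right_neutral)
    qed
    hence "(\<Sum>t\<in>S. c t * tile_sign t * crossings x (map_tile R t)) =
        (\<Sum>t\<in>S. c t * of_bool (strictly_inside t (d * x + y)))" by (rule sum.cong[OF refl])
    moreover have "\<forall>t\<in>S. off_lines t (d * x + y)"
    proof
      fix t assume "t \<in> S"
      hence "generic (map_tile R t) x" using g by blast
      hence "off_lines (map_tile R t) x" by (cases "map_tile R t") (simp add: generic_def)
      thus "off_lines t (d * x + y)" using off by simp
    qed
    ultimately show ?thesis using hyp by metis
  qed
  have gen: "\<forall>\<^sub>F a in at_right 0. \<forall>\<^sub>F b in at_right 0. \<forall>t\<in>S. generic (map_tile R t) (Complex (s * a) (s' * b))"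
    if "\<bar>s\<bar> = 1" "\<bar>s'\<bar> = 1" for s s'
  proof -
    have "\<forall>\<^sub>F a in at_right 0. \<forall>\<^sub>F b in at_right 0. generic (map_tile R t) (Complex (s * a) (s' * b))"
      if t: "t \<in> S" for t
    proof -
      obtain A B C where ABC: "map_tile R t = (A, B, C)" by (cases "map_tile R t") auto
      show ?thesis unfolding ABC using S(2)[OF t] sgnR[of t] \<open>\<bar>s\<bar> = 1\<close> \<open>\<bar>s'\<bar> = 1\<close>
        by (intro eventually_generic) (auto simp: ABC tile_sign_def)
    qed
    thus ?thesis using S(1) by (simp add: eventually_ball_finite_distrib)
  qed
  have flag: "\<forall>\<^sub>F a in at_right 0. \<forall>\<^sub>F b in at_right 0.
      corner_diff (\<lambda>x. crossings x (map_tile R t)) a b = vertex_flags (d\<^sup>2) y t" if t: "t \<in> S" for t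
  proof -
    obtain A B C where ABC: "t = (A, B, C)" by (cases t) auto
    have ne: "A \<noteq> B" "B \<noteq> C" "C \<noteq> A" using S(2)[OF t] by (auto simp: ABC tile_sign_def orient_coords)
    have inj: "R P \<noteq> R Q" if "P \<noteq> Q" for P Q using that d by (auto simp: R_def)
    have one: "\<forall>\<^sub>F a in at_right 0. \<forall>\<^sub>F b in at_right 0.
        corner_diff (\<lambda>x. crossing x (R P) (R Q)) a b = vertex_flag (d\<^sup>2) y P Q" if "P \<noteq> Q" for P Q
      using corner_diff_crossing[OF inj[OF that]] vertex_flag_rotated[OF d that, of y] by (simp add: R_def)
    have sp: "corner_diff (\<lambda>x. crossings x (map_tile R t)) a b =
        corner_diff (\<lambda>x. crossing x (R A) (R B)) a b + corner_diff (\<lambda>x. crossing x (R B) (R C)) a b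
        + corner_diff (\<lambda>x. crossing x (R C) (R A)) a b" for a b
      by (simp add: corner_diff_def crossings_def map_tile_def ABC)
    show ?thesis unfolding sp
      using one[OF ne(1)] one[OF ne(2)] one[OF ne(3)]
    proof eventually_elim
      case (elim a)
      thus ?case by eventually_elim (simp add: vertex_flags_def ABC)
    qed
  qed
  have "\<forall>\<^sub>F a in at_right 0. \<forall>\<^sub>F b in at_right 0.
      \<forall>t\<in>S. corner_diff (\<lambda>x. crossings x (map_tile R t)) a b = vertex_flags (d\<^sup>2) y t"
    using flag S(1) by (simp add: eventually_ball_finite_distrib)
  moreover have "\<forall>\<^sub>F a in at_right 0. \<forall>\<^sub>F b in at_right 0. \<forall>t\<in>S. generic (map_tile R t) (Complex a b)"
    using gen[of 1 1] by simp
  moreover have "\<forall>\<^sub>F a in at_right 0. \<forall>\<^sub>F b in at_right 0. \<forall>t\<in>S. generic (map_tile R t) (Complex a (- b))"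
    using gen[of 1 "- 1"] by simp
  moreover have "\<forall>\<^sub>F a in at_right 0. \<forall>\<^sub>F b in at_right 0. \<forall>t\<in>S. generic (map_tile R t) (Complex (- a) b)"
    using gen[of "- 1" 1] by simp
  moreover have "\<forall>\<^sub>F a in at_right 0. \<forall>\<^sub>F b in at_right 0. \<forall>t\<in>S. generic (map_tile R t) (Complex (- a) (- b))"
    using gen[of "- 1" "- 1"] by simp
  ultimately have "\<forall>\<^sub>F a in at_right (0::real). \<forall>\<^sub>F b in at_right (0::real).
     (\<Sum>t\<in>S. c t * tile_sign t * vertex_flags (d\<^sup>2) y t) = 0"
  proof eventually_elim
    case (elim a)
    thus ?case
    proof eventually_elim
      case (elim b)
      have "(\<Sum>t\<in>S. c t * tile_sign t * vertex_flags (d\<^sup>2) y t) =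
          (\<Sum>t\<in>S. c t * tile_sign t * corner_diff (\<lambda>x. crossings x (map_tile R t)) a b)"
        using elim by (intro sum.cong) auto
      also have "\<dots> = corner_diff (\<lambda>x. \<Sum>t\<in>S. c t * tile_sign t * crossings x (map_tile R t)) a b"
        by (simp add: corner_diff_def algebra_simps flip: sum.distrib sum_subtractf)
      also have "\<dots> = 0" using elim by (simp add: corner_diff_def zero)
      finally show ?case .
    qed
  qed
  \<comment> \<open>The equation does not involve the two small numbers, so it holds
    outright.\<close>
  thus ?thesis by (simp add: trivial_limit_at_right_real)
qed

text \<open>A linear relation between indicator functions of triangles, valid off the lines of their
  sides, passes to the sums over their edges. Only finitely many directions and corners occur, so
  \<open>g\<close> may be expanded into values at single pairs, each multiplied by a sum of
  flags.\<close>

theorem edge_sum_cancel: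
  assumes S: "finite S" "\<And>t. t \<in> S \<Longrightarrow> tile_sign t \<noteq> 0"
    and hyp: "\<And>x. \<forall>t\<in>S. off_lines t x \<Longrightarrow> (\<Sum>t\<in>S. c t * of_bool (strictly_inside t x)) = 0"
  shows "(\<Sum>t\<in>S. c t * tile_sign t * edge_sum g t) = 0"
proof -
  define Y where "Y = (\<Union>(A, B, C)\<in>S. {A, B, C})"
  define E where "E = (\<Union>(A, B, C)\<in>S. {edge_dir A B, edge_dir B C, edge_dir C A})"
  have fin: "finite Y" "finite E" using S(1) by (auto simp: Y_def E_def)
  have diff: "edge_diff g A B = - (\<Sum>e\<in>E. \<Sum>y\<in>Y. g e y * vertex_flag e y A B)"
    if "edge_dir A B \<in> E" "A \<in> Y" "B \<in> Y" for A B
  proof -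
    have "(\<Sum>y\<in>Y. g e y * vertex_flag e y A B) = (if edge_dir A B = e then g e A - g e B else 0)" for e
    proof -
      have "(\<Sum>y\<in>Y. g e y * vertex_flag e y A B) =
         (\<Sum>y\<in>Y. (if edge_dir A B = e then (if A = y then g e y else 0) - (if B = y then g e y else 0) else 0))"
        by (intro sum.cong) (auto simp: vertex_flag_def)
      also have "\<dots> = (if edge_dir A B = e then g e A - g e B else 0)"
        using that fin by (simp add: sum_subtractf)
      finally show ?thesis .
    qed
    thus ?thesis using that fin by (simp add: edge_diff_def)
  qed
  have "edge_sum g t = - (\<Sum>e\<in>E. \<Sum>y\<in>Y. g e y * vertex_flags e y t)" if t: "t \<in> S" for t
  proof -
    obtain A B C where ABC: "t = (A, B, C)" by (cases t) auto
    have mem: "A \<in> Y" "B \<in> Y" "C \<in> Y" "edge_dir A B \<in> E" "edge_dir B C \<in> E" "edge_dir C A \<in> E"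
      using t by (auto simp: Y_def E_def ABC)
    show ?thesis
      by (simp add: edge_sum_def vertex_flags_def ABC diff mem distrib_left sum.distrib)
  qed
  hence "(\<Sum>t\<in>S. c t * tile_sign t * edge_sum g t)
      = - (\<Sum>t\<in>S. \<Sum>e\<in>E. \<Sum>y\<in>Y. g e y * (c t * tile_sign t * vertex_flags e y t))"
    by (simp add: sum_distrib_left sum_negf mult_ac)
  also have "(\<Sum>t\<in>S. \<Sum>e\<in>E. \<Sum>y\<in>Y. g e y * (c t * tile_sign t * vertex_flags e y t))
      = (\<Sum>e\<in>E. \<Sum>y\<in>Y. \<Sum>t\<in>S. g e y * (c t * tile_sign t * vertex_flags e y t))"
    by (subst sum.swap, intro sum.cong refl, rule sum.swap)
  also have "\<dots> = (\<Sum>e\<in>E. \<Sum>y\<in>Y. g e y * (\<Sum>t\<in>S. c t * tile_sign t * vertex_flags e y t))"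
    by (simp only: sum_distrib_left)
  also have "\<dots> = 0"
  proof (intro sum.neutral ballI)
    fix e y assume "e \<in> E"
    then obtain A B C where t: "(A, B, C) \<in> S" and e: "e \<in> {edge_dir A B, edge_dir B C, edge_dir C A}"
      by (auto simp: E_def)
    have "A \<noteq> B" "B \<noteq> C" "C \<noteq> A" using S(2)[OF t] by (auto simp: tile_sign_def orient_coords)
    then obtain d where "e = d\<^sup>2" "cmod d = 1"
      using e by (auto simp: edge_dir_def norm_sgn)
    thus "g e y * (\<Sum>t\<in>S. c t * tile_sign t * vertex_flags e y t) = 0"
      using vertex_flags_cancel[OF S hyp] by simp
  qed
  finally show ?thesis by simp
qed

section \<open>Triangulating the regular polygon\<close>

lemma region_coords:
  assumes "x \<in> region (A, B, C)"
  obtains u v w where "u \<ge> 0" "v \<ge> 0" "w \<ge> 0" "orient B C x = u * orient A B C"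
    "orient C A x = v * orient A B C" "orient A B x = w * orient A B C"
proof -
  obtain u v w where u: "0 \<le> u" "0 \<le> v" "0 \<le> w" "u + v + w = 1"
    and x: "x = u *\<^sub>R A + v *\<^sub>R B + w *\<^sub>R C"
    using assms unfolding region_def by (auto simp: convex_hull_3)
  have v: "v = 1 - u - w" using u by simp
  have "orient A B x = w * orient A B C" unfolding x v by (simp add: orient_coords algebra_simps)
  moreover have "orient B C x = u * orient A B C" unfolding x v by (simp add: orient_coords algebra_simps)
  moreover have "orient C A x = v * orient A B C" unfolding x v by (simp add: orient_coords algebra_simps)
  ultimately show thesis using u that by blast
qed

lemma region_off_lines_inside:
  assumes "off_lines t x" "x \<in> region t"
  shows "strictly_inside t x"
proof -
  obtain A B C where t: "t = (A, B, C)" by (cases t) auto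
  obtain u v w where uvw: "u \<ge> 0" "v \<ge> 0" "w \<ge> 0" "orient B C x = u * orient A B C"
    "orient C A x = v * orient A B C" "orient A B x = w * orient A B C"
    using region_coords assms(2) unfolding t by metis
  have "orient A B C \<noteq> 0" "u \<noteq> 0" "v \<noteq> 0" "w \<noteq> 0" using assms(1) uvw by (auto simp: t off_lines_def)
  hence "orient A B C * orient A B C > 0" "u > 0" "v > 0" "w > 0"
    using uvw by (auto simp flip: power2_eq_square)
  thus ?thesis using uvw by (simp add: strictly_inside_def t mult.left_commute)
qed

lemma strictly_inside_region:
  assumes "strictly_inside t x"
  shows "x \<in> region t"
proof -
  obtain A B C where t: "t = (A, B, C)" by (cases t) auto
  define D where "D = orient A B C"
  define u v w where "u = orient B C x / D" and "v = orient C A x / D" and "w = orient A B x / D"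
  have pos: "D * orient B C x > 0" "D * orient C A x > 0" "D * orient A B x > 0"
    using assms by (auto simp: strictly_inside_def t D_def)
  hence "D \<noteq> 0" by auto
  have "u \<ge> 0" "v \<ge> 0" "w \<ge> 0"
    using pos by (auto simp: u_def v_def w_def zero_less_mult_iff zero_le_divide_iff)
  moreover have "u + v + w = 1"
    using orient_sum[of B C x A] \<open>D \<noteq> 0\<close> by (simp add: u_def v_def w_def D_def flip: add_divide_distrib)
  moreover have "x = u *\<^sub>R A + v *\<^sub>R B + w *\<^sub>R C"
  proof -
    have "of_real D * (u *\<^sub>R A + v *\<^sub>R B + w *\<^sub>R C) =
        of_real (orient B C x) * A + of_real (orient C A x) * B + of_real (orient A B x) * C"
      using \<open>D \<noteq> 0\<close> by (simp add: u_def v_def w_def scaleR_conv_of_real algebra_simps)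
    also have "\<dots> = of_real (orient B C x + orient C A x + orient A B x) * x"
      using orient_barycentric[of B C x A] by (simp add: algebra_simps)
    also have "\<dots> = of_real D * x" by (simp add: orient_sum D_def)
    finally show ?thesis using \<open>D \<noteq> 0\<close> by simp
  qed
  ultimately show ?thesis unfolding region_def t by (auto simp: convex_hull_3)
qed

lemma open_strictly_inside: "open {x. strictly_inside t x}"
proof -
  obtain A B C where t: "t = (A, B, C)" by (cases t) auto
  have "continuous_on UNIV (\<lambda>x. orient A B C * orient P Q x)" for P Q
    unfolding orient_def by (intro continuous_intros)
  hence "open {x. 0 < orient A B C * orient P Q x}" for P Q
    by (intro open_Collect_less continuous_on_const)
  thus ?thesis unfolding t strictly_inside_def by (auto intro!: open_Collect_conj)
qed

lemma strictly_inside_interior: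
  assumes "strictly_inside t x"
  shows "x \<in> interior (region t)"
  using interior_maximal[of "{x. strictly_inside t x}" "region t"] open_strictly_inside[of t]
    strictly_inside_region assms by blast

lemma sum_of_bool_unique:
  assumes "finite S" "\<And>s t. \<lbrakk>s \<in> S; t \<in> S; P s; P t\<rbrakk> \<Longrightarrow> s = t"
  shows "(\<Sum>t\<in>S. of_bool (P t)) = (of_bool (\<exists>t\<in>S. P t) :: real)"
proof (cases "\<exists>t\<in>S. P t")
  case True
  then obtain s where s: "s \<in> S" "P s" by blast
  hence "(\<Sum>t\<in>S. of_bool (P t)) = (\<Sum>t\<in>S. if t = s then 1 else (0::real))"
    using assms(2) by (intro sum.cong) auto
  thus ?thesis using s assms(1) by auto
qed auto

lemma orient_zero_collinear:
  assumes "orient A B C = 0"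
  shows "collinear {A, B, C}"
proof (cases "A = B")
  case True
  thus ?thesis by simp
next
  case False
  have "Im (cnj (B - A) * (C - A)) = 0" using assms by (simp add: orient_def)
  then obtain r where r: "cnj (B - A) * (C - A) = of_real r" by (metis complex_is_Real_iff Reals_cases)
  define q where "q = r / (cmod (B - A))\<^sup>2"
  have "cnj (B - A) * (C - A) = cnj (B - A) * (of_real q * (B - A))"
  proof -
    have "cnj (B - A) * (of_real q * (B - A)) = of_real q * ((B - A) * cnj (B - A))" by (simp add: mult_ac)
    also have "\<dots> = of_real (q * (cmod (B - A))\<^sup>2)" by (simp only: complex_norm_square[symmetric] of_real_mult)
    also have "q * (cmod (B - A))\<^sup>2 = r" using False by (simp add: q_def)
    finally show ?thesis using r by simp
  qed
  hence "C - A = q *\<^sub>R (B - A)" using False by (simp add: scaleR_conv_of_real)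
  hence "collinear {0, B - A, C - A}" by (auto simp: collinear_lemma)
  hence "collinear {B, A, C}" using collinear_3[of B A C] by (simp add: NO_MATCH_def)
  thus ?thesis by (simp add: insert_commute)
qed

lemma tiling_tile_sign:
  assumes "is_tiling P \<alpha> \<beta> \<gamma> T" "t \<in> T"
  shows "tile_sign t \<noteq> 0"
proof -
  obtain A B C where t: "t = (A, B, C)" by (cases t) auto
  have "triangle_with_angles \<alpha> \<beta> \<gamma> t" using assms unfolding is_tiling_def by blast
  hence "\<not> collinear {A, B, C}" unfolding t triangle_with_angles_def prod.case by (rule conjunct1)
  hence "orient A B C \<noteq> 0" using orient_zero_collinear by blast
  thus ?thesis by (simp add: t tile_sign_def sgn_0_0)
qed

lemma tiling_indicator:
  assumes T: "is_tiling P \<alpha> \<beta> \<gamma> T" and x: "\<forall>t\<in>T. off_lines t x"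
  shows "(\<Sum>t\<in>T. of_bool (strictly_inside t x)) = (of_bool (x \<in> P) :: real)"
proof -
  have "(\<Sum>t\<in>T. of_bool (strictly_inside t x)) = (of_bool (\<exists>t\<in>T. strictly_inside t x) :: real)"
  proof (rule sum_of_bool_unique)
    show "finite T" using T by (simp add: is_tiling_def)
    fix s t assume "s \<in> T" "t \<in> T" "strictly_inside s x" "strictly_inside t x"
    moreover have "pairwise (\<lambda>s t. interior (region s) \<inter> interior (region t) = {}) T"
      using T by (simp only: is_tiling_def)
    ultimately show "s = t" using strictly_inside_interior unfolding pairwise_def by blast
  qed
  also have "(\<exists>t\<in>T. strictly_inside t x) \<longleftrightarrow> x \<in> P"
  proof -
    have P: "P = (\<Union>t\<in>T. region t)" using T by (simp add: is_tiling_def)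
    show ?thesis unfolding P using x region_off_lines_inside strictly_inside_region by blast
  qed
  finally show ?thesis .
qed

text \<open>The angle keeps a distance of at least \<open>s * pi / N\<close> from every multiple of
  2 pi. The case s = 1 serves the half-plane of a polygon side, the case s = 2 the corners of the
  star polygon.\<close>

lemma cos_int_multiple_le:
  assumes N: "N > 0" and s: "0 \<le> s" "s \<le> int N" and l: "\<And>q. \<bar>l - 2 * int N * q\<bar> \<ge> s"
  shows "cos (of_int l * pi / real N) \<le> cos (of_int s * pi / real N)"
proof -
  define r where "r = l mod (2 * int N)"
  define q where "q = l div (2 * int N)"
  have lr: "l = 2 * int N * q + r" by (simp add: r_def q_def)
  have r: "0 \<le> r" "r < 2 * int N" using N by (auto simp: r_def)
  have "r \<ge> s" using l[of q] r lr by simp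
  have "l - 2 * int N * (q + 1) = r - 2 * int N" unfolding lr by (simp add: algebra_simps)
  hence "2 * int N - r \<ge> s" using l[of "q + 1"] r by simp
  have "of_int l * pi / real N = of_int r * pi / real N + 2 * pi * of_int q"
    unfolding lr using N by (simp add: field_simps)
  hence "cos (of_int l * pi / real N) = cos (of_int r * pi / real N)"
    by (simp add: cos_add)
  also have "\<dots> \<le> cos (of_int s * pi / real N)"
  proof (cases "r \<le> int N")
    case True
    thus ?thesis using N s \<open>r \<ge> s\<close>
      by (intro cos_monotone_0_pi_le) (auto simp: field_simps)
  next
    case False
    have "of_int (2 * int N - r) * pi / real N = 2 * pi - of_int r * pi / real N"
      using N by (simp add: field_simps)
    hence "cos (of_int r * pi / real N) = cos (of_int (2 * int N - r) * pi / real N)"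
      by (simp add: cos_diff)
    also have "\<dots> \<le> cos (of_int s * pi / real N)"
    proof (intro cos_monotone_0_pi_le)
      have "real_of_int s \<le> of_int (2 * int N - r)" using \<open>2 * int N - r \<ge> s\<close> by (simp only: of_int_le_iff)
      thus "of_int s * pi / real N \<le> of_int (2 * int N - r) * pi / real N"
        by (intro divide_right_mono mult_right_mono) auto
      have "real_of_int (2 * int N - r) \<le> of_int (int N)" using False by (simp only: of_int_le_iff)
      hence "of_int (2 * int N - r) * pi \<le> real N * pi" by (intro mult_right_mono) auto
      thus "of_int (2 * int N - r) * pi / real N \<le> pi" using N by (simp add: field_simps)
    qed (use s N in auto)
    finally show ?thesis .
  qed
  finally show ?thesis .
qed

lemma orient_cis_origin:
  "orient 0 (cis a) (of_real r * cis t) = r * sin (t - a)"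
  "orient (cis b) 0 (of_real r * cis t) = r * sin (b - t)"
  by (simp_all add: orient_coords sin_diff algebra_simps)

lemma orient_cis_edge:
  "orient (cis a) (cis b) (of_real r * cis t) = sin (b - a) - r * (sin (t - a) + sin (b - t))"
proof -
  have s: "orient (cis a) (cis b) (of_real r * cis t) + orient (cis b) 0 (of_real r * cis t)
      + orient 0 (cis a) (of_real r * cis t) = orient 0 (cis a) (cis b)"
    by (rule orient_sum)
  have o: "orient 0 (cis a) (cis b) = sin (b - a)" by (simp add: orient_coords sin_diff algebra_simps)
  show ?thesis using s unfolding orient_cis_origin o by (simp add: distrib_left)
qed

section \<open>The central fan of the regular polygon\<close>

locale regular_polygon =
  fixes N :: nat and c w :: complex
  assumes N3: "N \<ge> 3" and w0: "w \<noteq> 0"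
begin

definition \<delta> :: real where "\<delta> = 2 * pi / real N"

lemma \<delta>_bounds: "0 < \<delta>" "\<delta> < pi"
  using N3 by (auto simp: \<delta>_def field_simps)

abbreviation V :: "nat \<Rightarrow> complex" where "V \<equiv> ngon_vertex N c w"

lemma V_eq: "V j = w * cis ((real j - 1) * \<delta>) + c"
  by (simp add: ngon_vertex_def \<delta>_def mult_ac)

lemma V_wrap: "V (Suc N) = V 1"
  using N3 by (simp add: V_eq \<delta>_def)

definition fan :: "nat \<Rightarrow> tile" where
  "fan j = (c, V j, V (Suc j))"

lemma orient_normalized: "orient (w * A + c) (w * B + c) (w * C + c) = (cmod w)\<^sup>2 * orient A B C"
  by (rule orient_affine)

lemma orient_fan: "orient c (V j) (V (Suc j)) = (cmod w)\<^sup>2 * sin \<delta>"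
proof -
  have "orient c (V j) (V (Suc j)) = orient (w * 0 + c) (w * cis ((real j - 1) * \<delta>) + c) (w * (of_real 1 * cis (real j * \<delta>)) + c)"
    by (simp add: V_eq)
  also have "\<dots> = (cmod w)\<^sup>2 * sin (real j * \<delta> - (real j - 1) * \<delta>)"
    unfolding orient_normalized orient_cis_origin by simp
  finally show ?thesis by (simp add: algebra_simps)
qed

lemma tile_sign_fan: "tile_sign (fan j) = 1"
  using \<delta>_bounds w0 by (simp add: tile_sign_def fan_def orient_fan sgn_mult sin_gt_zero)

text \<open>Up to a nonnegative factor, the height of a corner over the side is cos (\<delta>/2)
  minus the cosine of an odd multiple of \<delta>/2. Convexity carries the inequality to the
  hull.\<close>

lemma ngon_edge_halfplane:
  assumes "x \<in> regular_ngon N c w"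
  shows "orient (V j) (V (Suc j)) x \<ge> 0"
proof -
  define a where "a = (real j - 1) * \<delta>"
  have b: "real j * \<delta> = a + \<delta>" by (simp add: a_def algebra_simps)
  have vert: "orient (V j) (V (Suc j)) (V i) \<ge> 0" for i
  proof -
    define t where "t = (real i - 1) * \<delta>"
    define m where "m = int i - int j"
    have ta: "t - a = of_int m * \<delta>" by (simp add: t_def a_def m_def algebra_simps)
    have "orient (V j) (V (Suc j)) (V i) = orient (w * cis a + c) (w * cis (a + \<delta>) + c) (w * (of_real 1 * cis t) + c)"
      by (simp add: V_eq b flip: a_def t_def)
    also have "\<dots> = (cmod w)\<^sup>2 * (sin \<delta> - (sin (t - a) + sin (\<delta> - (t - a))))"
      unfolding orient_normalized orient_cis_edge by (simp add: algebra_simps)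
    finally have e: "orient (V j) (V (Suc j)) (V i) = (cmod w)\<^sup>2 * (sin \<delta> - (sin (t - a) + sin (\<delta> - (t - a))))" .
    have "sin (t - a) + sin (\<delta> - (t - a)) = 2 * sin (\<delta> / 2) * cos ((t - a) - \<delta> / 2)"
    proof -
      have "((t - a) + (\<delta> - (t - a))) / 2 = \<delta> / 2" "((t - a) - (\<delta> - (t - a))) / 2 = (t - a) - \<delta> / 2"
        by (simp_all add: field_simps)
      thus ?thesis by (simp only: sin_plus_sin)
    qed
    moreover have "sin \<delta> = 2 * sin (\<delta> / 2) * cos (\<delta> / 2)" using sin_double[of "\<delta> / 2"] by simp
    moreover have "cos ((t - a) - \<delta> / 2) \<le> cos (\<delta> / 2)"
    proof -
      have "cos (of_int (2 * m - 1) * pi / real N) \<le> cos (of_int 1 * pi / real N)"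
      proof (rule cos_int_multiple_le)
        show "\<bar>2 * m - 1 - 2 * int N * q\<bar> \<ge> 1" for q
        proof -
          have "odd (2 * m - 1 - 2 * int N * q)" by simp
          hence "2 * m - 1 - 2 * int N * q \<noteq> 0" by (metis even_zero)
          thus ?thesis by linarith
        qed
      qed (use N3 in auto)
      moreover have "(t - a) - \<delta> / 2 = of_int (2 * m - 1) * pi / real N"
        unfolding ta using N3 by (simp add: \<delta>_def field_simps)
      moreover have "\<delta> / 2 = of_int 1 * pi / real N" by (simp add: \<delta>_def)
      ultimately show ?thesis by simp
    qed
    moreover have "sin (\<delta> / 2) \<ge> 0" using \<delta>_bounds by (intro sin_ge_zero) auto
    ultimately have "sin (t - a) + sin (\<delta> - (t - a)) \<le> sin \<delta>" by (simp add: mult_left_mono)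
    thus ?thesis unfolding e by simp
  qed
  have "convex {x. orient (V j) (V (Suc j)) x \<ge> 0}"
  proof (rule convexI)
    fix x y and u v :: real
    assume uv: "0 \<le> u" "0 \<le> v" "u + v = 1" and xy: "x \<in> {x. orient (V j) (V (Suc j)) x \<ge> 0}" "y \<in> {x. orient (V j) (V (Suc j)) x \<ge> 0}"
    have u: "u = 1 - v" using uv by simp
    have "orient A B (u *\<^sub>R x + v *\<^sub>R y) = u * orient A B x + v * orient A B y" for A B
      unfolding u by (simp add: orient_coords algebra_simps)
    thus "u *\<^sub>R x + v *\<^sub>R y \<in> {x. orient (V j) (V (Suc j)) x \<ge> 0}" using uv xy by simp
  qed
  hence "regular_ngon N c w \<subseteq> {x. orient (V j) (V (Suc j)) x \<ge> 0}"
    unfolding regular_ngon_def using vert by (intro hull_minimal) auto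
  thus ?thesis using assms by blast
qed

lemma centre_in_ngon: "c \<in> regular_ngon N c w"
proof -
  have e: "cis (real j * \<delta>) = cis \<delta> ^ j" for j by (simp add: Complex.DeMoivre)
  have one: "cis \<delta> ^ N = 1" using N3 by (simp add: Complex.DeMoivre \<delta>_def)
  have "cis \<delta> \<noteq> 1" using sin_gt_zero[OF \<delta>_bounds] by (auto simp: complex_eq_iff)
  hence s0: "(\<Sum>j<N. cis \<delta> ^ j) = 0" using one by (simp add: geometric_sum)
  have "(\<Sum>j\<in>{1..N}. (1 / real N) *\<^sub>R V j) = (\<Sum>j<N. (1 / real N) *\<^sub>R V (Suc j))"
    by (rule sum.reindex_bij_witness[of _ Suc "\<lambda>j. j - 1"]) auto
  also have "\<dots> = (\<Sum>j<N. (w / of_nat N) * cis \<delta> ^ j + c / of_nat N)"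
    by (intro sum.cong refl) (simp add: V_eq e scaleR_conv_of_real add_divide_distrib)
  also have "\<dots> = c" unfolding sum.distrib sum_distrib_left[symmetric] s0 using N3 by simp
  finally have "c = (\<Sum>j\<in>{1..N}. (1 / real N) *\<^sub>R V j)" by simp
  also have "\<dots> \<in> regular_ngon N c w"
    unfolding regular_ngon_def using N3
    by (intro convex_sum) (auto intro: hull_inc)
  finally show ?thesis .
qed

lemma fan_region:
  assumes "j \<in> {1..N}"
  shows "region (fan j) \<subseteq> regular_ngon N c w"
proof -
  have V: "V i \<in> regular_ngon N c w" if "i \<in> {1..N}" for i
    unfolding regular_ngon_def using that by (auto intro: hull_inc)
  have "V (Suc j) \<in> regular_ngon N c w"
  proof (cases "j = N")
    case True
    thus ?thesis using V[of 1] N3 V_wrap by simp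
  qed (use V assms in auto)
  moreover have "convex (regular_ngon N c w)" by (simp add: regular_ngon_def)
  ultimately show ?thesis
    unfolding region_def fan_def using centre_in_ngon V[OF assms] by (simp add: hull_minimal)
qed

text \<open>In polar coordinates about the centre, two of the three conditions for a fan triangle
  say that the argument lies in its sector; the third is the half-plane of the side, in which the
  whole polygon lies.\<close>

lemma fan_indicator:
  assumes x: "\<forall>t\<in>fan ` {1..N}. off_lines t x"
  shows "(\<Sum>t\<in>fan ` {1..N}. of_bool (strictly_inside t x)) = (of_bool (x \<in> regular_ngon N c w) :: real)"
proof -
  define z where "z = (x - c) / w"
  have xz: "x = w * z + c" using w0 by (simp add: z_def)
  define r where "r = cmod z"
  define t where "t = Arg2pi z"
  have zt: "z = of_real r * cis t" using Arg2pi_eq[of z] by (simp add: r_def t_def cis_conv_exp)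
  have t: "0 \<le> t" "t < 2 * pi" by (auto simp: t_def Arg2pi_ge_0 Arg2pi_lt_2pi)
  have o1: "orient c (V j) x = (cmod w)\<^sup>2 * (r * sin (t - (real j - 1) * \<delta>))" for j
  proof -
    have "orient c (V j) x = (cmod w)\<^sup>2 * orient 0 (cis ((real j - 1) * \<delta>)) z"
      using orient_normalized[of 0 "cis ((real j - 1) * \<delta>)" z] by (simp add: V_eq xz)
    thus ?thesis by (simp only: zt orient_cis_origin)
  qed
  have o2: "orient (V (Suc j)) c x = (cmod w)\<^sup>2 * (r * sin (real j * \<delta> - t))" for j
  proof -
    have "orient (V (Suc j)) c x = (cmod w)\<^sup>2 * orient (cis (real j * \<delta>)) 0 z"
      using orient_normalized[of "cis (real j * \<delta>)" 0 z] by (simp add: V_eq xz)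
    thus ?thesis by (simp only: zt orient_cis_origin)
  qed
  have off: "orient c (V j) x \<noteq> 0" "orient (V (Suc j)) c x \<noteq> 0" "orient (V j) (V (Suc j)) x \<noteq> 0"
    if "j \<in> {1..N}" for j
    using x that by (auto simp: fan_def off_lines_def)
  have "r \<noteq> 0" using off(1)[of 1] o1[of 1] N3 by auto
  hence r: "r > 0" by (simp add: r_def)
  have w2: "(cmod w)\<^sup>2 > 0" using w0 by simp
  have D: "orient c (V j) (V (Suc j)) > 0" for j
    using w2 sin_gt_zero[OF \<delta>_bounds] by (simp add: orient_fan)
  have inside: "strictly_inside (fan j) x \<longleftrightarrow> orient (V j) (V (Suc j)) x > 0 \<and>
      sin (real j * \<delta> - t) > 0 \<and> sin (t - (real j - 1) * \<delta>) > 0" for j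
    using D[of j] r w2 by (simp add: strictly_inside_def fan_def o1 o2 zero_less_mult_iff)
  define k where "k = nat \<lfloor>t / \<delta>\<rfloor>"
  have k: "real k \<le> t / \<delta>" "t / \<delta> < real k + 1"
    using t \<delta>_bounds by (auto simp: k_def)
  hence kt: "real k * \<delta> \<le> t" "t < (real k + 1) * \<delta>"
    using \<delta>_bounds by (auto simp: field_simps)
  have "t / \<delta> < real N" using t \<delta>_bounds N3 by (simp add: \<delta>_def field_simps)
  hence kN: "Suc k \<in> {1..N}" using k by simp
  have sec: "sin (real (Suc k) * \<delta> - t) > 0" "sin (t - (real (Suc k) - 1) * \<delta>) > 0"
  proof -
    show "sin (real (Suc k) * \<delta> - t) > 0" using kt \<delta>_bounds by (intro sin_gt_zero) (auto simp: algebra_simps)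
    have "sin (t - (real (Suc k) - 1) * \<delta>) \<ge> 0" using kt \<delta>_bounds by (intro sin_ge_zero) (auto simp: algebra_simps)
    moreover have "sin (t - (real (Suc k) - 1) * \<delta>) \<noteq> 0" using off(1)[OF kN] o1[of "Suc k"] by auto
    ultimately show "sin (t - (real (Suc k) - 1) * \<delta>) > 0" by simp
  qed
  \<comment> \<open>The sine conditions see the angle \<open>p\<close> only modulo 2 pi; its range
    from \<delta> - 2 pi to 2 pi excludes all solutions but those between 0 and \<delta>.\<close>
  have uniq: "j = Suc k" if j: "j \<in> {1..N}" and s: "sin (real j * \<delta> - t) > 0" "sin (t - (real j - 1) * \<delta>) > 0" for j
  proof -
    define p where "p = t - (real j - 1) * \<delta>"
    have jp: "real j * \<delta> - t = \<delta> - p" by (simp add: p_def algebra_simps)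
    have N\<delta>: "real N * \<delta> = 2 * pi" using N3 by (simp add: \<delta>_def)
    have "(real j - 1) * \<delta> \<le> (real N - 1) * \<delta>" using j \<delta>_bounds by (intro mult_right_mono) auto
    hence lo: "p \<ge> \<delta> - 2 * pi" using t N\<delta> by (simp add: p_def algebra_simps)
    have "(real j - 1) * \<delta> \<ge> 0" using j \<delta>_bounds by simp
    hence hi: "p < 2 * pi" using t by (simp add: p_def)
    have "p > 0"
    proof (rule ccontr)
      assume "\<not> p > 0"
      moreover have "sin (\<delta> - p) > 0" using s jp by simp
      moreover have "sin p > 0" using s by (simp add: p_def)
      moreover have "p \<noteq> 0" using calculation by auto
      moreover have "- pi < p \<Longrightarrow> sin p < 0" using sin_lt_zero[of "p + 2 * pi"] calculation by force
      moreover have "p = - pi \<Longrightarrow> sin p = 0" by simp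
      ultimately have "p < - pi" by fastforce
      hence "sin (\<delta> - p) \<le> 0"
        using lo \<delta>_bounds sin_le_zero[of "\<delta> - p"] by (cases "\<delta> - p = 2 * pi") auto
      thus False using \<open>sin (\<delta> - p) > 0\<close> by simp
    qed
    have "p < pi"
    proof (rule ccontr)
      assume "\<not> p < pi"
      hence "sin p \<le> 0" using hi by (intro sin_le_zero) auto
      thus False using s by (simp add: p_def)
    qed
    have "p < \<delta>"
    proof (rule ccontr)
      assume "\<not> p < \<delta>"
      hence "sin (p - \<delta>) \<ge> 0" using \<open>p < pi\<close> \<delta>_bounds by (intro sin_ge_zero) auto
      moreover have "sin (\<delta> - p) = - sin (p - \<delta>)" by (metis minus_diff_eq sin_minus)
      ultimately show False using s jp by simp
    qed
    have "(real j - 1) * \<delta> < t" using \<open>p > 0\<close> by (simp add: p_def)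
    hence "(real j - 1) * \<delta> < (real k + 1) * \<delta>" using kt(2) by (rule less_trans)
    moreover have "t < real j * \<delta>" using \<open>p < \<delta>\<close> jp by simp
    with kt(1) have "real k * \<delta> < real j * \<delta>" by (rule le_less_trans)
    ultimately
    have "real j - 1 < real k + 1" "real k < real j" using \<delta>_bounds by (auto simp: mult_less_cancel_right)
    thus ?thesis by linarith
  qed
  have "(\<Sum>t\<in>fan ` {1..N}. of_bool (strictly_inside t x)) =
      (of_bool (\<exists>t\<in>fan ` {1..N}. strictly_inside t x) :: real)"
  proof (rule sum_of_bool_unique)
    fix s t' assume *: "s \<in> fan ` {1..N}" "t' \<in> fan ` {1..N}" "strictly_inside s x" "strictly_inside t' x"
    obtain i where i: "s = fan i" "i \<in> {1..N}" using *(1) by (rule imageE)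
    obtain j where j: "t' = fan j" "j \<in> {1..N}" using *(2) by (rule imageE)
    have "i = Suc k" using *(3) unfolding i(1) inside by (intro uniq i(2)) (elim conjE, assumption)+
    moreover have "j = Suc k" using *(4) unfolding j(1) inside by (intro uniq j(2)) (elim conjE, assumption)+
    ultimately show "s = t'" by (simp only: i(1) j(1))
  qed simp
  also have "(\<exists>t\<in>fan ` {1..N}. strictly_inside t x) \<longleftrightarrow> x \<in> regular_ngon N c w"
  proof
    assume "\<exists>t\<in>fan ` {1..N}. strictly_inside t x"
    thus "x \<in> regular_ngon N c w" using strictly_inside_region fan_region by blast
  next
    assume "x \<in> regular_ngon N c w"
    hence "orient (V (Suc k)) (V (Suc (Suc k))) x > 0"
      using ngon_edge_halfplane[of x "Suc k"] off(3)[OF kN] by simp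
    hence "strictly_inside (fan (Suc k)) x" using inside sec by blast
    thus "\<exists>t\<in>fan ` {1..N}. strictly_inside t x" using kN by blast
  qed
  finally show ?thesis .
qed

lemma inj_V: "inj_on V {1..N}"
proof (rule inj_onI)
  fix i j assume ij: "i \<in> {1..N}" "j \<in> {1..N}" "V i = V j"
  have "cis (2 * pi * real (i - 1) / real N) = cis (2 * pi * real (j - 1) / real N)"
    using ij w0 by (simp add: ngon_vertex_def of_nat_diff)
  hence "i - 1 = j - 1"
    using Complex.bij_betw_roots_unity[of N] ij N3 by (auto simp: bij_betw_def inj_on_def)
  thus "i = j" using ij by auto
qed

lemma edge_sum_fan:
  "edge_sum g (fan j) = edge_diff g (V j) (V (Suc j)) - (edge_diff g c (V (Suc j)) - edge_diff g c (V j))"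
  by (simp add: edge_sum_def fan_def edge_diff_swap[of g "V (Suc j)" c])

text \<open>Off the side lines the tiling and the fan have the same indicator function, so
  \<open>edge_sum_cancel\<close> applies to their difference. In the fan the spokes telescope around
  the centre.\<close>

theorem tiling_edge_sum:
  assumes T: "is_tiling (regular_ngon N c w) \<alpha> \<beta> \<gamma> T"
  shows "(\<Sum>t\<in>T. tile_sign t * edge_sum g t) = (\<Sum>j\<in>{1..N}. edge_diff g (V j) (V (Suc j)))"
proof -
  define F where "F = fan ` {1..N}"
  \<comment> \<open>A triple that occurs in both families gets coefficient 0, so the two families
    need not be disjoint.\<close>
  define k :: "tile \<Rightarrow> real" where "k t = of_bool (t \<in> T) - of_bool (t \<in> F)" for t
  have finT: "finite T" using T by (simp add: is_tiling_def)
  have finF: "finite F" by (simp add: F_def)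
  have split: "(\<Sum>t\<in>T \<union> F. k t * f t) = (\<Sum>t\<in>T. f t) - (\<Sum>t\<in>F. f t)" for f
  proof -
    have "(\<Sum>t\<in>T \<union> F. k t * f t) = (\<Sum>t\<in>T \<union> F. of_bool (t \<in> T) * f t) - (\<Sum>t\<in>T \<union> F. of_bool (t \<in> F) * f t)"
      by (simp add: k_def left_diff_distrib sum_subtractf)
    also have "(\<Sum>t\<in>T \<union> F. of_bool (t \<in> T) * f t) = (\<Sum>t\<in>T. f t)"
      by (rule sum.mono_neutral_cong_right) (use finT finF in auto)
    also have "(\<Sum>t\<in>T \<union> F. of_bool (t \<in> F) * f t) = (\<Sum>t\<in>F. f t)"
      by (rule sum.mono_neutral_cong_right) (use finT finF in auto)
    finally show ?thesis .
  qed
  have "(\<Sum>t\<in>T \<union> F. k t * tile_sign t * edge_sum g t) = 0"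
  proof (rule edge_sum_cancel)
    show "finite (T \<union> F)" using finT finF by simp
    show "tile_sign t \<noteq> 0" if "t \<in> T \<union> F" for t
      using that tiling_tile_sign[OF T, of t] tile_sign_fan by (auto simp: F_def)
    fix x assume x: "\<forall>t\<in>T \<union> F. off_lines t x"
    show "(\<Sum>t\<in>T \<union> F. k t * of_bool (strictly_inside t x)) = 0"
      unfolding split using tiling_indicator[OF T] fan_indicator x by (simp add: F_def)
  qed
  hence "(\<Sum>t\<in>T. tile_sign t * edge_sum g t) = (\<Sum>t\<in>F. tile_sign t * edge_sum g t)"
    unfolding mult.assoc split by simp
  also have "\<dots> = (\<Sum>j\<in>{1..N}. tile_sign (fan j) * edge_sum g (fan j))"
  proof -
    have "inj_on fan {1..N}"
    proof (rule inj_onI)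
      fix i j assume "i \<in> {1..N}" "j \<in> {1..N}" "fan i = fan j"
      thus "i = j" using inj_onD[OF inj_V, of i j] by (simp only: fan_def prod.inject)
    qed
    thus ?thesis unfolding F_def by (simp add: sum.reindex)
  qed
  also have "\<dots> = (\<Sum>j\<in>{1..N}. edge_diff g (V j) (V (Suc j)) - (edge_diff g c (V (Suc j)) - edge_diff g c (V j)))"
    by (intro sum.cong refl) (simp add: tile_sign_fan edge_sum_fan)
  also have "\<dots> = (\<Sum>j\<in>{1..N}. edge_diff g (V j) (V (Suc j))) - (\<Sum>j\<in>{1..N}. edge_diff g c (V (Suc j)) - edge_diff g c (V j))"
    by (rule sum_subtractf)
  also have "(\<Sum>j\<in>{1..N}. edge_diff g c (V (Suc j)) - edge_diff g c (V j)) = edge_diff g c (V (Suc N)) - edge_diff g c (V 1)"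
    using N3 by (intro sum_Suc_diff) auto
  also have "\<dots> = 0" by (simp only: V_wrap diff_self)
  finally show ?thesis by simp
qed

end

section \<open>Directions of the sides\<close>

lemma arccos_cis:
  assumes "Im z \<noteq> 0"
  defines "t \<equiv> arccos (Re z / cmod z)"
  shows "0 < t" "t < pi" "z = of_real (cmod z) * cis (sgn (Im z) * t)"
proof -
  have z0: "z \<noteq> 0" using assms by auto
  hence cz: "cmod z > 0" by simp
  have b0: "\<bar>Re z / cmod z\<bar> \<le> 1" using abs_Re_le_cmod[of z] cz by (simp add: abs_divide)
  have b: "- 1 \<le> Re z / cmod z" "Re z / cmod z \<le> 1"
    using abs_le_D1[OF b0] abs_le_D2[OF b0] by linarith+
  have pyth: "(Re z / cmod z)\<^sup>2 + (Im z / cmod z)\<^sup>2 = 1"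
    unfolding power_divide add_divide_distrib[symmetric] cmod_power2[symmetric] using cz by simp
  have c: "cos t = Re z / cmod z" unfolding t_def using b by (intro cos_arccos) auto
  have "sin t = sqrt (1 - (Re z / cmod z)\<^sup>2)" unfolding t_def using b by (intro sin_arccos) auto
  also have "1 - (Re z / cmod z)\<^sup>2 = (Im z / cmod z)\<^sup>2" using pyth by linarith
  finally have s: "sin t = \<bar>Im z\<bar> / cmod z" using cz by simp
  have sp: "sin t > 0" unfolding s using assms cz by simp
  have "0 \<le> t" "t \<le> pi" unfolding t_def using b by (auto intro: arccos_lbound arccos_ubound)
  moreover have "t \<noteq> 0" "t \<noteq> pi" using sp by auto
  ultimately show "0 < t" "t < pi" by auto
  show "z = of_real (cmod z) * cis (sgn (Im z) * t)"
  proof (cases "Im z > 0")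
    case True
    thus ?thesis using c s cz by (simp add: complex_eq_iff)
  next
    case False
    hence "Im z < 0" using assms by simp
    thus ?thesis using c s cz by (simp add: complex_eq_iff)
  qed
qed

lemma vertex_angle_cis:
  assumes "orient Q P R \<noteq> 0"
  shows "0 < vertex_angle P Q R" "vertex_angle P Q R < pi"
    "cnj (P - Q) * (R - Q) = of_real (cmod (P - Q) * cmod (R - Q)) * cis (sgn (orient Q P R) * vertex_angle P Q R)"
proof -
  define z where "z = cnj (P - Q) * (R - Q)"
  have im: "Im z = orient Q P R" by (simp add: z_def orient_def algebra_simps)
  have mz: "cmod z = cmod (P - Q) * cmod (R - Q)" unfolding z_def norm_mult complex_mod_cnj ..
  have re: "Re z = (P - Q) \<bullet> (R - Q)" by (simp add: z_def inner_complex_def algebra_simps)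
  have v: "vertex_angle P Q R = arccos (Re z / cmod z)" unfolding vertex_angle_def re mz ..
  have nz: "Im z \<noteq> 0" using assms im by simp
  show "0 < vertex_angle P Q R" "vertex_angle P Q R < pi" unfolding v using arccos_cis(1,2)[OF nz] .
  show "cnj (P - Q) * (R - Q) = of_real (cmod (P - Q) * cmod (R - Q)) * cis (sgn (orient Q P R) * vertex_angle P Q R)"
    unfolding v mz[symmetric] im[symmetric] z_def[symmetric] by (rule arccos_cis(3)[OF nz])
qed

lemma vertex_angle_commute: "vertex_angle P Q R = vertex_angle R Q P"
  by (simp add: vertex_angle_def inner_commute mult.commute)

text \<open>The fifth relation joins the law of sines to the rotation at \<open>A\<close>. It is
  multiplied out because \<Psi> is not linear over the reals but is compatible with powers of
  \<zeta> and with sines of multiples of pi/n.\<close>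

lemma triangle_relations:
  assumes "triangle_with_angles \<alpha> \<beta> \<gamma> (A, B, C)"
  shows "0 < \<alpha>" "0 < \<beta>" "0 < \<gamma>" "\<alpha> + \<beta> + \<gamma> = pi"
    "of_real (sin \<gamma>) * (C - A) = cis (sgn (orient A B C) * \<alpha>) * (of_real (sin \<beta>) * (B - A))"
    "orient A B C \<noteq> 0"
proof -
  define D where "D = orient A B C"
  have nc: "\<not> collinear {A, B, C}"
    and "vertex_angle C A B = \<alpha>" "vertex_angle A B C = \<beta>" "vertex_angle B C A = \<gamma>"
    using assms unfolding triangle_with_angles_def prod.case by blast+
  hence ang: "vertex_angle B A C = \<alpha>" "vertex_angle C B A = \<beta>" "vertex_angle A C B = \<gamma>"
    using vertex_angle_commute by metis+
  show D0: "orient A B C \<noteq> 0" using nc orient_zero_collinear by blast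
  have rot: "orient B C A = D" "orient C A B = D" by (simp_all add: D_def orient_coords algebra_simps)
  note a = vertex_angle_cis[of A B C, unfolded ang]
  note b = vertex_angle_cis[of B C A, unfolded ang rot]
  note c = vertex_angle_cis[of C A B, unfolded ang rot]
  have nz: "D \<noteq> 0" using D0 by (simp add: D_def)
  show pos: "0 < \<alpha>" "0 < \<beta>" "0 < \<gamma>" using a(1) b(1) c(1) D0 nz by auto
  have lt: "\<alpha> < pi" "\<beta> < pi" "\<gamma> < pi" using a(2) b(2) c(2) D0 nz by auto
  have a3: "cnj (B - A) * (C - A) = of_real (cmod (B - A) * cmod (C - A)) * cis (sgn D * \<alpha>)"
    using a(3)[OF D0] unfolding D_def .
  have b3: "cnj (C - B) * (A - B) = of_real (cmod (C - B) * cmod (A - B)) * cis (sgn D * \<beta>)"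
    using b(3)[OF nz] .
  have c3: "cnj (A - C) * (B - C) = of_real (cmod (A - C) * cmod (B - C)) * cis (sgn D * \<gamma>)"
    using c(3)[OF nz] .
  have ne: "A \<noteq> B" "B \<noteq> C" "C \<noteq> A" using D0 by (auto simp: orient_coords)
  have sg: "sgn D = 1 \<or> sgn D = - 1" using nz by (auto simp: sgn_real_def)
  hence ss: "sin (sgn D * t) = sgn D * sin t" for t by auto
  have Db: "D = cmod (C - B) * cmod (A - B) * (sgn D * sin \<beta>)"
  proof -
    have "D = Im (cnj (C - B) * (A - B))" using rot(1) by (simp add: orient_def)
    also have "\<dots> = cmod (C - B) * cmod (A - B) * sin (sgn D * \<beta>)" unfolding b3 Im_complex_of_real Im_divide by simp
    finally show ?thesis by (simp only: ss)
  qed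
  have Dc: "D = cmod (A - C) * cmod (B - C) * (sgn D * sin \<gamma>)"
  proof -
    have "D = Im (cnj (A - C) * (B - C))" using rot(2) by (simp add: orient_def)
    also have "\<dots> = cmod (A - C) * cmod (B - C) * sin (sgn D * \<gamma>)" unfolding c3 by simp
    finally show ?thesis by (simp only: ss)
  qed
  have "cmod (B - C) * (sin \<gamma> * cmod (C - A)) = cmod (B - C) * (sin \<beta> * cmod (B - A))"
  proof -
    have "sgn D * (cmod (B - C) * (sin \<gamma> * cmod (C - A))) = D"
      by (subst (2) Dc) (simp add: norm_minus_commute[of A C])
    moreover have "sgn D * (cmod (B - C) * (sin \<beta> * cmod (B - A))) = D"
      by (subst (2) Db) (simp add: norm_minus_commute[of C B] norm_minus_commute[of A B])
    ultimately show ?thesis using nz by (metis mult_left_cancel sgn_zero_iff)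
  qed
  hence sines: "sin \<gamma> * cmod (C - A) = sin \<beta> * cmod (B - A)" using ne by simp
  show "of_real (sin \<gamma>) * (C - A) = cis (sgn (orient A B C) * \<alpha>) * (of_real (sin \<beta>) * (B - A))"
  proof -
    have "cnj (B - A) * (of_real (sin \<gamma>) * (C - A)) = of_real (sin \<gamma>) * (cnj (B - A) * (C - A))" by simp
    also have "\<dots> = of_real (cmod (B - A) * (sin \<gamma> * cmod (C - A))) * cis (sgn D * \<alpha>)" unfolding a3 by simp
    also have "\<dots> = of_real (sin \<beta>) * of_real ((cmod (B - A))\<^sup>2) * cis (sgn D * \<alpha>)"
      unfolding sines by (simp add: power2_eq_square)
    also have "of_real ((cmod (B - A))\<^sup>2) = (B - A) * cnj (B - A)" using complex_norm_square[of "B - A"] by simp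
    finally have "cnj (B - A) * (of_real (sin \<gamma>) * (C - A)) = cnj (B - A) * (cis (sgn D * \<alpha>) * (of_real (sin \<beta>) * (B - A)))"
      by (simp only: mult_ac)
    moreover have "cnj (B - A) \<noteq> 0" using ne by simp
    ultimately show ?thesis unfolding D_def[symmetric] by (metis mult_left_cancel)
  qed
  \<comment> \<open>The product of the three corner expressions has the angle sum as its argument.
    In it each side vector also meets its own conjugate, after three changes of sign; hence the
    argument is pi modulo 2 pi.\<close>
  define L where "L = (cmod (B - A) * cmod (C - A)) * (cmod (C - B) * cmod (A - B)) * (cmod (A - C) * cmod (B - C))"
  have "cnj (B - A) * (C - A) * (cnj (C - B) * (A - B)) * (cnj (A - C) * (B - C))
      = of_real L * cis (sgn D * (\<alpha> + \<beta> + \<gamma>))"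
    unfolding a3 b3 c3 L_def by (simp add: cis_mult mult_ac distrib_left add_ac flip: of_real_mult)
  moreover have "cnj (B - A) * (C - A) * (cnj (C - B) * (A - B)) * (cnj (A - C) * (B - C)) = - of_real L"
  proof -
    have "cnj (B - A) * (C - A) * (cnj (C - B) * (A - B)) * (cnj (A - C) * (B - C))
      = - (((B - A) * cnj (B - A)) * ((C - B) * cnj (C - B)) * ((A - C) * cnj (A - C)))"
      by (simp add: algebra_simps)
    also have "\<dots> = - of_real ((cmod (B - A))\<^sup>2 * (cmod (C - B))\<^sup>2 * (cmod (A - C))\<^sup>2)"
      by (simp only: complex_norm_square[symmetric] of_real_mult)
    also have "(cmod (B - A))\<^sup>2 * (cmod (C - B))\<^sup>2 * (cmod (A - C))\<^sup>2 = L"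
      by (simp add: L_def power2_eq_square norm_minus_commute)
    finally show ?thesis .
  qed
  ultimately have "of_real L * cis (sgn D * (\<alpha> + \<beta> + \<gamma>)) = of_real L * (- 1)" by simp
  moreover have "L \<noteq> 0" using ne by (simp add: L_def)
  ultimately have "cis (sgn D * (\<alpha> + \<beta> + \<gamma>)) = - 1" by (metis mult_left_cancel of_real_eq_0_iff)
  hence "cos (sgn D * (\<alpha> + \<beta> + \<gamma>)) = - 1" by (simp add: complex_eq_iff)
  hence "cos (\<alpha> + \<beta> + \<gamma>) = - 1" using sg by (metis cos_minus mult_1 mult_minus1)
  hence "cos (\<alpha> + \<beta> + \<gamma> - pi) = 1" by (simp add: cos_diff)
  then obtain m :: int where m: "\<alpha> + \<beta> + \<gamma> - pi = of_int m * (2 * pi)" using cos_one_2pi_int by (metis mult.assoc)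
  have "of_int m * (2 * pi) < 2 * pi" "of_int m * (2 * pi) > - (2 * pi)"
    using m pos lt pi_gt_zero by linarith+
  hence "real_of_int m * (2 * pi) < 1 * (2 * pi)" "- 1 * (2 * pi) < real_of_int m * (2 * pi)" by simp_all
  hence "real_of_int m < 1" "- 1 < real_of_int m"
    using mult_right_less_imp_less[of "real_of_int m" "2 * pi" 1]
      mult_right_less_imp_less[of "- 1" "2 * pi" "real_of_int m"] pi_ge_zero by auto
  hence "m = 0" by linarith
  thus "\<alpha> + \<beta> + \<gamma> = pi" using m by simp
qed

lemma triangle_with_angles_rotate:
  assumes "triangle_with_angles \<alpha> \<beta> \<gamma> (A, B, C)"
  shows "triangle_with_angles \<beta> \<gamma> \<alpha> (B, C, A)"
proof -
  have "{B, C, A} = {A, B, C}" by auto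
  thus ?thesis using assms unfolding triangle_with_angles_def prod.case by metis
qed

section \<open>Area as a sum over edges\<close>

definition signed_area_potential :: "complex \<Rightarrow> complex \<Rightarrow> real" where
  "signed_area_potential e y = Re (cnj (csqrt e) * y) * Im (cnj y * csqrt e)"

lemma edge_dir_direction:
  assumes "A \<noteq> B" "edge_dir A B = d\<^sup>2"
  obtains r :: real where "B - A = of_real r * d"
proof -
  have "sgn (B - A) = d \<or> sgn (B - A) = - d" using assms by (simp add: edge_dir_def power2_eq_iff)
  hence "B - A = of_real (cmod (B - A)) * d \<or> B - A = of_real (- cmod (B - A)) * d"
    using assms(1) by (auto simp: sgn_eq field_simps)
  thus thesis using that by blast
qed

text \<open>For a unit direction of the edge the second factor of the potential is constant along
  its line and the first is a coordinate on it, so the difference is twice the signed area of the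
  triangle \<open>0 A B\<close>. The potential is quadratic in \<open>csqrt e\<close>, so the sign
  of the root does not matter.\<close>

lemma edge_diff_signed_area:
  assumes "A \<noteq> B"
  shows "edge_diff signed_area_potential A B = Im (cnj A * B)"
proof -
  define d where "d = csqrt (edge_dir A B)"
  have e: "edge_dir A B = d\<^sup>2" by (simp add: d_def)
  obtain r where r: "B - A = of_real r * d" using edge_dir_direction[OF assms e] .
  have "cmod (d\<^sup>2) = 1" using assms unfolding e[symmetric] by (simp add: edge_dir_def norm_power norm_sgn)
  hence "cmod d = 1 \<or> cmod d = - 1" by (simp add: norm_power power2_eq_1_iff)
  hence "cmod d = 1" using norm_ge_zero[of d] by linarith
  hence dd: "Re d * Re d + Im d * Im d = 1" using cmod_power2[of d] by (simp add: power2_eq_square)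
  have B: "B = A + of_real r * d" using r by (simp add: algebra_simps)
  have i: "Im (cnj B * d) = Im (cnj A * d)" unfolding B by (simp add: algebra_simps)
  have re: "Re (cnj d * B) = Re (cnj d * A) + r"
  proof -
    have "Re (cnj d * B) = Re (cnj d * A) + r * (Re d * Re d + Im d * Im d)"
      unfolding B by (simp add: algebra_simps)
    thus ?thesis using dd by simp
  qed
  have "edge_diff signed_area_potential A B = r * Im (cnj A * d)"
    unfolding edge_diff_def signed_area_potential_def d_def[symmetric] i re by (simp add: algebra_simps)
  also have "\<dots> = Im (cnj A * B)" unfolding B by (simp add: algebra_simps)
  finally show ?thesis .
qed

text \<open>\<open>n\<close> is a common denominator of the angles in units of pi. Divisibility by
  \<open>2 * N\<close> puts the sides of the polygon on the grid: relative to \<open>w\<close> they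
  make a right angle with directions at odd multiples of pi/N.\<close>

locale rational_tiling = regular_polygon +
  fixes \<alpha> \<beta> \<gamma> :: real and T :: "tile set" and n :: nat
  assumes tiling: "is_tiling (regular_ngon N c w) \<alpha> \<beta> \<gamma> T"
    and n: "n > 0" "2 * N dvd n"
    and angles: "\<exists>a::int. \<alpha> = pi * of_int a / real n" "\<exists>a::int. \<beta> = pi * of_int a / real n"
      "\<exists>a::int. \<gamma> = pi * of_int a / real n"
begin

definition root :: "int \<Rightarrow> complex" where
  "root j = cis (pi * of_int j / real n)"

lemma root_add: "root (i + j) = root i * root j"
  by (simp add: root_def cis_mult distrib_left add_divide_distrib)

lemma root_n: "root (j + int n) = - root j"
proof -
  have "root (int n) = - 1" using n by (simp add: root_def)
  thus ?thesis by (simp add: root_add)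
qed

text \<open>The real factor is fixed as \<open>cmod z / cmod w\<close>, because \<Psi> will later be
  required not to vanish at exactly these numbers.\<close>

definition on_grid :: "complex \<Rightarrow> bool" where
  "on_grid z \<longleftrightarrow> (\<exists>j. z = of_real (cmod z / cmod w) * (w * root j))"

lemma on_gridI:
  assumes "z = of_real r * (w * root j)"
  shows "on_grid z"
proof -
  have m: "cmod z = \<bar>r\<bar> * cmod w" unfolding assms norm_mult by (simp add: root_def)
  hence r: "cmod z / cmod w = \<bar>r\<bar>" using w0 by simp
  show ?thesis
  proof (cases "r \<ge> 0")
    case True
    thus ?thesis unfolding on_grid_def r using assms by auto
  next
    case False
    hence "z = of_real \<bar>r\<bar> * (w * root (j + int n))" unfolding root_n using assms by simp
    thus ?thesis unfolding on_grid_def r by blast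
  qed
qed

lemma on_grid_rotate:
  assumes "on_grid z"
  shows "on_grid (of_real r * (root j * z))"
proof -
  obtain i where "z = of_real (cmod z / cmod w) * (w * root i)" using assms unfolding on_grid_def by blast
  hence "of_real r * (root j * z) = of_real (r * (cmod z / cmod w)) * (w * root (j + i))"
    by (metis (no_types, lifting) mult.assoc mult.left_commute of_real_mult root_add)
  thus ?thesis by (rule on_gridI)
qed

lemma on_grid_dir:
  assumes "z \<noteq> 0"
  shows "on_grid z \<longleftrightarrow> (\<exists>j. (sgn z)\<^sup>2 = (sgn w * root j)\<^sup>2)"
proof
  assume "on_grid z"
  then obtain j where "z = of_real (cmod z / cmod w) * (w * root j)" unfolding on_grid_def by blast
  hence "z / of_real (cmod z) = w / of_real (cmod w) * root j" using assms w0 by (simp add: field_simps)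
  hence "sgn z = sgn w * root j" by (simp add: sgn_eq)
  thus "\<exists>j. (sgn z)\<^sup>2 = (sgn w * root j)\<^sup>2" by auto
next
  assume "\<exists>j. (sgn z)\<^sup>2 = (sgn w * root j)\<^sup>2"
  then obtain j where "sgn z = sgn w * root j \<or> sgn z = - (sgn w * root j)" by (auto simp: power2_eq_iff)
  then obtain j where "sgn z = sgn w * root j" using root_n by (metis mult_minus_right)
  hence "z = of_real (cmod z / cmod w) * (w * root j)" using assms w0 by (simp add: sgn_eq field_simps)
  thus "on_grid z" unfolding on_grid_def by blast
qed

lemma on_grid_minus: "on_grid z \<Longrightarrow> on_grid (- z)"
  using on_grid_rotate[of z "- 1" 0] by (simp add: root_def)

lemma cis_angle_root:
  assumes "\<exists>a::int. \<theta> = pi * of_int a / real n" "s = 1 \<or> s = - 1"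
  obtains j where "cis (s * \<theta>) = root j"
proof -
  obtain a :: int where a: "\<theta> = pi * of_int a / real n" using assms by blast
  from assms(2) show thesis
  proof
    assume "s = 1"
    thus thesis using a that[of a] by (simp add: root_def)
  next
    assume "s = - 1"
    thus thesis using a that[of "- a"] by (simp add: root_def)
  qed
qed

text \<open>The angle at \<open>A\<close> rotates one side into the next up to a real factor. Going
  around the triangle shows that its sides are all on the grid or all off it.\<close>

lemma on_grid_next_edge:
  assumes t: "triangle_with_angles x y z (A, B, C)" and x: "\<exists>a::int. x = pi * of_int a / real n"
    and g: "on_grid (B - A)"
  shows "on_grid (A - C)"
proof -
  note r = triangle_relations[OF t]
  have "sgn (orient A B C) = 1 \<or> sgn (orient A B C) = - 1" using r(6) by (auto simp: sgn_real_def)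
  then obtain j where j: "cis (sgn (orient A B C) * x) = root j" using cis_angle_root[OF x] by metis
  have "z < pi" using r by simp
  hence "sin z > 0" using r(3) by (rule sin_gt_zero[rotated])
  hence "C - A = of_real (sin y / sin z) * (root j * (B - A))"
    using r(5) unfolding j by (simp add: field_simps)
  hence "on_grid (C - A)" using on_grid_rotate[OF g] by metis
  thus ?thesis using on_grid_minus[of "C - A"] by simp
qed

lemma tile_grid_edges:
  assumes "(A, B, C) \<in> T"
  shows "on_grid (C - B) \<longleftrightarrow> on_grid (B - A)" "on_grid (A - C) \<longleftrightarrow> on_grid (B - A)"
proof -
  have t: "triangle_with_angles \<alpha> \<beta> \<gamma> (A, B, C)" using tiling assms unfolding is_tiling_def by blast
  note t2 = triangle_with_angles_rotate[OF t]
  note t3 = triangle_with_angles_rotate[OF t2]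
  have "on_grid (B - A) \<Longrightarrow> on_grid (A - C)" using on_grid_next_edge[OF t angles(1)] .
  moreover have "on_grid (C - B) \<Longrightarrow> on_grid (B - A)" using on_grid_next_edge[OF t2 angles(2)] .
  moreover have "on_grid (A - C) \<Longrightarrow> on_grid (C - B)" using on_grid_next_edge[OF t3 angles(3)] .
  ultimately show "on_grid (C - B) \<longleftrightarrow> on_grid (B - A)" "on_grid (A - C) \<longleftrightarrow> on_grid (B - A)" by blast+
qed

lemma ngon_edge_on_grid: "on_grid (V (Suc j) - V j)"
proof -
  obtain m where m: "n = 2 * N * m" using n(2) by blast
  define a where "a = (2 * real j - 1) * \<delta> / 2"
  have "cis (real j * \<delta>) - cis ((real j - 1) * \<delta>) = of_real (2 * sin (\<delta> / 2)) * cis (a + pi / 2)"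
  proof -
    have e: "real j * \<delta> = a + \<delta> / 2" "(real j - 1) * \<delta> = a - \<delta> / 2" by (simp_all add: a_def field_simps)
    show ?thesis unfolding e
      by (simp add: complex_eq_iff cos_add sin_add cos_diff sin_diff)
  qed
  moreover have "cis (a + pi / 2) = root ((2 * int j - 1) * (2 * int m) + int N * int m)"
    using N3 n(1) unfolding root_def by (intro arg_cong[of _ _ cis]) (simp add: a_def \<delta>_def m field_simps)
  ultimately have "V (Suc j) - V j = of_real (2 * sin (\<delta> / 2)) * (w * root ((2 * int j - 1) * (2 * int m) + int N * int m))"
    by (simp add: V_eq flip: right_diff_distrib)
  thus ?thesis by (rule on_gridI)
qed

lemma V_neq: "V (Suc j) \<noteq> V j"
proof
  assume "V (Suc j) = V j"
  hence "orient c (V j) (V (Suc j)) = 0" by (simp add: orient_coords)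
  thus False using orient_fan[of j] sin_gt_zero[OF \<delta>_bounds] w0 by simp
qed

text \<open>If some tile had its sides in directions outside the grid spanned by the sides of the
  polygon, then these tiles alone would satisfy the cancellation of edges with an empty boundary,
  so their total area would be zero.\<close>

lemma tile_edges_on_grid:
  assumes "(A, B, C) \<in> T"
  shows "on_grid (B - A)" "on_grid (C - B)" "on_grid (A - C)"
proof -
  define E where "E = range (\<lambda>j. (sgn w * root j)\<^sup>2)"
  \<comment> \<open>Restricting the area potential to directions off the grid keeps or drops whole
    tiles, and it drops all sides of the polygon.\<close>
  define g where "g e y = (if e \<in> E then 0 else signed_area_potential e y)" for e y
  have dirE: "edge_dir P Q \<in> E \<longleftrightarrow> on_grid (Q - P)" if "P \<noteq> Q" for P Q
    using on_grid_dir[of "Q - P"] that by (auto simp: E_def edge_dir_def)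
  have diff: "edge_diff g P Q = (if on_grid (Q - P) then 0 else Im (cnj P * Q))" if "P \<noteq> Q" for P Q
    using dirE[OF that] edge_diff_signed_area[OF that] by (simp add: edge_diff_def g_def)
  have "(\<Sum>t\<in>T. tile_sign t * edge_sum g t) = 0"
    unfolding tiling_edge_sum[OF tiling] using diff[OF V_neq[symmetric]] ngon_edge_on_grid by simp
  moreover have "tile_sign (P, Q, R) * edge_sum g (P, Q, R) = (if on_grid (Q - P) then 0 else \<bar>orient P Q R\<bar>)"
    if t: "(P, Q, R) \<in> T" for P Q R
  proof -
    have "orient P Q R \<noteq> 0" using tiling_tile_sign[OF tiling t] by (auto simp: tile_sign_def)
    hence "P \<noteq> Q" "Q \<noteq> R" "R \<noteq> P" by (auto simp: orient_coords)
    hence "edge_sum g (P, Q, R) = (if on_grid (Q - P) then 0 else Im (cnj P * Q) + Im (cnj Q * R) + Im (cnj R * P))"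
      using tile_grid_edges[OF t] by (simp add: edge_sum_def diff)
    also have "Im (cnj P * Q) + Im (cnj Q * R) + Im (cnj R * P) = orient P Q R"
      by (simp add: orient_coords algebra_simps)
    finally show ?thesis by (simp add: tile_sign_def abs_sgn mult.commute)
  qed
  hence "(\<Sum>t\<in>T. tile_sign t * edge_sum g t) = (\<Sum>(P, Q, R)\<in>T. if on_grid (Q - P) then 0 else \<bar>orient P Q R\<bar>)"
    by (intro sum.cong) auto
  ultimately have "(\<Sum>(P, Q, R)\<in>T. if on_grid (Q - P) then 0 else \<bar>orient P Q R\<bar>) = 0" by metis
  moreover have "finite T" using tiling by (simp add: is_tiling_def)
  ultimately have "\<forall>(P, Q, R)\<in>T. (if on_grid (Q - P) then 0 else \<bar>orient P Q R\<bar>) = 0"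
    by (subst (asm) sum_nonneg_eq_0_iff) auto
  moreover have "orient A B C \<noteq> 0" using tiling_tile_sign[OF tiling assms] by (auto simp: tile_sign_def)
  ultimately show "on_grid (B - A)" using assms by (force split: if_splits)
  thus "on_grid (C - B)" "on_grid (A - C)" using tile_grid_edges[OF assms] by auto
qed

end

section \<open>The conjugate tiling\<close>

text \<open>Along a fixed direction the crossing number is a difference of values of one function at
  the endpoints. The factor \<open>r\<close> may have any sign, as \<Psi> can reverse
  segments.\<close>

lemma crossing_potential:
  fixes x A B v :: complex
  assumes "B - A = of_real r * v"
  defines "f \<equiv> \<lambda>P. of_bool (Re v \<noteq> 0) * (of_bool (Re P < Re x) * of_bool (Im P + (Re x - Re P) * slope v > Im x)) :: real"
  shows "crossing x A B = f B - f A"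
proof (cases "r = 0 \<or> Re v = 0")
  case True
  thus ?thesis
  proof
    assume "r = 0"
    hence "B = A" using assms by simp
    thus ?thesis by simp
  next
    assume "Re v = 0"
    hence "Re (B - A) = 0" unfolding assms by simp
    thus ?thesis using \<open>Re v = 0\<close> by (simp add: crossing_def f_def)
  qed
next
  case False
  hence "slope (B - A) = slope v" unfolding assms by (simp add: slope_scale)
  moreover have "Re (B - A) \<noteq> 0" unfolding assms using False by simp
  hence "Re A \<noteq> Re B" by auto
  ultimately show ?thesis using slope_line[of A B "Re x"] False
    by (simp add: crossing_def f_def left_diff_distrib)
qed

lemma crossing_below:
  assumes "Im A < Im x" "Im B < Im x"
  shows "crossing x A B = 0"
proof (cases "Re A < Re x \<longleftrightarrow> Re B < Re x")
  case True
  thus ?thesis by (rule crossing_same_side)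
next
  case False
  define l where "l = (Re x - Re A) / (Re B - Re A)"
  have ne: "Re B - Re A \<noteq> 0" using False by auto
  have l: "0 \<le> l" "l \<le> 1" using False by (auto simp: l_def divide_simps)
  have "(Re x - Re A) * slope (B - A) = l * (Im B - Im A)" by (simp add: slope_def l_def)
  hence "Im A + (Re x - Re A) * slope (B - A) = (1 - l) * Im A + l * Im B" by (simp add: algebra_simps)
  also have "\<dots> < Im x" using l assms by (intro convex_bound_lt) auto
  finally show ?thesis by (simp add: crossing_def)
qed

text \<open>The coefficient of \<open>\<bar>Re x\<bar>\<close> is tan (\<theta>/2). The two edges
  form a roof with its top at \<open>\<i>\<close>, the indicator says that \<open>x\<close> is below
  it, and the bound on \<open>Re x\<close> keeps the outer ends of the roof away from the
  ray.\<close>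

lemma crossing_at_top:
  assumes S: "sin \<theta> > 0" and x: "\<bar>Re x\<bar> < sin \<theta>" "Re x \<noteq> 0"
  shows "crossing x (\<i> * cis (- \<theta>)) \<i> + crossing x \<i> (\<i> * cis \<theta>) =
    of_bool (Im x < 1 - (1 - cos \<theta>) / sin \<theta> * \<bar>Re x\<bar>)"
proof -
  define \<tau> where "\<tau> = (1 - cos \<theta>) / sin \<theta>"
  have St: "sin \<theta> * \<tau> = 1 - cos \<theta>" using S by (simp add: \<tau>_def)
  have s1: "slope (\<i> - \<i> * cis (- \<theta>)) = - \<tau>" "slope (\<i> * cis \<theta> - \<i>) = \<tau>"
    using S by (simp_all add: slope_def \<tau>_def field_simps)
  have h: "cos \<theta> + (Re x - sin \<theta>) * (- \<tau>) = 1 - \<tau> * Re x" using St by (simp add: algebra_simps)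
  have xb: "\<not> sin \<theta> < Re x" "- sin \<theta> < Re x" using x by auto
  have c1: "crossing x (\<i> * cis (- \<theta>)) \<i> = of_bool (0 < Re x) * of_bool (1 - \<tau> * Re x > Im x)"
    unfolding crossing_def s1 using x xb h by simp
  have c2: "crossing x \<i> (\<i> * cis \<theta>) = of_bool (\<not> 0 < Re x) * of_bool (1 + \<tau> * Re x > Im x)"
    unfolding crossing_def s1 using x xb by (simp add: mult.commute)
  show ?thesis unfolding c1 c2 \<tau>_def[symmetric] using x by (cases "0 < Re x") auto
qed

text \<open>The condition on the sine says that {k/N} lies strictly between 0 and 1/2.
  \<open>j0\<close> is the vertex under study; the last two assumptions prevent the polygon and the
  sides of the tiles from collapsing.\<close>

locale conjugate_tiling = rational_tiling +
  fixes k j0 :: nat and \<Psi> :: "complex \<Rightarrow> complex"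
  assumes k: "coprime k (2 * n)" "sin (real k * \<delta>) > 0"
    and j0: "j0 \<in> {1..N}"
    and \<Psi>_add: "\<And>x y. \<Psi> (x + y) = \<Psi> x + \<Psi> y"
    and \<Psi>_root1: "\<And>x. \<Psi> (cis (pi / real n) * x) = cis (pi * real k / real n) * \<Psi> x"
    and \<Psi>_real: "\<And>r. \<Psi> (of_real r) \<in> \<real>"
    and \<Psi>_1: "\<Psi> 1 \<noteq> 0"
    and \<Psi>_edge: "\<And>A B C. (A, B, C) \<in> T \<Longrightarrow> \<Psi> (of_real (cmod (B - A) / cmod w)) \<noteq> 0"
begin

lemma \<Psi>_0 [simp]: "\<Psi> 0 = 0"
  using \<Psi>_add[of 0 0] by simp

lemma \<Psi>_diff: "\<Psi> (x - y) = \<Psi> x - \<Psi> y"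
  using \<Psi>_add[of "x - y" y] by simp

lemma \<Psi>_root: "\<Psi> (root j * x) = root (int k * j) * \<Psi> x"
proof (induction j arbitrary: x rule: int_induct[where k = 0])
  case base
  show ?case by (simp add: root_def)
next
  have one: "\<Psi> (root 1 * x) = root (int k) * \<Psi> x" for x
    using \<Psi>_root1 by (simp add: root_def)
  {
    case (step1 i)
    have "\<Psi> (root (i + 1) * x) = root (int k * i) * (root (int k) * \<Psi> x)"
      unfolding root_add mult.assoc step1 one ..
    thus ?case by (simp add: distrib_left root_add)
  next
    case (step2 i)
    have "root (int k) * \<Psi> (root (i - 1) * x) = \<Psi> (root i * x)"
      using one[of "root (i - 1) * x"] root_add[of 1 "i - 1"] by (simp add: mult.assoc)
    also have "\<dots> = root (int k) * (root (int k * (i - 1)) * \<Psi> x)"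
      unfolding step2 using root_add[of "int k" "int k * (i - 1)"] by (simp add: algebra_simps)
    finally show ?case by (simp add: root_def)
  }
qed

lemma sin_root: "of_real (sin (pi * of_int j / real n)) * (2 * \<i>) = root j - root (- j)"
  by (simp add: root_def complex_eq_iff)

lemma root_scaled: "cis (real k * (pi * of_int j / real n)) = root (int k * j)"
  by (simp add: root_def mult_ac)

text \<open>Multiplication by twice \<open>\<i>\<close> times such a sine is a difference of two
  powers of \<zeta>, so additivity suffices to pull it through \<Psi>.\<close>

lemma \<Psi>_sin:
  assumes "z = pi * of_int j / real n"
  shows "\<Psi> (of_real (sin z) * (2 * \<i>) * x) = of_real (sin (real k * z)) * (2 * \<i>) * \<Psi> x"
proof -
  have kz: "real k * z = pi * of_int (int k * j) / real n" unfolding assms by simp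
  show ?thesis unfolding kz unfolding assms sin_root left_diff_distrib \<Psi>_diff \<Psi>_root by simp
qed

text \<open>Normalisation: the images of the corners come to lie on the unit circle, and that of
  \<open>V j0\<close> at its top point \<open>\<i>\<close>.\<close>

definition u :: complex where
  "u = \<i> * cis (- (real k * ((real j0 - 1) * \<delta>))) / \<Psi> 1"

definition \<Phi> :: "complex \<Rightarrow> complex" where
  "\<Phi> y = u * \<Psi> ((y - c) / w)"

abbreviation covers :: "tile \<Rightarrow> complex \<Rightarrow> bool" where
  "covers t \<equiv> strictly_inside (map_tile \<Phi> t)"

abbreviation cover_count :: "complex \<Rightarrow> real" where
  "cover_count x \<equiv> \<Sum>t\<in>T. of_bool (covers t x)"

abbreviation star_crossings :: "complex \<Rightarrow> real" where
  "star_crossings x \<equiv> \<Sum>j\<in>{1..N}. crossing x (\<Phi> (V j)) (\<Phi> (V (Suc j)))"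

lemma u_nonzero: "u \<noteq> 0"
  using \<Psi>_1 by (simp add: u_def)

lemma \<Phi>_diff: "\<Phi> B - \<Phi> A = u * \<Psi> ((B - A) / w)"
  by (simp add: \<Phi>_def flip: right_diff_distrib \<Psi>_diff diff_divide_distrib)

lemma \<delta>_root: "cis (of_int i * \<delta>) = root (2 * i * int (n div N))"
proof -
  obtain m where m: "n = 2 * N * m" using n(2) by blast
  hence "n div N = 2 * m" using N3 by simp
  thus ?thesis using N3 n(1) unfolding root_def by (intro arg_cong[of _ _ cis]) (simp add: \<delta>_def m field_simps)
qed

lemma \<Phi>_vertex: "\<Phi> (V j) = \<i> * cis (of_int (int k * (int j - int j0)) * \<delta>)"
proof -
  have r: "real j - 1 = of_int (int j - 1)" by simp
  have "(V j - c) / w = root (2 * (int j - 1) * int (n div N)) * 1"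
    using w0 unfolding V_eq r \<delta>_root by simp
  hence "\<Phi> (V j) = u * (root (int k * (2 * (int j - 1) * int (n div N))) * \<Psi> 1)"
    by (simp only: \<Phi>_def \<Psi>_root)
  also have "root (int k * (2 * (int j - 1) * int (n div N))) = cis (of_int (int k * (int j - 1)) * \<delta>)"
    unfolding \<delta>_root by (simp add: mult_ac)
  also have "u * (cis (of_int (int k * (int j - 1)) * \<delta>) * \<Psi> 1) =
      \<i> * (cis (- (real k * ((real j0 - 1) * \<delta>))) * cis (of_int (int k * (int j - 1)) * \<delta>))"
    using \<Psi>_1 by (simp add: u_def)
  also have "cis (- (real k * ((real j0 - 1) * \<delta>))) * cis (of_int (int k * (int j - 1)) * \<delta>)
      = cis (of_int (int k * (int j - int j0)) * \<delta>)"
    unfolding cis_mult by (intro arg_cong[of _ _ cis]) (simp add: algebra_simps)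
  finally show ?thesis .
qed

text \<open>A direction is stored as a square, so the power of \<zeta> is known only up to sign.
  Neither \<open>slope\<close> nor the test for vertical lines depends on the choice.\<close>

definition direction :: "complex \<Rightarrow> complex" where
  "direction e = u * root (int k * (SOME j. e = (sgn w * root j)\<^sup>2))"

text \<open>The first factor excludes vertical directions, where \<^const>\<open>slope\<close> has the value \<open>x / 0 = 0\<close>.\<close>

definition potential :: "complex \<Rightarrow> complex \<Rightarrow> complex \<Rightarrow> real" where
  "potential x e y = of_bool (Re (direction e) \<noteq> 0) *
    (of_bool (Re (\<Phi> y) < Re x) * of_bool (Im (\<Phi> y) + (Re x - Re (\<Phi> y)) * slope (direction e) > Im x))"

lemma direction_eq:
  assumes "e = (sgn w * root j)\<^sup>2"
  shows "direction e = u * root (int k * j) \<or> direction e = - (u * root (int k * j))"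
proof -
  define i where "i = (SOME i. e = (sgn w * root i)\<^sup>2)"
  have "e = (sgn w * root i)\<^sup>2" unfolding i_def using assms by (rule someI)
  hence "(sgn w * root i)\<^sup>2 = (sgn w * root j)\<^sup>2" using assms by simp
  hence "sgn w * root i = sgn w * root j \<or> sgn w * root i = - (sgn w * root j)"
    by (simp only: power2_eq_iff)
  moreover have "sgn w \<noteq> 0" using w0 by (simp add: sgn_zero_iff)
  ultimately have "root i = root j \<or> root i = - root j" by (metis mult_left_cancel mult_minus_right)
  moreover have R: "root (int k * i) = \<Psi> (root i) / \<Psi> 1" for i
    using \<Psi>_root[of i 1] \<Psi>_1 by simp
  moreover have "\<Psi> (- root j) = - \<Psi> (root j)" using \<Psi>_diff[of 0 "root j"] by simp
  ultimately have "root (int k * i) = root (int k * j) \<or> root (int k * i) = - root (int k * j)" by auto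
  thus ?thesis unfolding direction_def i_def[symmetric] by auto
qed

lemma edge_diff_potential:
  assumes "A \<noteq> B" "on_grid (B - A)"
  shows "edge_diff (potential x) A B = crossing x (\<Phi> A) (\<Phi> B)"
proof -
  obtain j where j: "B - A = of_real (cmod (B - A) / cmod w) * (w * root j)"
    using assms(2) unfolding on_grid_def by blast
  define r where "r = cmod (B - A) / cmod w"
  have "(B - A) / of_real (cmod (B - A)) = w / of_real (cmod w) * root j"
    by (subst j) (use assms(1) w0 in \<open>simp add: field_simps\<close>)
  hence "edge_dir A B = (sgn w * root j)\<^sup>2" by (simp add: edge_dir_def sgn_eq)
  note d = direction_eq[OF this]
  have "(B - A) / w = root j * of_real r" unfolding r_def by (subst j) (use w0 in \<open>simp add: field_simps\<close>)
  hence im: "\<Phi> B - \<Phi> A = u * (root (int k * j) * \<Psi> (of_real r))" unfolding \<Phi>_diff by (simp only: \<Psi>_root)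
  obtain q where q: "\<Psi> (of_real r) = of_real q" using \<Psi>_real Reals_cases by metis
  have "\<exists>p. \<Phi> B - \<Phi> A = of_real p * direction (edge_dir A B)"
    using d
  proof
    assume "direction (edge_dir A B) = u * root (int k * j)"
    thus ?thesis using im q by (intro exI[of _ q]) simp
  next
    assume "direction (edge_dir A B) = - (u * root (int k * j))"
    thus ?thesis using im q by (intro exI[of _ "- q"]) simp
  qed
  then obtain p where p: "\<Phi> B - \<Phi> A = of_real p * direction (edge_dir A B)" by blast
  show ?thesis unfolding edge_diff_def potential_def crossing_potential[OF p] by simp
qed

lemma tile_edges_distinct:
  assumes "(A, B, C) \<in> T"
  shows "A \<noteq> B" "B \<noteq> C" "C \<noteq> A"
proof -
  have "orient A B C \<noteq> 0" using tiling_tile_sign[OF tiling assms] by (auto simp: tile_sign_def)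
  thus "A \<noteq> B" "B \<noteq> C" "C \<noteq> A" by (auto simp: orient_coords)
qed

text \<open>The cancellation takes place in the original tiling, with \<Phi> hidden in the
  potential; nothing about incidences between image triangles is used.\<close>

lemma image_crossings_sum:
  "(\<Sum>t\<in>T. tile_sign t * crossings x (map_tile \<Phi> t)) = star_crossings x"
proof -
  have "crossings x (map_tile \<Phi> t) = edge_sum (potential x) t" if t: "t \<in> T" for t
  proof -
    obtain A B C where ABC: "t = (A, B, C)" by (cases t) auto
    have "(A, B, C) \<in> T" using t ABC by simp
    note tile_edges_on_grid[OF this] tile_edges_distinct[OF this]
    thus ?thesis by (simp add: ABC crossings_def map_tile_def edge_sum_def edge_diff_potential)
  qed
  hence "(\<Sum>t\<in>T. tile_sign t * crossings x (map_tile \<Phi> t)) = (\<Sum>t\<in>T. tile_sign t * edge_sum (potential x) t)"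
    by (intro sum.cong) auto
  also have "\<dots> = (\<Sum>j\<in>{1..N}. edge_diff (potential x) (V j) (V (Suc j)))" by (rule tiling_edge_sum[OF tiling])
  also have "\<dots> = star_crossings x"
    by (intro sum.cong refl edge_diff_potential V_neq[symmetric] ngon_edge_on_grid)
  finally show ?thesis .
qed

lemma sin_scaled_nonzero:
  assumes "z = pi * of_int j / real n" "sin z \<noteq> 0"
  shows "sin (real k * z) \<noteq> 0"
proof
  assume "sin (real k * z) = 0"
  then obtain i :: int where "real k * z = of_int i * pi" using sin_zero_iff_int2 by blast
  hence "real_of_int (int k * j) = of_int (i * int n)" using n(1) unfolding assms(1) by (simp add: field_simps)
  hence "int k * j = i * int n" by (simp only: of_int_eq_iff)
  hence "int n dvd int k * j" by simp
  moreover have "coprime (int n) (int k)" using k(1) by (simp add: coprime_commute)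
  ultimately have "int n dvd j" by (simp add: coprime_dvd_mult_right_iff)
  then obtain l where "j = int n * l" by blast
  hence "z = of_int l * pi" using n(1) assms(1) by simp
  hence "sin z = 0" using sin_zero_iff_int2 by blast
  thus False using assms(2) by simp
qed

lemma image_relation:
  assumes t: "triangle_with_angles x y z (A, B, C)"
    and x: "\<exists>a::int. x = pi * of_int a / real n" and y: "\<exists>a::int. y = pi * of_int a / real n"
    and z: "\<exists>a::int. z = pi * of_int a / real n"
  shows "of_real (sin (real k * z)) * (\<Phi> C - \<Phi> A) =
    cis (sgn (orient A B C) * (real k * x)) * (of_real (sin (real k * y)) * (\<Phi> B - \<Phi> A))"
proof -
  define s where "s = sgn (orient A B C)"
  note r = triangle_relations[OF t]
  have s: "s = 1 \<or> s = - 1" using r(6) by (auto simp: s_def sgn_real_def)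
  obtain a where a: "x = pi * of_int a / real n" using x by blast
  obtain i where i: "cis (s * x) = root i" "cis (s * (real k * x)) = root (int k * i)"
  proof -
    from s show thesis
    proof
      assume "s = 1"
      thus thesis using that[of a] root_scaled[of a] by (simp add: a root_def)
    next
      assume "s = - 1"
      thus thesis using that[of "- a"] root_scaled[of "- a"] by (simp add: a root_def)
    qed
  qed
  obtain jy where jy: "y = pi * of_int jy / real n" using y by blast
  obtain jz where jz: "z = pi * of_int jz / real n" using z by blast
  have "of_real (sin z) * (2 * \<i>) * ((C - A) / w) = (2 * \<i> / w) * (of_real (sin z) * (C - A))" by simp
  also have "\<dots> = root i * (of_real (sin y) * (2 * \<i>) * ((B - A) / w))"
    unfolding r(5) s_def[symmetric] i(1) by simp
  finally have "of_real (sin z) * (2 * \<i>) * ((C - A) / w) = root i * (of_real (sin y) * (2 * \<i>) * ((B - A) / w))" .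
  from arg_cong[OF this, of \<Psi>]
  have "of_real (sin (real k * z)) * (2 * \<i>) * \<Psi> ((C - A) / w) =
      root (int k * i) * (of_real (sin (real k * y)) * (2 * \<i>) * \<Psi> ((B - A) / w))"
    unfolding \<Psi>_sin[OF jz] \<Psi>_root \<Psi>_sin[OF jy] .
  thus ?thesis unfolding s_def[symmetric] i(2) \<Phi>_diff by simp
qed

text \<open>The factor by which \<Phi> changes the orientation of every tile. Being symmetric in the
  angles, it does not depend on the corner at which it is computed.\<close>

definition eps :: real where
  "eps = sgn (sin (real k * \<alpha>) * sin (real k * \<beta>) * sin (real k * \<gamma>))"

lemma eps_cases:
  assumes "t \<in> T"
  shows "eps = 1 \<or> eps = - 1"
proof -
  obtain A B C where "triangle_with_angles \<alpha> \<beta> \<gamma> (A, B, C)"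
    using tiling assms unfolding is_tiling_def by (cases t) blast
  note r = triangle_relations[OF this]
  have "\<alpha> < pi" "\<beta> < pi" "\<gamma> < pi" using r by simp_all
  hence "sin \<alpha> \<noteq> 0" "sin \<beta> \<noteq> 0" "sin \<gamma> \<noteq> 0" using r sin_gt_zero by (metis less_irrefl)+
  hence "sin (real k * \<alpha>) \<noteq> 0" "sin (real k * \<beta>) \<noteq> 0" "sin (real k * \<gamma>) \<noteq> 0"
    using angles sin_scaled_nonzero by metis+
  thus ?thesis by (auto simp: eps_def sgn_real_def)
qed

lemma image_edge_nonzero:
  assumes "(A, B, C) \<in> T"
  shows "\<Phi> B \<noteq> \<Phi> A"
proof -
  obtain j where j: "B - A = of_real (cmod (B - A) / cmod w) * (w * root j)"
    using tile_edges_on_grid(1)[OF assms] unfolding on_grid_def by blast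
  have "(B - A) / w = root j * of_real (cmod (B - A) / cmod w)"
    by (subst j) (use w0 in \<open>simp add: field_simps\<close>)
  hence "\<Phi> B - \<Phi> A = u * (root (int k * j) * \<Psi> (of_real (cmod (B - A) / cmod w)))"
    unfolding \<Phi>_diff by (simp only: \<Psi>_root)
  hence "\<Phi> B - \<Phi> A \<noteq> 0" using u_nonzero \<Psi>_edge[OF assms] by (simp add: root_def)
  thus ?thesis by simp
qed

lemma image_sign:
  assumes "t \<in> T"
  shows "tile_sign (map_tile \<Phi> t) = tile_sign t * eps"
proof -
  obtain A B C where ABC: "t = (A, B, C)" by (cases t) auto
  have mem: "(A, B, C) \<in> T" using assms ABC by simp
  have t: "triangle_with_angles \<alpha> \<beta> \<gamma> (A, B, C)" using tiling mem unfolding is_tiling_def by blast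
  define s where "s = sgn (orient A B C)"
  have s: "s = 1 \<or> s = - 1" using triangle_relations(6)[OF t] by (auto simp: s_def sgn_real_def)
  hence ss: "sin (s * x) = s * sin x" for x by auto
  define b where "b = \<Phi> B - \<Phi> A"
  have b0: "b \<noteq> 0" using image_edge_nonzero[OF mem] by (simp add: b_def)
  have rel: "of_real (sin (real k * \<gamma>)) * (\<Phi> C - \<Phi> A) = cis (s * (real k * \<alpha>)) * (of_real (sin (real k * \<beta>)) * b)"
    using image_relation[OF t angles] by (simp only: s_def b_def)
  have "of_real (sin (real k * \<gamma>)) * (cnj b * (\<Phi> C - \<Phi> A)) = of_real (sin (real k * \<beta>) * (cmod b)\<^sup>2) * cis (s * (real k * \<alpha>))"
  proof -
    have "of_real (sin (real k * \<gamma>)) * (cnj b * (\<Phi> C - \<Phi> A)) = cnj b * (of_real (sin (real k * \<gamma>)) * (\<Phi> C - \<Phi> A))"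
      by (simp only: mult_ac)
    also have "\<dots> = of_real (sin (real k * \<beta>)) * (b * cnj b) * cis (s * (real k * \<alpha>))" unfolding rel by (simp only: mult_ac)
    finally show ?thesis by (simp only: complex_norm_square[symmetric] of_real_mult)
  qed
  moreover define X where "X = cnj b * (\<Phi> C - \<Phi> A)"
  ultimately have "of_real (sin (real k * \<gamma>)) * X = of_real (sin (real k * \<beta>) * (cmod b)\<^sup>2) * cis (s * (real k * \<alpha>))"
    by simp
  from arg_cong[OF this, of Im]
  have "sin (real k * \<gamma>) * Im X = sin (real k * \<beta>) * (cmod b)\<^sup>2 * (s * sin (real k * \<alpha>))"
    by (simp add: ss)
  moreover have "Im X = orient (\<Phi> A) (\<Phi> B) (\<Phi> C)" by (simp only: orient_def X_def b_def)
  ultimately have "sin (real k * \<gamma>) * orient (\<Phi> A) (\<Phi> B) (\<Phi> C) = sin (real k * \<beta>) * (cmod b)\<^sup>2 * (s * sin (real k * \<alpha>))"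
    by simp
  \<comment> \<open>One more factor of this sine makes the right side symmetric in the angles and
    leaves a square on the left, which does not affect the sign.\<close>
  hence "(sin (real k * \<gamma>))\<^sup>2 * orient (\<Phi> A) (\<Phi> B) (\<Phi> C) =
     (cmod b)\<^sup>2 * (s * (sin (real k * \<alpha>) * sin (real k * \<beta>) * sin (real k * \<gamma>)))"
    by (simp add: power2_eq_square mult_ac)
  hence "sgn ((sin (real k * \<gamma>))\<^sup>2 * orient (\<Phi> A) (\<Phi> B) (\<Phi> C)) = s * eps"
    using b0 by (simp add: sgn_mult eps_def s_def)
  moreover have "sin (real k * \<gamma>) \<noteq> 0" using eps_cases[OF assms] by (auto simp: eps_def)
  hence "(sgn (sin (real k * \<gamma>)))\<^sup>2 = 1" by (auto simp: sgn_real_def)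
  ultimately show ?thesis by (simp add: sgn_mult ABC tile_sign_def map_tile_def s_def)
qed

text \<open>The crossing number of an image carries the orientation of the image, and its
  coefficient that of the tile; their product is \<open>eps\<close> throughout, so the signed count
  is a plain count up to this factor.\<close>

lemma image_crossings_count:
  assumes "\<forall>t\<in>T. generic (map_tile \<Phi> t) x"
  shows "eps * cover_count x =
    star_crossings x"
  unfolding image_crossings_sum[symmetric] sum_distrib_left
proof (rule sum.cong[OF refl])
  fix t assume t: "t \<in> T"
  obtain A B C where ABC: "map_tile \<Phi> t = (A, B, C)" by (cases "map_tile \<Phi> t") auto
  have "crossings x (map_tile \<Phi> t) = tile_sign (map_tile \<Phi> t) * of_bool (covers t x)"
    using crossings_inside[of A B C x] assms t unfolding ABC tile_sign_def by (force simp: generic_def ABC)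
  hence "crossings x (map_tile \<Phi> t) = tile_sign t * eps * of_bool (covers t x)"
    unfolding image_sign[OF t] .
  moreover have "tile_sign t * tile_sign t = 1"
    using tiling_tile_sign[OF tiling t] by (cases t) (auto simp: tile_sign_def sgn_real_def split: if_splits)
  ultimately show "eps * of_bool (covers t x) = tile_sign t * crossings x (map_tile \<Phi> t)"
    by (metis (no_types, lifting) mult.assoc mult.left_commute mult_1)
qed

section \<open>The star polygon near its top vertex\<close>

definition \<tau> :: real where
  "\<tau> = (1 - cos (real k * \<delta>)) / sin (real k * \<delta>)"

text \<open>As \<open>k\<close> is coprime to \<open>N\<close>, every other corner is at a nonzero
  multiple of \<delta> from the top, modulo a full turn.\<close>

lemma image_vertex_low:
  assumes "j \<in> {1..N}" "j \<noteq> j0"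
  shows "Im (\<Phi> (V j)) \<le> cos \<delta>"
proof -
  define l where "l = 2 * (int k * (int j - int j0))"
  have "cos (of_int l * pi / real N) \<le> cos (of_int 2 * pi / real N)"
  proof (rule cos_int_multiple_le)
    fix q
    have "int k * (int j - int j0) - int N * q \<noteq> 0"
    proof
      assume "int k * (int j - int j0) - int N * q = 0"
      hence "int N dvd int k * (int j - int j0)" by simp
      moreover have "coprime (int N) (int k)"
      proof -
        have "coprime k N" using k(1) n(2) by (metis coprime_divisors dvd_mult dvd_mult_right dvd_refl)
        thus ?thesis by (simp add: coprime_commute)
      qed
      ultimately have "int N dvd int j - int j0" by (simp add: coprime_dvd_mult_right_iff)
      hence "\<bar>int N\<bar> \<le> \<bar>int j - int j0\<bar>" using assms(2) by (intro dvd_imp_le_int) auto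
      thus False using assms(1) j0 by auto
    qed
    hence "\<bar>int k * (int j - int j0) - int N * q\<bar> \<ge> 1" by linarith
    moreover have "l - 2 * int N * q = 2 * (int k * (int j - int j0) - int N * q)" by (simp add: l_def algebra_simps)
    ultimately show "2 \<le> \<bar>l - 2 * int N * q\<bar>" by (simp add: abs_mult)
  qed (use N3 in auto)
  moreover have "of_int l * pi / real N = of_int (int k * (int j - int j0)) * \<delta>" by (simp add: l_def \<delta>_def)
  moreover have "of_int 2 * pi / real N = \<delta>" by (simp add: \<delta>_def)
  ultimately show ?thesis unfolding \<Phi>_vertex by simp
qed

text \<open>Above height cos \<delta> only the two edges at the top vertex can meet the ray, and
  they form the roof of \<open>crossing_at_top\<close>.\<close>

lemma image_polygon_winding:
  assumes x: "cos \<delta> < Im x" "\<bar>Re x\<bar> < sin (real k * \<delta>)" "Re x \<noteq> 0"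
  shows "star_crossings x = of_bool (Im x < 1 - \<tau> * \<bar>Re x\<bar>)"
proof -
  define jm where "jm = (if j0 = 1 then N else j0 - 1)"
  have jm: "jm \<in> {1..N}" "jm \<noteq> j0" using j0 N3 by (auto simp: jm_def)
  have Vjm: "V (Suc jm) = V j0" using V_wrap j0 by (auto simp: jm_def)
  have per: "\<Phi> (V (j + N)) = \<Phi> (V j)" for j
  proof -
    have "V (j + N) = V j"
    proof -
      have "(real (j + N) - 1) * \<delta> = (real j - 1) * \<delta> + 2 * pi" using N3 by (simp add: \<delta>_def field_simps)
      thus ?thesis unfolding V_eq by (simp add: cis_mult[symmetric])
    qed
    thus ?thesis by simp
  qed
  have top: "\<Phi> (V j0) = \<i>" by (simp add: \<Phi>_vertex)
  have right: "\<Phi> (V (Suc j0)) = \<i> * cis (real k * \<delta>)" by (simp add: \<Phi>_vertex)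
  have left: "\<Phi> (V jm) = \<i> * cis (- (real k * \<delta>))"
  proof (cases "j0 = 1")
    case True
    have "\<Phi> (V jm) = \<Phi> (V (0 + N))" using True by (simp add: jm_def)
    also have "\<dots> = \<Phi> (V 0)" by (rule per)
    also have "\<dots> = \<i> * cis (of_int (- int k) * \<delta>)"
    proof -
      have "int k * (int 0 - int j0) = - int k" using True by simp
      thus ?thesis by (simp only: \<Phi>_vertex)
    qed
    finally show ?thesis by simp
  next
    case False
    thus ?thesis using j0 by (simp add: jm_def \<Phi>_vertex of_nat_diff)
  qed
  have "star_crossings x = (\<Sum>j\<in>{jm, j0}. crossing x (\<Phi> (V j)) (\<Phi> (V (Suc j))))"
  proof (rule sum.mono_neutral_right)
    show "\<forall>j\<in>{1..N} - {jm, j0}. crossing x (\<Phi> (V j)) (\<Phi> (V (Suc j))) = 0"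
    proof
      fix j assume j: "j \<in> {1..N} - {jm, j0}"
      have "Im (\<Phi> (V j)) \<le> cos \<delta>" using j by (intro image_vertex_low) auto
      moreover have "Im (\<Phi> (V (Suc j))) \<le> cos \<delta>"
      proof (cases "j = N")
        case True
        hence "j0 \<noteq> 1" using j by (auto simp: jm_def)
        thus ?thesis using True V_wrap image_vertex_low[of 1] N3 by auto
      next
        case False
        have "Suc j \<noteq> j0" using j by (auto simp: jm_def split: if_splits)
        thus ?thesis using j False by (intro image_vertex_low) auto
      qed
      ultimately show "crossing x (\<Phi> (V j)) (\<Phi> (V (Suc j))) = 0"
        using x by (intro crossing_below) auto
    qed
  qed (use jm j0 in auto)
  also have "\<dots> = crossing x (\<i> * cis (- (real k * \<delta>))) \<i> + crossing x \<i> (\<i> * cis (real k * \<delta>))"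
    using jm(2) by (simp add: Vjm top left right)
  also have "\<dots> = of_bool (Im x < 1 - \<tau> * \<bar>Re x\<bar>)"
    unfolding \<tau>_def by (rule crossing_at_top[OF k(2) x(2,3)])
  finally show ?thesis .
qed

end

section \<open>Sectors at a vertex\<close>

lemma negligible_line:
  assumes "A \<noteq> B"
  shows "negligible {x. orient A B x = 0}"
proof -
  define a where "a = Complex (- (Im B - Im A)) (Re B - Re A)"
  have "a \<noteq> 0" using assms by (auto simp: a_def complex_eq_iff)
  moreover have "{x. orient A B x = 0} = {x. a \<bullet> x = a \<bullet> A}"
    by (auto simp: a_def orient_coords inner_complex_def algebra_simps)
  ultimately show ?thesis using negligible_hyperplane[of a "a \<bullet> A"] by simp
qed

lemma negligible_vertical: "negligible {x. Re x = r}"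
proof -
  have "{x. Re x = r} = {x. 1 \<bullet> x = r}" by (simp add: inner_complex_def)
  thus ?thesis using negligible_hyperplane[of "1::complex" r] by simp
qed

lemma generic_point:
  assumes "finite S" "\<And>t. t \<in> S \<Longrightarrow> tile_sign t \<noteq> 0" "open U" "U \<noteq> {}"
  obtains x where "x \<in> U" "Re x \<noteq> 0" "\<And>t. t \<in> S \<Longrightarrow> generic t x"
proof -
  have "negligible {x. \<not> generic t x}" if t: "t \<in> S" for t
  proof -
    obtain A B C where ABC: "t = (A, B, C)" by (cases t) auto
    have ne: "A \<noteq> B" "B \<noteq> C" "C \<noteq> A" using assms(2)[OF t] by (auto simp: ABC tile_sign_def orient_coords)
    have "{x. \<not> generic t x} = {x. orient A B x = 0} \<union> {x. orient B C x = 0} \<union> {x. orient C A x = 0}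
        \<union> {x. Re x = Re A} \<union> {x. Re x = Re B} \<union> {x. Re x = Re C}"
      by (auto simp: ABC generic_def off_lines_def)
    thus ?thesis using ne by (simp add: negligible_line negligible_vertical)
  qed
  hence "negligible ({x. Re x = 0} \<union> (\<Union>t\<in>S. {x. \<not> generic t x}))"
    using assms(1) negligible_vertical by (intro negligible_Un negligible_Union) auto
  moreover have "\<not> negligible U" using assms(3,4) open_not_negligible by blast
  ultimately have "\<not> U \<subseteq> {x. Re x = 0} \<union> (\<Union>t\<in>S. {x. \<not> generic t x})"
    using negligible_subset by blast
  thus thesis using that by blast
qed

text \<open>Angles are measured from the downward vertical, so the cone under the roof becomes a
  symmetric interval; its half-width is pi/2 - pi \<kappa> because \<tau> is tan (pi
  \<kappa>).\<close>

lemma sector_ray_angle: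
  assumes v: "v \<noteq> 0" "Im v \<le> - \<tau> * \<bar>Re v\<bar>"
    and \<kappa>: "0 < \<kappa>" "\<kappa> < 1 / 2" "\<tau> * cos (pi * \<kappa>) = sin (pi * \<kappa>)"
  obtains \<phi> where "v = of_real (cmod v) * (- \<i> * cis \<phi>)" "\<bar>\<phi>\<bar> \<le> pi / 2 - pi * \<kappa>"
proof -
  define \<phi> where "\<phi> = Arg (\<i> * v)"
  have b: "- pi < \<phi>" "\<phi> \<le> pi" using Arg_bounded[of "\<i> * v"] by (auto simp: \<phi>_def)
  have "cis \<phi> = sgn (\<i> * v)" unfolding \<phi>_def using v by (intro cis_Arg) auto
  also have "\<dots> = \<i> * v / of_real (cmod v)" by (simp add: sgn_eq norm_mult)
  finally have vc: "v = of_real (cmod v) * (- \<i> * cis \<phi>)" using v by (simp add: field_simps)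
  have Im: "Im v = - cmod v * cos \<phi>" and Re: "Re v = cmod v * sin \<phi>" by (subst vc, simp)+
  have "cmod v * (\<tau> * \<bar>sin \<phi>\<bar>) \<le> cmod v * cos \<phi>" using v(2) by (simp add: Im Re abs_mult algebra_simps)
  hence "\<tau> * \<bar>sin \<phi>\<bar> \<le> cos \<phi>" using v by simp
  moreover have pk: "pi * \<kappa> < pi / 2" "pi * \<kappa> > 0" using \<kappa> by (auto simp: field_simps)
  have cp: "cos (pi * \<kappa>) > 0" by (intro cos_gt_zero_pi) (use pk pi_gt_zero in linarith)+
  ultimately have "\<tau> * \<bar>sin \<phi>\<bar> * cos (pi * \<kappa>) \<le> cos \<phi> * cos (pi * \<kappa>)" by (simp add: mult_right_mono)
  hence "sin (pi * \<kappa>) * \<bar>sin \<phi>\<bar> \<le> cos \<phi> * cos (pi * \<kappa>)" using \<kappa>(3) by (metis mult.assoc mult.commute)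
  moreover have "sin \<bar>\<phi>\<bar> \<ge> 0" using b by (intro sin_ge_zero) auto
  hence "\<bar>sin \<phi>\<bar> = sin \<bar>\<phi>\<bar>" by (cases "\<phi> \<ge> 0") auto
  moreover have "cos \<bar>\<phi>\<bar> = cos \<phi>" by (cases "\<phi> \<ge> 0") auto
  ultimately have c: "cos (\<bar>\<phi>\<bar> + pi * \<kappa>) \<ge> 0" by (simp add: cos_add mult.commute)
  have "\<bar>\<phi>\<bar> + pi * \<kappa> \<le> pi / 2"
  proof (rule ccontr)
    assume "\<not> ?thesis"
    hence "sin (\<bar>\<phi>\<bar> + pi * \<kappa> - pi / 2) > 0" by (intro sin_gt_zero) (use b pk in linarith)+
    thus False using c by (simp add: sin_diff)
  qed
  thus thesis using that vc by auto
qed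

text \<open>Since \<open>r\<close> and \<open>r'\<close> may have any sign, the relation determines
  the opening angle only modulo pi. The opening lies between 0 and pi, which leaves pi times the
  fractional part.\<close>

lemma sector_interval:
  assumes bc: "Im (cnj b * c) > 0" "Im b \<le> - \<tau> * \<bar>Re b\<bar>" "Im c \<le> - \<tau> * \<bar>Re c\<bar>"
    and rel: "of_real r * c = cis \<theta> * (of_real r' * b)" "r \<noteq> 0"
    and \<kappa>: "0 < \<kappa>" "\<kappa> < 1 / 2" "\<tau> * cos (pi * \<kappa>) = sin (pi * \<kappa>)"
  obtains l h where "l < h" "h - l = pi * frac (\<theta> / pi)" "- (pi / 2 - pi * \<kappa>) \<le> l" "h \<le> pi / 2 - pi * \<kappa>"
    "\<And>\<phi>. \<lbrakk>l < \<phi>; \<phi> < h\<rbrakk> \<Longrightarrow> \<exists>p q. p > 0 \<and> q > 0 \<and> - \<i> * cis \<phi> = of_real p * b + of_real q * c"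
proof -
  have ne: "b \<noteq> 0" "c \<noteq> 0" using bc(1) by auto
  obtain l where l: "b = of_real (cmod b) * (- \<i> * cis l)" "\<bar>l\<bar> \<le> pi / 2 - pi * \<kappa>"
    using sector_ray_angle[OF ne(1) bc(2) \<kappa>] .
  obtain h where h: "c = of_real (cmod c) * (- \<i> * cis h)" "\<bar>h\<bar> \<le> pi / 2 - pi * \<kappa>"
    using sector_ray_angle[OF ne(2) bc(3) \<kappa>] .
  define x y where "x = cmod b" and "y = cmod c"
  have pos: "x > 0" "y > 0" using ne by (auto simp: x_def y_def)
  have b: "b = of_real x * (- \<i> * cis l)" and c: "c = of_real y * (- \<i> * cis h)"
    using l(1) h(1) by (simp_all only: x_def y_def)
  have "Im (cnj b * c) = x * y * sin (h - l)"
    unfolding b c by (simp add: sin_diff algebra_simps)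
  hence s: "sin (h - l) > 0" using bc(1) mult_pos_pos[OF pos] by (metis zero_less_mult_pos)
  have pk: "pi * \<kappa> > 0" using \<kappa> by simp
  have lt: "\<bar>h - l\<bar> < pi" using l(2) h(2) pk by auto
  have hl: "l < h"
  proof (rule ccontr)
    assume "\<not> l < h"
    hence "sin (l - h) \<ge> 0" using lt by (intro sin_ge_zero) auto
    moreover have "sin (l - h) = - sin (h - l)" by (metis minus_diff_eq sin_minus)
    ultimately show False using s by simp
  qed
  have "cis (h - l - \<theta>) = of_real (r' * x / (r * y))"
  proof -
    have "of_real (r * y) * (- \<i> * cis h) = of_real (r' * x) * (- \<i>) * (cis \<theta> * cis l)"
      using rel(1) unfolding b c by (simp add: mult_ac)
    hence "of_real (r * y) * cis h = of_real (r' * x) * cis (\<theta> + l)"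
      by (simp add: cis_mult mult.assoc)
    hence "of_real (r * y) * (cis h * cis (- (\<theta> + l))) = of_real (r' * x) * (cis (\<theta> + l) * cis (- (\<theta> + l)))"
      by (simp only: mult.assoc[symmetric])
    hence "of_real (r * y) * cis (h - l - \<theta>) = of_real (r' * x)"
      by (simp add: cis_mult algebra_simps)
    thus ?thesis using rel(2) pos by (simp add: field_simps)
  qed
  hence "sin (h - l - \<theta>) = 0" by (metis Im_complex_of_real cis.sel(2))
  then obtain m :: int where m: "h - l - \<theta> = of_int m * pi" using sin_zero_iff_int2 by blast
  have "frac (\<theta> / pi) = (h - l) / pi"
  proof (rule frac_unique_iff[THEN iffD2], intro conjI)
    have "\<theta> / pi - (h - l) / pi = - of_int m" using m by (simp add: field_simps)
    thus "\<theta> / pi - (h - l) / pi \<in> \<int>" by simp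
    show "0 \<le> (h - l) / pi" "(h - l) / pi < 1" using hl lt by auto
  qed
  hence "h - l = pi * frac (\<theta> / pi)" by simp
  moreover have "\<exists>p q. p > 0 \<and> q > 0 \<and> - \<i> * cis \<phi> = of_real p * b + of_real q * c" if "l < \<phi>" "\<phi> < h" for \<phi>
  proof (intro exI conjI)
    have s1: "sin (h - \<phi>) > 0" "sin (\<phi> - l) > 0" using that lt hl by (auto intro!: sin_gt_zero)
    show "sin (h - \<phi>) / (sin (h - l) * x) > 0" "sin (\<phi> - l) / (sin (h - l) * y) > 0" using s s1 pos by simp_all
    have "sin (h - l) * cos \<phi> = sin (h - \<phi>) * cos l + sin (\<phi> - l) * cos h"
    proof -
      have "sin (h - l) * cos \<phi> = (sin h * cos l - cos h * sin l) * cos \<phi>" by (simp add: sin_diff)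
      thus ?thesis by (simp add: sin_diff algebra_simps)
    qed
    moreover have "sin (h - l) * sin \<phi> = sin (h - \<phi>) * sin l + sin (\<phi> - l) * sin h"
      by (simp add: sin_diff algebra_simps)
    ultimately have "of_real (sin (h - l)) * cis \<phi> = of_real (sin (h - \<phi>)) * cis l + of_real (sin (\<phi> - l)) * cis h"
      by (simp add: complex_eq_iff)
    hence "cis \<phi> = of_real (sin (h - \<phi>) / sin (h - l)) * cis l + of_real (sin (\<phi> - l) / sin (h - l)) * cis h"
      using s by (simp add: field_simps)
    hence "- \<i> * cis \<phi> = of_real (sin (h - \<phi>) / sin (h - l)) * (- \<i> * cis l) + of_real (sin (\<phi> - l) / sin (h - l)) * (- \<i> * cis h)"
      by (simp add: algebra_simps)
    thus "- \<i> * cis \<phi> = of_real (sin (h - \<phi>) / (sin (h - l) * x)) * b + of_real (sin (\<phi> - l) / (sin (h - l) * y)) * c"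
      unfolding b c using pos by simp
  qed
  moreover have "- (pi / 2 - pi * \<kappa>) \<le> l" "h \<le> pi / 2 - pi * \<kappa>" using l(2) h(2) by auto
  ultimately show thesis using that hl by blast
qed

lemma disjoint_open_intervals:
  fixes l h l' h' :: real
  assumes "l < h" "l' < h'" "\<And>x. \<lbrakk>l < x; x < h; l' < x; x < h'\<rbrakk> \<Longrightarrow> False"
  shows "h \<le> l' \<or> h' \<le> l"
proof (rule ccontr)
  assume "\<not> ?thesis"
  hence "max l l' < min h h'" using assms by auto
  then obtain x where "max l l' < x" "x < min h h'" using dense by blast
  thus False using assms(3)[of x] by auto
qed

definition angle_at :: "real \<Rightarrow> real \<Rightarrow> real \<Rightarrow> tile \<Rightarrow> complex \<Rightarrow> real \<Rightarrow> bool" where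
  "angle_at \<alpha> \<beta> \<gamma> = (\<lambda>(A, B, C) P \<theta>. P = A \<and> \<theta> = \<alpha> \<or> P = B \<and> \<theta> = \<beta> \<or> P = C \<and> \<theta> = \<gamma>)"

context conjugate_tiling
begin

text \<open>The edge vectors \<open>b\<close> and \<open>d\<close> at the top are ordered so that
  the rotation from \<open>b\<close> to \<open>d\<close>, up to real factors, is by
  \<open>k * x\<close> counterclockwise; for a clockwise tile they are exchanged. Their orientation
  is then \<open>eps\<close> in both cases.\<close>

lemma image_sector_first:
  assumes t: "triangle_with_angles x y z (A, B, C)"
    and x: "\<exists>a::int. x = pi * of_int a / real n" and y: "\<exists>a::int. y = pi * of_int a / real n"
    and z: "\<exists>a::int. z = pi * of_int a / real n"
    and A: "\<Phi> A = \<i>" and sg: "tile_sign (map_tile \<Phi> (A, B, C)) = tile_sign (A, B, C) * eps" "eps = 1 \<or> eps = - 1"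
  shows "\<exists>b d r r'. eps * Im (cnj b * d) > 0 \<and> of_real r * d = cis (real k * x) * (of_real r' * b) \<and> r \<noteq> 0 \<and>
    (\<forall>p q. 0 < p \<longrightarrow> 0 < q \<longrightarrow> p + q < 1 \<longrightarrow> covers (A, B, C) (\<i> + of_real p * b + of_real q * d))"
proof -
  note tr = triangle_relations[OF t]
  have "y < pi" "z < pi" using tr by simp_all
  hence "sin y \<noteq> 0" "sin z \<noteq> 0" using tr sin_gt_zero by (metis less_irrefl)+
  hence nz: "sin (real k * y) \<noteq> 0" "sin (real k * z) \<noteq> 0" using y z sin_scaled_nonzero by metis+
  define D where "D = orient \<i> (\<Phi> B) (\<Phi> C)"
  define b where "b = \<Phi> B - \<i>"
  define d where "d = \<Phi> C - \<i>"
  have rel: "of_real (sin (real k * z)) * d = cis (sgn (orient A B C) * (real k * x)) * (of_real (sin (real k * y)) * b)"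
    using image_relation[OF t x y z] by (simp only: A b_def d_def)
  have sD: "sgn D = sgn (orient A B C) * eps" using sg(1) by (simp add: tile_sign_def map_tile_def A D_def)
  have s: "sgn (orient A B C) = 1 \<or> sgn (orient A B C) = - 1" using tr(6) by (auto simp: sgn_real_def)
  have D0: "D \<noteq> 0" using sD s sg(2) by auto
  have Dbc: "D = Im (cnj b * d)" by (simp only: D_def orient_def b_def d_def)
  have inside: "covers (A, B, C) (\<i> + of_real p * b + of_real q * d)"
    if "0 < p" "0 < q" "p + q < 1" for p q
  proof -
    define x where "x = \<i> + of_real p * b + of_real q * d"
    have o1: "orient \<i> (\<Phi> B) x = q * D" unfolding x_def b_def d_def D_def by (rule orient_add_scaled)
    have o2: "orient (\<Phi> C) \<i> x = p * D" unfolding x_def b_def d_def D_def by (simp add: orient_coords algebra_simps)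
    have o3: "orient (\<Phi> B) (\<Phi> C) x = (1 - p - q) * D"
      using orient_sum[of "\<Phi> B" "\<Phi> C" x \<i>] unfolding o1 o2 by (simp add: D_def[symmetric] algebra_simps)
    have DD: "D * D > 0" using D0 by (auto simp: zero_less_mult_iff linorder_neq_iff)
    have "D * (w * D) > 0" if "w > 0" for w :: real
      using mult_pos_pos[OF that DD] by (simp add: mult.left_commute)
    thus ?thesis using that o1 o2 o3
      by (simp add: strictly_inside_def map_tile_def A D_def[symmetric] x_def[symmetric])
  qed
  show ?thesis using s
  proof
    assume 1: "sgn (orient A B C) = 1"
    hence "sgn D = eps" using sD by simp
    hence "eps * Im (cnj b * d) > 0" using D0 unfolding Dbc[symmetric] by (metis mult_sgn_abs sgn_zero_iff abs_sgn zero_less_abs_iff mult.commute)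
    moreover have "of_real (sin (real k * z)) * d = cis (real k * x) * (of_real (sin (real k * y)) * b)"
      using rel 1 by simp
    ultimately show ?thesis using inside nz by blast
  next
    assume 1: "sgn (orient A B C) = - 1"
    hence "sgn (- D) = eps" using sD by (simp add: sgn_minus)
    moreover have "- D = Im (cnj d * b)" unfolding Dbc by simp
    ultimately have "eps * Im (cnj d * b) > 0" using D0
      by (metis mult_sgn_abs sgn_zero_iff abs_sgn zero_less_abs_iff mult.commute neg_equal_0_iff_equal)
    moreover have "of_real (sin (real k * y)) * b = cis (real k * x) * (of_real (sin (real k * z)) * d)"
    proof -
      have "cis (real k * x) * (of_real (sin (real k * z)) * d) = (cis (real k * x) * cis (- (real k * x))) * (of_real (sin (real k * y)) * b)"
        unfolding rel using 1 by (simp add: mult_ac)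
      thus ?thesis by (simp add: cis_mult)
    qed
    moreover have "covers (A, B, C) (\<i> + of_real p * d + of_real q * b)"
      if "0 < p" "0 < q" "p + q < 1" for p q
      using inside[of q p] that by (simp add: add_ac)
    ultimately show ?thesis using nz by blast
  qed
qed

lemma image_sector:
  assumes t: "t \<in> T" and at: "angle_at \<alpha> \<beta> \<gamma> t (V j0) \<theta>"
  obtains b d r r' where "eps * Im (cnj b * d) > 0" "of_real r * d = cis (real k * \<theta>) * (of_real r' * b)" "r \<noteq> 0"
    "\<And>p q. \<lbrakk>0 < p; 0 < q; p + q < 1\<rbrakk> \<Longrightarrow> covers t (\<i> + of_real p * b + of_real q * d)"
proof -
  obtain A B C where ABC: "t = (A, B, C)" by (cases t) auto
  have tr: "triangle_with_angles \<alpha> \<beta> \<gamma> (A, B, C)" using tiling t unfolding is_tiling_def ABC by blast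
  note tr2 = triangle_with_angles_rotate[OF tr]
  note tr3 = triangle_with_angles_rotate[OF tr2]
  have sg: "tile_sign (map_tile \<Phi> (A, B, C)) = tile_sign (A, B, C) * eps" using image_sign[OF t] unfolding ABC .
  have sg2: "tile_sign (map_tile \<Phi> (B, C, A)) = tile_sign (B, C, A) * eps"
    using sg by (simp add: tile_sign_def map_tile_def orient_cyclic)
  have sg3: "tile_sign (map_tile \<Phi> (C, A, B)) = tile_sign (C, A, B) * eps"
    using sg2 by (simp add: tile_sign_def map_tile_def orient_cyclic)
  have top: "\<Phi> (V j0) = \<i>" by (simp add: \<Phi>_vertex)
  have in2: "covers (B, C, A) x = covers (A, B, C) x" for x
    unfolding map_tile_def prod.case by (rule inside_rotate)
  have in3: "covers (C, A, B) x = covers (A, B, C) x" for x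
    unfolding map_tile_def prod.case by (rule inside_rotate[symmetric])
  consider "V j0 = A" "\<theta> = \<alpha>" | "V j0 = B" "\<theta> = \<beta>" | "V j0 = C" "\<theta> = \<gamma>"
    using at unfolding angle_at_def ABC by auto
  thus thesis
  proof cases
    case 1
    with image_sector_first[OF tr angles(1,2,3) _ sg eps_cases[OF t]] top show thesis
      using that unfolding ABC by metis
  next
    case 2
    with image_sector_first[OF tr2 angles(2,3,1) _ sg2 eps_cases[OF t]] top show thesis
      using that unfolding ABC in2 by metis
  next
    case 3
    with image_sector_first[OF tr3 angles(3,1,2) _ sg3 eps_cases[OF t]] top show thesis
      using that unfolding ABC in3 by metis
  qed
qed

section \<open>Counting image triangles near the top\<close>

definition near_top :: "complex set" where
  "near_top = {x. cos \<delta> < Im x \<and> \<bar>Re x\<bar> < sin (real k * \<delta>)}"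

lemma open_near_top: "open near_top"
  unfolding near_top_def by (intro open_Collect_conj open_Collect_less continuous_intros)

lemma top_near: "\<i> \<in> near_top"
proof -
  have "cos \<delta> < cos 0" using \<delta>_bounds by (intro cos_monotone_0_pi) auto
  thus ?thesis using k(2) by (simp add: near_top_def)
qed

lemma near_top_ray:
  obtains \<rho> :: real where "\<rho> > 0" "\<rho> * s < 1" "\<rho> * s' < 1" "\<i> + of_real \<rho> * v \<in> near_top"
proof -
  have "((\<lambda>\<rho>. \<i> + of_real \<rho> * v) \<longlongrightarrow> \<i> + of_real 0 * v) (at_right 0)" by (intro tendsto_intros)
  hence e1: "\<forall>\<^sub>F \<rho> in at_right 0. \<i> + of_real \<rho> * v \<in> near_top"
    using open_near_top top_near by (auto dest: topological_tendstoD)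
  have e: "\<forall>\<^sub>F \<rho> in at_right 0. \<rho> * r < 1" for r :: real
  proof -
    have "((\<lambda>\<rho>. \<rho> * r) \<longlongrightarrow> 0 * r) (at_right 0)" by (intro tendsto_intros)
    from order_tendstoD(2)[OF this, of 1] show ?thesis by simp
  qed
  have "\<forall>\<^sub>F \<rho> in at_right 0. \<rho> > 0 \<and> \<rho> * s < 1 \<and> \<rho> * s' < 1 \<and> \<i> + of_real \<rho> * v \<in> near_top"
    using e1 e[of s] e[of s'] eventually_at_right_less[of "0::real"] by eventually_elim auto
  from eventually_happens'[OF _ this] that show thesis by auto
qed

lemma finite_T: "finite T"
  using tiling by (simp add: is_tiling_def)

text \<open>The counting formula holds at generic points only. The conditions to which it is applied
  are open, so any point satisfying them can be exchanged for a generic one.\<close>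

lemma generic_near_top:
  assumes "open U" "x \<in> U" "x \<in> near_top"
  obtains y where "y \<in> U" "eps * cover_count y = of_bool (Im y < 1 - \<tau> * \<bar>Re y\<bar>)"
proof -
  have sg: "tile_sign s \<noteq> 0" if "s \<in> map_tile \<Phi> ` T" for s
    using that image_sign tiling_tile_sign[OF tiling] eps_cases by fastforce
  have U: "open (U \<inter> near_top)" "U \<inter> near_top \<noteq> {}" using assms open_near_top by auto
  obtain y where y: "y \<in> U \<inter> near_top" "Re y \<noteq> 0" "\<And>s. s \<in> map_tile \<Phi> ` T \<Longrightarrow> generic s y"
    using generic_point[OF finite_imageI[OF finite_T] sg U] by blast
  have "\<forall>t\<in>T. generic (map_tile \<Phi> t) y" using y(3) by blast
  from image_crossings_count[OF this] image_polygon_winding[of y] y(1,2) that[of y]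
  show thesis by (auto simp: near_top_def)
qed

lemma count_ge_1:
  assumes "t \<in> T" "covers t y"
  shows "cover_count y \<ge> (1::real)"
proof -
  have "(\<Sum>t\<in>{t}. of_bool (covers t y)) \<le> cover_count y"
    using finite_T assms by (intro sum_mono2) auto
  thus ?thesis using assms by simp
qed

text \<open>The image of a tile at the vertex covers points near the top. There the count is
  positive, while \<open>eps\<close> times the count is an indicator and so not negative.\<close>

lemma eps_1:
  assumes t: "t \<in> T" and at: "angle_at \<alpha> \<beta> \<gamma> t (V j0) \<theta>"
  shows "eps = 1"
proof -
  obtain b d where bc: "\<And>p q. \<lbrakk>0 < p; 0 < q; p + q < 1\<rbrakk> \<Longrightarrow> covers t (\<i> + of_real p * b + of_real q * d)"
    using image_sector[OF t at] by metis
  obtain \<rho> :: real where \<rho>: "\<rho> > 0" "\<rho> * 2 < 1" "\<i> + of_real \<rho> * (b + d) \<in> near_top" using near_top_ray by metis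
  have "covers t (\<i> + of_real \<rho> * (b + d))"
    using bc[of \<rho> \<rho>] \<rho> by (simp add: algebra_simps)
  hence "\<i> + of_real \<rho> * (b + d) \<in> {x. covers t x}" by simp
  from generic_near_top[OF open_strictly_inside this \<rho>(3)] obtain y where
    y: "covers t y" "eps * cover_count y = of_bool (Im y < 1 - \<tau> * \<bar>Re y\<bar>)"
    by blast
  have "cover_count y \<ge> (1::real)" using count_ge_1[OF t y(1)] .
  thus ?thesis using y(2) eps_cases[OF t] by (auto simp: of_bool_def split: if_splits)
qed

lemma image_tile_below:
  assumes t: "t \<in> T" and x: "x \<in> near_top" "covers t x"
  shows "Im x \<le> 1 - \<tau> * \<bar>Re x\<bar>"
proof (rule ccontr)
  assume neg: "\<not> ?thesis"
  define U where "U = {x. covers t x} \<inter> {x. 1 - \<tau> * \<bar>Re x\<bar> < Im x}"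
  have "open U" unfolding U_def
    by (intro open_Int open_strictly_inside open_Collect_less continuous_intros)
  moreover have "x \<in> U" using x neg by (simp add: U_def)
  ultimately obtain y where y: "y \<in> U"
    "eps * cover_count y = of_bool (Im y < 1 - \<tau> * \<bar>Re y\<bar>)"
    using generic_near_top[OF _ _ x(1)] by blast
  have yU: "covers t y" "1 - \<tau> * \<bar>Re y\<bar> < Im y" using y(1) by (auto simp: U_def)
  have "of_bool (Im y < 1 - \<tau> * \<bar>Re y\<bar>) = (0::real)" using yU(2) by simp
  hence "eps * cover_count y = 0" using y(2) by (simp only:)
  moreover have "eps \<noteq> 0" using eps_cases[OF t] by auto
  ultimately have "cover_count y = (0::real)" by (metis mult_eq_0_iff)
  thus False using count_ge_1[OF t yU(1)] by linarith
qed

lemma image_tiles_disjoint: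
  assumes t: "t \<in> T" "t' \<in> T" "t \<noteq> t'" and x: "x \<in> near_top"
    "covers t x" "covers t' x"
  shows False
proof -
  define U where "U = {x. covers t x} \<inter> {x. covers t' x}"
  have "open U" unfolding U_def by (intro open_Int open_strictly_inside)
  moreover have "x \<in> U" using x by (simp add: U_def)
  ultimately obtain y where y: "y \<in> U"
    "eps * cover_count y = of_bool (Im y < 1 - \<tau> * \<bar>Re y\<bar>)"
    using generic_near_top[OF _ _ x(1)] by blast
  have yU: "covers t y" "covers t' y" using y(1) by (auto simp: U_def)
  have "(\<Sum>t\<in>{t, t'}. of_bool (covers t y)) \<le> cover_count y"
    using finite_T t by (intro sum_mono2) auto
  hence "cover_count y \<ge> 2" using yU t(3) by simp
  thus False using y(2) eps_cases[OF t(1)] by (auto simp: of_bool_def split: if_splits)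
qed

lemma half_angle:
  defines "\<kappa> \<equiv> frac (real k / real N)"
  shows "0 < \<kappa>" "\<kappa> < 1 / 2" "\<tau> * cos (pi * \<kappa>) = sin (pi * \<kappa>)"
proof -
  have "real k * \<delta> = 2 * (pi * \<kappa>) + 2 * pi * of_int \<lfloor>real k / real N\<rfloor>"
    by (simp add: \<kappa>_def frac_def \<delta>_def algebra_simps)
  hence e: "sin (real k * \<delta>) = sin (2 * (pi * \<kappa>))" "cos (real k * \<delta>) = cos (2 * (pi * \<kappa>))"
    by (simp_all add: sin_add cos_add)
  have \<kappa>: "0 \<le> \<kappa>" "\<kappa> < 1" by (auto simp: \<kappa>_def frac_lt_1)
  have s: "sin (2 * (pi * \<kappa>)) > 0" using k(2) e by simp
  show "0 < \<kappa>" using \<kappa> s by (cases "\<kappa> = 0") auto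
  show "\<kappa> < 1 / 2"
  proof (rule ccontr)
    assume "\<not> ?thesis"
    hence "pi \<le> 2 * (pi * \<kappa>)" "2 * (pi * \<kappa>) < 2 * pi" using \<kappa> by (auto simp: field_simps)
    hence "sin (2 * (pi * \<kappa>)) \<le> 0" by (intro sin_le_zero)
    thus False using s by simp
  qed
  have s2: "sin (2 * (pi * \<kappa>)) = 2 * sin (pi * \<kappa>) * cos (pi * \<kappa>)" by (rule sin_double)
  have c2: "1 - cos (2 * (pi * \<kappa>)) = 2 * sin (pi * \<kappa>) * sin (pi * \<kappa>)"
    by (simp add: cos_double_sin power2_eq_square)
  have "sin (pi * \<kappa>) \<noteq> 0" "cos (pi * \<kappa>) \<noteq> 0" using s s2 by auto
  thus "\<tau> * cos (pi * \<kappa>) = sin (pi * \<kappa>)" unfolding \<tau>_def e c2 s2 by simp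
qed

text \<open>Points of the sector close to the top lie under the roof, and shrinking towards the top
  turns this into a homogeneous inequality. The rays \<open>b\<close> and \<open>d\<close> are
  limits of rays inside the sector.\<close>

lemma sector_in_cone:
  assumes t: "t \<in> T"
    and bc: "\<And>p q. \<lbrakk>0 < p; 0 < q; p + q < 1\<rbrakk> \<Longrightarrow> covers t (\<i> + of_real p * b + of_real q * d)"
  shows "Im b \<le> - \<tau> * \<bar>Re b\<bar>" "Im d \<le> - \<tau> * \<bar>Re d\<bar>"
proof -
  have cone: "Im (of_real p * b + of_real q * d) \<le> - \<tau> * \<bar>Re (of_real p * b + of_real q * d)\<bar>"
    if "p > 0" "q > 0" for p q
  proof -
    define v where "v = of_real p * b + of_real q * d"
    obtain \<rho> :: real where \<rho>: "\<rho> > 0" "\<rho> * (p + q) < 1" "\<i> + of_real \<rho> * v \<in> near_top" using near_top_ray by metis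
    have "covers t (\<i> + of_real \<rho> * v)"
      using bc[of "\<rho> * p" "\<rho> * q"] \<rho> that by (simp add: v_def algebra_simps)
    from image_tile_below[OF t \<rho>(3) this]
    have "\<rho> * Im v \<le> \<rho> * (- \<tau> * \<bar>Re v\<bar>)" using \<rho>(1) by (simp add: abs_mult algebra_simps)
    thus ?thesis using mult_le_cancel_left_pos[OF \<rho>(1)] unfolding v_def[symmetric] by blast
  qed
  have lim: "Im b \<le> - \<tau> * \<bar>Re b\<bar>"
    if "\<And>q. q > 0 \<Longrightarrow> Im (b + of_real q * d) \<le> - \<tau> * \<bar>Re (b + of_real q * d)\<bar>" for b d
  proof -
    have "((\<lambda>q. Im (b + of_real q * d)) \<longlongrightarrow> Im (b + of_real 0 * d)) (at_right 0)"
      "((\<lambda>q. - \<tau> * \<bar>Re (b + of_real q * d)\<bar>) \<longlongrightarrow> - \<tau> * \<bar>Re (b + of_real 0 * d)\<bar>) (at_right 0)"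
      by (intro tendsto_intros)+
    moreover have "\<forall>\<^sub>F q in at_right 0. Im (b + of_real q * d) \<le> - \<tau> * \<bar>Re (b + of_real q * d)\<bar>"
      using eventually_at_right_less[of "0::real"] by (rule eventually_mono) (rule that)
    ultimately have "Im (b + of_real 0 * d) \<le> - \<tau> * \<bar>Re (b + of_real 0 * d)\<bar>"
      using tendsto_le[OF trivial_limit_at_right_real] by blast
    thus ?thesis by simp
  qed
  show "Im b \<le> - \<tau> * \<bar>Re b\<bar>" by (rule lim[of b d]) (use cone[of 1] in auto)
  show "Im d \<le> - \<tau> * \<bar>Re d\<bar>" by (rule lim[of d b]) (use cone[of _ 1] in \<open>auto simp: add.commute\<close>)
qed

lemma vertex_interval:
  assumes t: "t \<in> T" and at: "angle_at \<alpha> \<beta> \<gamma> t (V j0) \<theta>"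
  defines "H \<equiv> pi / 2 - pi * frac (real k / real N)"
  obtains l h where "l < h" "h - l = pi * frac (real k * \<theta> / pi)" "- H \<le> l" "h \<le> H"
    "\<And>\<phi>. \<lbrakk>l < \<phi>; \<phi> < h\<rbrakk> \<Longrightarrow> \<exists>\<rho>0>0. \<forall>\<rho>. 0 < \<rho> \<longrightarrow> \<rho> * \<rho>0 < 1 \<longrightarrow> covers t (\<i> + of_real \<rho> * (- \<i> * cis \<phi>))"
proof -
  obtain b d r r' where bc: "eps * Im (cnj b * d) > 0" "of_real r * d = cis (real k * \<theta>) * (of_real r' * b)" "r \<noteq> 0"
    "\<And>p q. \<lbrakk>0 < p; 0 < q; p + q < 1\<rbrakk> \<Longrightarrow> covers t (\<i> + of_real p * b + of_real q * d)"
    using image_sector[OF t at] by metis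
  have pos: "Im (cnj b * d) > 0" using bc(1) eps_1[OF t at] by simp
  have cone: "Im b \<le> - \<tau> * \<bar>Re b\<bar>" "Im d \<le> - \<tau> * \<bar>Re d\<bar>"
    using sector_in_cone[OF t, of b d] bc(4) by blast+
  obtain l h where lh: "l < h" "h - l = pi * frac (real k * \<theta> / pi)" "- H \<le> l" "h \<le> H"
    "\<And>\<phi>. \<lbrakk>l < \<phi>; \<phi> < h\<rbrakk> \<Longrightarrow> \<exists>p q. p > 0 \<and> q > 0 \<and> - \<i> * cis \<phi> = of_real p * b + of_real q * d"
    using sector_interval[OF pos cone bc(2,3) half_angle] unfolding H_def by metis
  have "\<exists>\<rho>0>0. \<forall>\<rho>. 0 < \<rho> \<longrightarrow> \<rho> * \<rho>0 < 1 \<longrightarrow> covers t (\<i> + of_real \<rho> * (- \<i> * cis \<phi>))"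
    if \<phi>: "l < \<phi>" "\<phi> < h" for \<phi>
  proof -
    obtain p q where pq: "p > 0" "q > 0" "- \<i> * cis \<phi> = of_real p * b + of_real q * d" using lh(5)[OF \<phi>] by blast
    show ?thesis
    proof (intro exI[of _ "p + q"] conjI allI impI)
      fix \<rho> :: real assume "0 < \<rho>" "\<rho> * (p + q) < 1"
      thus "covers t (\<i> + of_real \<rho> * (- \<i> * cis \<phi>))"
        unfolding pq(3) using bc(4)[of "\<rho> * p" "\<rho> * q"] pq(1,2) by (simp add: algebra_simps)
    qed (use pq in auto)
  qed
  thus thesis using that lh(1-4) by blast
qed

text \<open>A direction common to two of the sectors would give points near the top covered twice.
  So three disjoint intervals fit into one of length \<open>2 * H\<close>.\<close>

theorem vertex_angles_conjugate_le:
  assumes t: "t1 \<in> T" "t2 \<in> T" "t3 \<in> T" "t1 \<noteq> t2" "t2 \<noteq> t3" "t1 \<noteq> t3"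
    and at: "angle_at \<alpha> \<beta> \<gamma> t1 (V j0) \<theta>1" "angle_at \<alpha> \<beta> \<gamma> t2 (V j0) \<theta>2" "angle_at \<alpha> \<beta> \<gamma> t3 (V j0) \<theta>3"
  shows "frac (real k * \<theta>1 / pi) + frac (real k * \<theta>2 / pi) + frac (real k * \<theta>3 / pi) \<le> 1 - 2 * frac (real k / real N)"
proof -
  define H where "H = pi / 2 - pi * frac (real k / real N)"
  define I where "I t \<phi> \<longleftrightarrow> (\<exists>\<rho>0>0. \<forall>\<rho>. 0 < \<rho> \<longrightarrow> \<rho> * \<rho>0 < 1 \<longrightarrow> covers t (\<i> + of_real \<rho> * (- \<i> * cis \<phi>)))" for t \<phi>
  have dis: False if s: "s \<in> T" "s' \<in> T" "s \<noteq> s'" "I s \<phi>" "I s' \<phi>" for s s' \<phi>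
  proof -
    obtain r where r: "\<And>\<rho>. \<lbrakk>0 < \<rho>; \<rho> * r < 1\<rbrakk> \<Longrightarrow> covers s (\<i> + of_real \<rho> * (- \<i> * cis \<phi>))"
      using s(4) unfolding I_def by blast
    obtain r' where r': "\<And>\<rho>. \<lbrakk>0 < \<rho>; \<rho> * r' < 1\<rbrakk> \<Longrightarrow> covers s' (\<i> + of_real \<rho> * (- \<i> * cis \<phi>))"
      using s(5) unfolding I_def by blast
    obtain \<rho> :: real where "\<rho> > 0" "\<rho> * r < 1" "\<rho> * r' < 1" "\<i> + of_real \<rho> * (- \<i> * cis \<phi>) \<in> near_top"
      using near_top_ray by blast
    thus False using image_tiles_disjoint[OF s(1-3)] r r' by blast
  qed
  obtain l1 h1 where 1: "l1 < h1" "h1 - l1 = pi * frac (real k * \<theta>1 / pi)" "- H \<le> l1" "h1 \<le> H" "\<And>\<phi>. \<lbrakk>l1 < \<phi>; \<phi> < h1\<rbrakk> \<Longrightarrow> I t1 \<phi>"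
    using vertex_interval[OF t(1) at(1)] unfolding H_def I_def by metis
  obtain l2 h2 where 2: "l2 < h2" "h2 - l2 = pi * frac (real k * \<theta>2 / pi)" "- H \<le> l2" "h2 \<le> H" "\<And>\<phi>. \<lbrakk>l2 < \<phi>; \<phi> < h2\<rbrakk> \<Longrightarrow> I t2 \<phi>"
    using vertex_interval[OF t(2) at(2)] unfolding H_def I_def by metis
  obtain l3 h3 where 3: "l3 < h3" "h3 - l3 = pi * frac (real k * \<theta>3 / pi)" "- H \<le> l3" "h3 \<le> H" "\<And>\<phi>. \<lbrakk>l3 < \<phi>; \<phi> < h3\<rbrakk> \<Longrightarrow> I t3 \<phi>"
    using vertex_interval[OF t(3) at(3)] unfolding H_def I_def by metis
  have d: "h1 \<le> l2 \<or> h2 \<le> l1"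
    using disjoint_open_intervals[OF 1(1) 2(1)] dis[OF t(1,2,4) 1(5) 2(5)] by metis
  have e: "h2 \<le> l3 \<or> h3 \<le> l2"
    using disjoint_open_intervals[OF 2(1) 3(1)] dis[OF t(2,3,5) 2(5) 3(5)] by metis
  have f: "h1 \<le> l3 \<or> h3 \<le> l1"
    using disjoint_open_intervals[OF 1(1) 3(1)] dis[OF t(1,3,6) 1(5) 3(5)] by metis
  have "(h1 - l1) + (h2 - l2) + (h3 - l3) \<le> 2 * H"
    using d e f 1(1,3,4) 2(1,3,4) 3(1,3,4) by linarith
  hence "pi * (frac (real k * \<theta>1 / pi) + frac (real k * \<theta>2 / pi) + frac (real k * \<theta>3 / pi)) \<le> pi * (1 - 2 * frac (real k / real N))"
    unfolding 1(2) 2(2) 3(2) H_def by (simp add: algebra_simps)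
  thus ?thesis by (simp only: mult_le_cancel_left_pos[OF pi_gt_zero])
qed

end

section \<open>Conclusion\<close>

context rational_tiling
begin

lemma vertex_angles_le:
  assumes k: "coprime k (2 * n)" "sin (real k * \<delta>) > 0" and j0: "j0 \<in> {1..N}"
    and t: "t1 \<in> T" "t2 \<in> T" "t3 \<in> T" "t1 \<noteq> t2" "t2 \<noteq> t3" "t1 \<noteq> t3"
    and at: "angle_at \<alpha> \<beta> \<gamma> t1 (V j0) \<theta>1" "angle_at \<alpha> \<beta> \<gamma> t2 (V j0) \<theta>2" "angle_at \<alpha> \<beta> \<gamma> t3 (V j0) \<theta>3"
  shows "frac (real k * \<theta>1 / pi) + frac (real k * \<theta>2 / pi) + frac (real k * \<theta>3 / pi) \<le> 1 - 2 * frac (real k / real N)"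
proof -
  \<comment> \<open>The number 1 protects the polygon, and one normalised side length protects each
    tile. The modulus \<open>2 * n\<close> below belongs to the root of unity with argument
    pi/n.\<close>
  define S where "S = insert 1 ((\<lambda>(A, B, C). cmod (B - A) / cmod w) ` T)"
  have "finite S" using tiling by (simp add: S_def is_tiling_def)
  moreover have "0 \<notin> S"
  proof
    assume "0 \<in> S"
    then obtain A B C where t: "(A, B, C) \<in> T" and "A = B" using w0 by (auto simp: S_def)
    thus False using tiling_tile_sign[OF tiling t] by (simp add: tile_sign_def orient_coords)
  qed
  moreover have "2 * n > 0" using n by simp
  ultimately obtain \<Psi> where \<Psi>: "\<And>x y. \<Psi> (x + y) = \<Psi> x + \<Psi> y"
    "\<And>x. \<Psi> (cis (2 * pi / real (2 * n)) * x) = cis (2 * pi * real k / real (2 * n)) * \<Psi> x"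
    "\<And>r. \<Psi> (of_real r) \<in> \<real>" "\<And>s. s \<in> S \<Longrightarrow> \<Psi> (of_real s) \<noteq> 0"
    using conjugation_map[of "2 * n" k S] k(1) by metis
  interpret conjugate_tiling N c w \<alpha> \<beta> \<gamma> T n k j0 \<Psi>
  proof unfold_locales
    show "\<Psi> (cis (pi / real n) * x) = cis (pi * real k / real n) * \<Psi> x" for x using \<Psi>(2)[of x] by simp
    show "\<Psi> 1 \<noteq> 0" using \<Psi>(4)[of 1] by (simp add: S_def)
    show "\<Psi> (of_real (cmod (B - A) / cmod w)) \<noteq> 0" if "(A, B, C) \<in> T" for A B C
    proof (rule \<Psi>(4))
      show "cmod (B - A) / cmod w \<in> S" unfolding S_def using that by force
    qed
  qed (use k j0 \<Psi> in auto)
  show ?thesis using vertex_angles_conjugate_le[OF t at] .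
qed

lemma scaled_angle_not_int:
  assumes k: "coprime k (int (2 * n))" and \<theta>: "\<exists>a::int. \<theta> = pi * of_int a / real n" "0 < \<theta>" "\<theta> < pi"
  shows "of_int k * (\<theta> / pi) \<notin> \<int>"
proof
  assume "of_int k * (\<theta> / pi) \<in> \<int>"
  then obtain m :: int where m: "of_int k * (\<theta> / pi) = of_int m" by (elim Ints_cases)
  obtain a :: int where a: "\<theta> = pi * of_int a / real n" using \<theta>(1) by blast
  have "real_of_int (k * a) = of_int (m * int n)" using m n(1) unfolding a by (simp add: field_simps)
  hence "k * a = m * int n" by (simp only: of_int_eq_iff)
  hence "int n dvd k * a" by simp
  moreover have "coprime (int n) k" using k by (simp add: coprime_commute)
  ultimately have "int n dvd a" by (simp add: coprime_dvd_mult_right_iff)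
  then obtain l where "a = int n * l" by blast
  hence "\<theta> = pi * of_int l" using a n(1) by simp
  hence "0 < real_of_int l" "real_of_int l < 1" using \<theta>(2,3) by (auto simp: zero_less_mult_iff)
  hence "0 < l" "l < 1" by simp_all
  thus False by simp
qed

text \<open>The third angle makes the inequality strict, as its fractional part is positive. Then
  {ka} + {k/N} < 1/2, so distances to the nearest integer are fractional parts and add without a
  carry.\<close>

lemma two_equal_angles_hexagon:
  assumes \<theta>: "\<exists>a::int. \<theta> = pi * of_int a / real n" "0 < \<theta>" "\<theta> < pi"
    and \<theta>': "\<exists>a::int. \<theta>' = pi * of_int a / real n" "0 < \<theta>'" "\<theta>' < pi"
    and le: "\<And>k. \<lbrakk>coprime k (2 * n); sin (real k * \<delta>) > 0\<rbrakk> \<Longrightarrow>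
      2 * frac (real k * \<theta> / pi) + frac (real k * \<theta>' / pi) \<le> 1 - 2 * frac (real k / real N)"
  shows "N = 6"
proof -
  define a where "a = \<theta> / pi"
  define u where "u = 1 / real N"
  obtain l where l: "n = 2 * N * l" using n(2) by blast
  have Mu: "real (2 * n) * u \<in> \<int>" using N3 by (simp add: l u_def)
  obtain i :: int where i: "\<theta> = pi * of_int i / real n" using \<theta>(1) by blast
  have Ma: "real (2 * n) * a \<in> \<int>" using n(1) by (simp add: a_def i)
  define good where "good k \<longleftrightarrow> dist_int (of_int k * (a + u)) = dist_int (of_int k * a) + dist_int (of_int k * u) \<and>
    dist_int (of_int k * (a + u)) < 1 / 2" for k :: int
  have good_nat: "good (int k)" if k: "coprime k (2 * n)" "sin (real k * \<delta>) > 0" for k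
  proof -
    have "of_int (int k) * (\<theta>' / pi) \<notin> \<int>"
      by (rule scaled_angle_not_int) (use k(1) \<theta>' in \<open>simp_all only: coprime_int_iff\<close>)
    hence pos: "frac (real k * \<theta>' / pi) > 0" by (simp add: frac_gt_0_iff)
    have au: "real k * a = real k * \<theta> / pi" "real k * u = real k / real N" by (simp_all add: a_def u_def)
    have le': "2 * frac (real k * a) + 2 * frac (real k * u) < 1"
      using le[OF k] pos unfolding au by linarith
    have nn: "0 \<le> frac (real k * a)" "0 \<le> frac (real k * u)" by simp_all
    have "dist_int (real k * a) = frac (real k * a)" "dist_int (real k * u) = frac (real k * u)"
      unfolding dist_int_def min_def using le' nn by (simp_all del: frac_ge_0)
    moreover have "dist_int (real k * (a + u)) = frac (real k * a) + frac (real k * u)"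
    proof -
      have "real k * (a + u) - (frac (real k * a) + frac (real k * u)) = of_int (\<lfloor>real k * a\<rfloor> + \<lfloor>real k * u\<rfloor>)"
        by (simp add: frac_def algebra_simps)
      hence "real k * (a + u) - (frac (real k * a) + frac (real k * u)) \<in> \<int>" by (metis Ints_of_int)
      hence "dist_int (real k * (a + u)) = dist_int (frac (real k * a) + frac (real k * u))"
        by (rule dist_int_add_int)
      also have "\<dots> = frac (real k * a) + frac (real k * u)"
        by (rule dist_int_small) (use le' nn in auto)
      finally show ?thesis .
    qed
    ultimately show ?thesis using le' by (simp add: good_def)
  qed
  have shift: "dist_int (of_int k * x) = dist_int (of_int m * x)"
    if x: "real (2 * n) * x \<in> \<int>" and km: "[k = m] (mod int (2 * n))" for x and k m :: int
  proof (rule dist_int_add_int)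
    obtain q where q: "k - m = int (2 * n) * q" using km by (auto simp: cong_iff_dvd_diff)
    have "of_int k * x - of_int m * x = of_int (k - m) * x" by (simp add: algebra_simps)
    also have "\<dots> = of_int q * (real (2 * n) * x)" unfolding q by simp
    also have "\<dots> \<in> \<int>" by (rule Ints_mult[OF Ints_of_int x])
    finally show "of_int k * x - of_int m * x \<in> \<int>" .
  qed
  have Mau: "real (2 * n) * (a + u) \<in> \<int>" using Ints_add[OF Ma Mu] by (simp add: distrib_left)
  have good_cong: "good k" if "good m" "[k = m] (mod int (2 * n))" for k m
    using that(1) shift[OF Ma that(2)] shift[OF Mu that(2)] shift[OF Mau that(2)] by (simp add: good_def)
  have good_minus: "good (- k)" if "good k" for k
    using that dist_int_minus[of "of_int k * a"] dist_int_minus[of "of_int k * u"] dist_int_minus[of "of_int k * (a + u)"]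
    by (simp add: good_def)
  \<comment> \<open>The hypothesis covers natural multipliers; reduction modulo \<open>2 * n\<close>
    extends it to negative ones, which prepares the passage from \<open>k\<close> to
    \<open>-k\<close>.\<close>
  have good_pos: "good k" if k: "coprime k (int (2 * n))" and s: "sin (of_int k * \<delta>) > 0" for k
  proof -
    define m where "m = nat (k mod int (2 * n))"
    have m: "int m = k mod int (2 * n)" using n(1) by (simp add: m_def)
    have c: "[k = int m] (mod int (2 * n))" unfolding m by (simp add: cong_def)
    have "coprime (int m) (int (2 * n))" using k c by (metis cong_imp_coprime)
    hence cm: "coprime m (2 * n)" by (simp only: coprime_int_iff)
    obtain q where q: "k - int m = int (2 * n) * q" using c by (auto simp: cong_iff_dvd_diff)
    have "of_int k * \<delta> = real m * \<delta> + of_int (k - int m) * \<delta>" by (simp add: algebra_simps)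
    also have "of_int (k - int m) * \<delta> = 2 * pi * of_int (4 * int l * q)"
      unfolding q using N3 by (simp add: l \<delta>_def)
    finally have "sin (of_int k * \<delta>) = sin (real m * \<delta>)" by (simp only: sin_add sin_int_2pin cos_int_2pin)
    hence "good (int m)" using good_nat[OF cm] s by simp
    thus ?thesis using good_cong c by blast
  qed
  have not_int: "of_int k * u \<notin> \<int> \<and> sin (of_int k * \<delta>) \<noteq> 0" if k: "coprime k (int (2 * n))" for k
  proof -
    have cN: "coprime (int N) k" using k by (simp add: l coprime_commute)
    have two: "\<not> int N dvd 2 * k"
    proof
      assume "int N dvd 2 * k"
      hence "int N dvd 2" using cN by (simp add: coprime_dvd_mult_left_iff)
      hence "int N \<le> 2" by (intro zdvd_imp_le) auto
      thus False using N3 by simp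
    qed
    have "sin (of_int k * \<delta>) \<noteq> 0"
    proof
      assume "sin (of_int k * \<delta>) = 0"
      then obtain m :: int where "of_int k * \<delta> = of_int m * pi" using sin_zero_iff_int2 by blast
      hence "real_of_int (2 * k) = of_int (int N * m)" using N3 by (simp add: \<delta>_def field_simps)
      hence "2 * k = int N * m" by (simp only: of_int_eq_iff)
      thus False using two by simp
    qed
    moreover have "of_int k * u \<notin> \<int>"
    proof
      assume "of_int k * u \<in> \<int>"
      then obtain m :: int where "of_int k * u = of_int m" by (elim Ints_cases)
      hence "real_of_int k = of_int (int N * m)" using N3 by (simp add: u_def field_simps)
      hence "k = int N * m" by (simp only: of_int_eq_iff)
      thus False using two by simp
    qed
    ultimately show ?thesis by blast
  qed
  have good_all: "good k" if k: "coprime k (int (2 * n))" for k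
  proof (cases "sin (of_int k * \<delta>) > 0")
    case True
    thus ?thesis using good_pos k by blast
  next
    case False
    hence "sin (of_int (- k) * \<delta>) > 0" using not_int[OF k] by simp
    moreover have "coprime (- k) (int (2 * n))" using k by simp
    ultimately show ?thesis using good_minus[of "- k"] good_pos by simp
  qed
  have ku: "of_int k / real N = of_int k * u" for k by (simp add: u_def)
  show ?thesis
  proof (rule additive_distance_orbit[of N "2 * n" a])
    show "N \<ge> 3" by (rule N3)
    show "2 * n > 0" "even (2 * n)" using n by auto
    show "real (2 * n) * a \<in> \<int>" by (rule Ma)
    show "N dvd 2 * n" by (simp add: l)
    fix k assume k: "coprime k (int (2 * n))"
    show "dist_int (of_int k * (a + 1 / real N)) = dist_int (of_int k * a) + dist_int (of_int k / real N)"
      "dist_int (of_int k * (a + 1 / real N)) < 1 / 2"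
      using good_all[OF k] unfolding ku u_def[symmetric] by (simp_all add: good_def)
    have "dist_int (of_int k * a) \<noteq> 0" "dist_int (of_int k / real N) \<noteq> 0"
      unfolding dist_int_eq_0_iff ku using not_int[OF k] scaled_angle_not_int[OF k \<theta>] by (auto simp: a_def)
    thus "dist_int (of_int k * a) > 0" "dist_int (of_int k / real N) > 0"
      using dist_int_bounds(1) by (metis order_le_less)+
  qed
qed

theorem at_most_two_tiles_at_vertex:
  assumes "N \<noteq> 6" and j: "j \<in> {1..N}"
  shows "num_alpha T (V j) + num_beta T (V j) + num_gamma T (V j) \<le> 2"
proof (rule ccontr)
  assume neg: "\<not> ?thesis"
  define P where "P = V j"
  define A B C where "A = {t \<in> T. fst t = P}" and "B = {t \<in> T. fst (snd t) = P}" and "C = {t \<in> T. snd (snd t) = P}"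
  have fin: "finite T" using tiling by (simp add: is_tiling_def)
  have tri: "triangle_with_angles \<alpha> \<beta> \<gamma> t" if "t \<in> T" for t using tiling that by (simp add: is_tiling_def)
  have ne: "fst t \<noteq> fst (snd t) \<and> fst (snd t) \<noteq> snd (snd t) \<and> fst t \<noteq> snd (snd t)" if "t \<in> T" for t
    using tiling_tile_sign[OF tiling that] by (cases t) (auto simp: tile_sign_def orient_coords)
  \<comment> \<open>The corners of a tile are distinct, so no tile is counted under two angles, and
    three counted angles come from three different tiles.\<close>
  have disj: "A \<inter> B = {}" "(A \<union> B) \<inter> C = {}"
    unfolding A_def B_def C_def using ne by fastforce+
  have finABC: "finite A" "finite B" "finite C" using fin by (auto simp: A_def B_def C_def)
  have "card (A \<union> B \<union> C) = card A + card B + card C"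
    using disj finABC by (simp add: card_Un_disjoint)
  also have "\<dots> = num_alpha T P + num_beta T P + num_gamma T P"
    by (simp add: num_alpha_def num_beta_def num_gamma_def A_def B_def C_def)
  finally have "card (A \<union> B \<union> C) \<ge> 3" using neg by (simp add: P_def)
  then obtain W where "W \<subseteq> A \<union> B \<union> C" "card W = 3" by (meson obtain_subset_with_card_n)
  then obtain t1 t2 t3 where W: "W = {t1, t2, t3}" "t1 \<noteq> t2" "t2 \<noteq> t3" "t1 \<noteq> t3"
    using card_3_iff by metis
  have t: "t1 \<in> A \<union> B \<union> C" "t2 \<in> A \<union> B \<union> C" "t3 \<in> A \<union> B \<union> C" "t1 \<noteq> t2" "t2 \<noteq> t3" "t1 \<noteq> t3"
    using \<open>W \<subseteq> A \<union> B \<union> C\<close> W by blast+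
  hence tT: "t1 \<in> T" "t2 \<in> T" "t3 \<in> T" by (auto simp: A_def B_def C_def)
  have ex: "\<exists>\<theta>\<in>{\<alpha>, \<beta>, \<gamma>}. angle_at \<alpha> \<beta> \<gamma> t P \<theta>" if "t \<in> A \<union> B \<union> C" for t
    using that by (cases t) (auto simp: A_def B_def C_def angle_at_def)
  obtain \<theta>1 where 1: "\<theta>1 \<in> {\<alpha>, \<beta>, \<gamma>}" "angle_at \<alpha> \<beta> \<gamma> t1 (V j) \<theta>1" using ex[OF t(1)] unfolding P_def by blast
  obtain \<theta>2 where 2: "\<theta>2 \<in> {\<alpha>, \<beta>, \<gamma>}" "angle_at \<alpha> \<beta> \<gamma> t2 (V j) \<theta>2" using ex[OF t(2)] unfolding P_def by blast
  obtain \<theta>3 where 3: "\<theta>3 \<in> {\<alpha>, \<beta>, \<gamma>}" "angle_at \<alpha> \<beta> \<gamma> t3 (V j) \<theta>3" using ex[OF t(3)] unfolding P_def by blast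
  obtain X Y Z where "t1 = (X, Y, Z)" by (cases t1) auto
  hence "triangle_with_angles \<alpha> \<beta> \<gamma> (X, Y, Z)" using tri[OF tT(1)] by simp
  note r = triangle_relations[OF this]
  have bounds: "(\<exists>a::int. \<theta> = pi * of_int a / real n) \<and> 0 < \<theta> \<and> \<theta> < pi" if "\<theta> \<in> {\<alpha>, \<beta>, \<gamma>}" for \<theta>
    using that r(1-4) angles by auto
  note le = vertex_angles_le[OF _ _ j tT t(4-6) 1(2) 2(2) 3(2)]
  have hex: False if e: "\<theta> \<in> {\<alpha>, \<beta>, \<gamma>}" "\<theta>' \<in> {\<alpha>, \<beta>, \<gamma>}" and
    h: "\<And>k. \<lbrakk>coprime k (2 * n); sin (real k * \<delta>) > 0\<rbrakk> \<Longrightarrow>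
      2 * frac (real k * \<theta> / pi) + frac (real k * \<theta>' / pi) \<le> 1 - 2 * frac (real k / real N)" for \<theta> \<theta>'
    using two_equal_angles_hexagon[of \<theta> \<theta>'] bounds[OF e(1)] bounds[OF e(2)] h \<open>N \<noteq> 6\<close> by blast
  consider "\<theta>1 = \<theta>2" | "\<theta>2 = \<theta>3" | "\<theta>1 = \<theta>3" | "\<theta>1 \<noteq> \<theta>2" "\<theta>2 \<noteq> \<theta>3" "\<theta>1 \<noteq> \<theta>3" by blast
  thus False
  proof cases
    case c: 1
    show False by (rule hex[OF 1(1) 3(1)]) (use le c in force)
  next
    case c: 2
    show False by (rule hex[OF 2(1) 1(1)]) (use le c in force)
  next
    case c: 3
    show False by (rule hex[OF 1(1) 2(1)]) (use le c in force)
  next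
    case 4
    have "\<theta>1 + \<theta>2 + \<theta>3 = pi" using 4 1(1) 2(1) 3(1) r(4) by auto
    moreover have "frac (real 1 * \<theta> / pi) = \<theta> / pi" if "\<theta> \<in> {\<alpha>, \<beta>, \<gamma>}" for \<theta>
    proof -
      have "0 \<le> \<theta> / pi" "\<theta> / pi < 1" using bounds[OF that] by auto
      thus ?thesis by (simp add: frac_eq)
    qed
    ultimately have "frac (real 1 * \<theta>1 / pi) + frac (real 1 * \<theta>2 / pi) + frac (real 1 * \<theta>3 / pi) = 1"
      using 1(1) 2(1) 3(1) by (simp flip: add_divide_distrib)
    moreover have "frac (real 1 / real N) > 0" using N3 by (simp add: frac_eq)
    moreover have "frac (real 1 * \<theta>1 / pi) + frac (real 1 * \<theta>2 / pi) + frac (real 1 * \<theta>3 / pi) \<le> 1 - 2 * frac (real 1 / real N)"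
      by (rule le) (use sin_gt_zero[OF \<delta>_bounds] in simp_all)
    ultimately show False by linarith
  qed
qed

end

lemma rational_multiple_of_pi:
  assumes "x / pi \<in> \<rat>"
  obtains a :: int and b :: nat where "b > 0" "x = pi * of_int a / real b"
proof -
  obtain a b :: int where ab: "b > 0" "x / pi = of_int a / of_int b"
    using assms by (elim Rats_cases')
  have "x = pi * (x / pi)" by simp
  also have "\<dots> = pi * of_int a / real (nat b)" unfolding ab(2) using ab(1) by simp
  finally show thesis using that[of "nat b" a] ab(1) by simp
qed

theorem theorem2:
  fixes N :: nat and c w :: complex and \<alpha> \<beta> \<gamma> :: real and T :: "tile set"
  assumes "N \<ge> 3"
    and "w \<noteq> 0"
    and "is_tiling (regular_ngon N c w) \<alpha> \<beta> \<gamma> T"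
    and "\<alpha> / pi \<in> \<rat>" and "\<beta> / pi \<in> \<rat>" and "\<gamma> / pi \<in> \<rat>"
    and "N \<noteq> 6"
  shows "\<forall>j\<in>{1..N}. num_alpha T (ngon_vertex N c w j) + num_beta T (ngon_vertex N c w j)
           + num_gamma T (ngon_vertex N c w j) \<le> 2"
proof -
  obtain a1 :: int and b1 :: nat where 1: "b1 > 0" "\<alpha> = pi * of_int a1 / real b1"
    using rational_multiple_of_pi assms(4) by blast
  obtain a2 :: int and b2 :: nat where 2: "b2 > 0" "\<beta> = pi * of_int a2 / real b2"
    using rational_multiple_of_pi assms(5) by blast
  obtain a3 :: int and b3 :: nat where 3: "b3 > 0" "\<gamma> = pi * of_int a3 / real b3"
    using rational_multiple_of_pi assms(6) by blast
  define n where "n = 2 * N * (b1 * b2 * b3)"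
  interpret rational_tiling N c w \<alpha> \<beta> \<gamma> T n
  proof unfold_locales
    show "n > 0" "2 * N dvd n" using assms(1) 1(1) 2(1) 3(1) by (auto simp: n_def)
    show "\<exists>a::int. \<alpha> = pi * of_int a / real n"
      using assms(1) 1 2(1) 3(1) by (intro exI[of _ "a1 * int (2 * N * b2 * b3)"]) (simp add: n_def)
    show "\<exists>a::int. \<beta> = pi * of_int a / real n"
      using assms(1) 1(1) 2 3(1) by (intro exI[of _ "a2 * int (2 * N * b1 * b3)"]) (simp add: n_def)
    show "\<exists>a::int. \<gamma> = pi * of_int a / real n"
      using assms(1) 1(1) 2(1) 3 by (intro exI[of _ "a3 * int (2 * N * b1 * b2)"]) (simp add: n_def)
  qed (use assms in auto)
  show ?thesis using at_most_two_tiles_at_vertex[OF assms(7)] by blast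
qed

end
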